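(* For all $x,y\in\mathbb R_+$ and $t\ge0$, $$\mathrm{Cov}\big(f(t,x),f(t,y)\big)=\mathbb E\left[\int_0^t|Q_B^{1/2}Z(s)|_w^2\,Y(s,x+t-s)\,Y(s,y+t-s)\,ds\right],$$ where $f(t,x):=\delta_x(X(t))$ and $Y(s,z):=\delta_z(Y(s))$ for $z\in\mathbb R_+$.
   Context: $(\Omega,\mathcal F,\{\mathcal F_t\}_{t\ge0},\mathbb P)$ is a filtered probability space and $\mathbb R_+=[0,\infty)$. Let $w:\mathbb R_+\to\mathbb R_+$ be measurable and increasing with $w(0)=1$ and $\int_0^\infty w^{-1}(x)\,dx<\infty$. The Filipovic space $H_w$ is the separable Hilbert space of absolutely continuous functions $f:\mathbb R_+\to\mathbb R$ with $|f|_w^2:=f(0)^2+\int_0^\infty w(x)|f'(x)|^2\,dx<\infty$ ($f'$ the weak derivative), with inner product $\langle\cdot,\cdot\rangle_w$ inducing $|\cdot|_w$. The evaluation functional $\delta_x:H_w\to\mathbb R$, $\delta_x(f)=f(x)$, is continuous and linear. Take $H=H_w$. For $f,g\in H_w$, $f\otimes g:=\langle f,\cdot\rangle_w\,g$. $\{W(t)\}_{t\ge0}$ and $\{B(t)\}_{t\ge0}$ are independent $H_w$-valued $\mathcal F_t$-Wiener processes with covariance operators $Q_W$ and $Q_B$ (both symmetric, positive definite, trace class). $\mathcal A$ is a densely defined operator on $H_w$ generating a $C_0$-semigroup $\{\mathcal U(t)\}_{t\ge0}$, $\eta$ is a bounded linear operator on $H_w$, $Y_0\in H_w$, and $Y(t)=\mathcal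 U(t)Y_0+\int_0^t\mathcal U(t-s)\eta\,dW(s)$ is the mild solution of $dY(t)=\mathcal AY(t)\,dt+\eta\,dW(t)$, $Y(0)=Y_0$. $\{Z(t)\}_{t\ge0}$ is an $\mathcal F_t$-adapted $H_w$-valued process with $|Z(t)|_w=1$ for all $t\geq 0$, and $\Gamma_Z(t):=Z(t)\otimes Y(t)$. The processes $Y$ and $Z$ are understood to be measurable in time (predictable), so that the integrals make sense. $\mathcal C=\partial/\partial x$ is the derivative operator on $H_w$, the generator of the left-shift $C_0$-semigroup $\mathcal S(t)f=f(\cdot+t)$ on $H_w$; $X_0\in H_w$, and $X(t)=\mathcal S(t)X_0+\int_0^t\mathcal S(t-s)\Gamma_Z(s)\,dB(s)$ is the mild solution of $dX(t)=\mathcal CX(t)\,dt+\Gamma_Z(t)\,dB(t)$, $X(0)=X_0$. The quantity $f(t,x)=\delta_x(X(t))$ models the forward price at time $t$ with time to delivery $x$. *)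

theory Defs
  imports "HOL-Probability.Probability"
begin

text \<open>
  A function on the half-line is represented by its extension by \<^term>\<open>undefined\<close> to the negative
  reals, i.e. by an element of \<^term>\<open>extensional {0..}\<close>. Absolute continuity on the half-line
  with weak derivative \<open>g\<close> is expressed by \<open>f\<close> being the indefinite Lebesgue integral of the locally
  integrable function \<open>g\<close>.
\<close>

definition has_weak_derivative :: "(real \<Rightarrow> real) \<Rightarrow> (real \<Rightarrow> real) \<Rightarrow> bool" where
  "has_weak_derivative f g \<longleftrightarrow>
     (\<forall>x\<ge>0. set_integrable lborel {0..x} g \<and> f x = f 0 + (LBINT u:{0..x}. g u))"

definition filipovic_weight :: "(real \<Rightarrow> real) \<Rightarrow> bool" where
  "filipovic_weight w \<longleftrightarrow>
     set_borel_measurable borel {0..} w \<and> (\<forall>x\<ge>0. 0 \<le> w x) \<and> mono_on {0..} w \<and> w 0 = 1 \<and>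
     set_integrable lborel {0..} (\<lambda>x. inverse (w x))"

definition filipovic_functions :: "(real \<Rightarrow> real) \<Rightarrow> (real \<Rightarrow> real) set" where
  "filipovic_functions w =
     {f \<in> extensional {0..}.
        \<exists>g. has_weak_derivative f g \<and> set_integrable lborel {0..} (\<lambda>x. w x * (g x)\<^sup>2)}"

text \<open>
  Since types cannot depend on the weight \<open>w\<close>, the Hilbert space \<open>H\<^sub>w\<close> is a type \<open>'h\<close> together with
  evaluation maps \<open>\<delta> x\<close>: every \<open>h\<close> stands for the function \<open>\<lambda>x. \<delta> x h\<close>, this correspondence is a linear
  bijection onto the set of functions above, and the norm of \<open>'h\<close> is the norm of \<open>H\<^sub>w\<close> (by
  polarization, the inner product of \<open>'h\<close> is then that of \<open>H\<^sub>w\<close>).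
\<close>

definition filipovic_space :: "(real \<Rightarrow> real) \<Rightarrow> (real \<Rightarrow> 'h::real_inner \<Rightarrow> real) \<Rightarrow> bool" where
  "filipovic_space w \<delta> \<longleftrightarrow>
     bij_betw (\<lambda>h x. \<delta> x h) UNIV (filipovic_functions w) \<and>
     (\<forall>x\<ge>0. linear (\<delta> x)) \<and>
     (\<forall>h g. has_weak_derivative (\<lambda>x. \<delta> x h) g \<longrightarrow>
        (norm h)\<^sup>2 = (\<delta> 0 h)\<^sup>2 + (LBINT x:{0..}. w x * (g x)\<^sup>2))"

definition tensor :: "'h::real_inner \<Rightarrow> 'h \<Rightarrow> 'h \<Rightarrow>\<^sub>L 'h" where
  "tensor f g = blinfun_scaleR_left g o\<^sub>L blinfun_inner_left f"

lemma tensor_apply: "tensor f g h = (f \<bullet> h) *\<^sub>R g"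
  by (simp add: tensor_def inner_commute)

definition symmetric_op :: "('h::real_inner \<Rightarrow>\<^sub>L 'h) \<Rightarrow> bool" where
  "symmetric_op T \<longleftrightarrow> (\<forall>f g. T f \<bullet> g = f \<bullet> T g)"

definition orthonormal_basis :: "'h::real_inner set \<Rightarrow> bool" where
  "orthonormal_basis E \<longleftrightarrow>
     pairwise orthogonal E \<and> (\<forall>e\<in>E. norm e = 1) \<and> closure (span E) = UNIV"

text \<open>
  For a symmetric positive operator, summability of the diagonal does not depend on the orthonormal
  basis and is equivalent to being trace class.
\<close>

definition covariance_operator :: "('h::real_inner \<Rightarrow>\<^sub>L 'h) \<Rightarrow> bool" where
  "covariance_operator Q \<longleftrightarrow>
     symmetric_op Q \<and> (\<forall>h. h \<noteq> 0 \<longrightarrow> 0 < Q h \<bullet> h) \<and>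
     (\<exists>E. orthonormal_basis E \<and> (\<lambda>e. Q e \<bullet> e) summable_on E)"

text \<open>Every symmetric positive semidefinite operator has exactly one such square root.\<close>

definition op_sqrt :: "('h::real_inner \<Rightarrow>\<^sub>L 'h) \<Rightarrow> 'h \<Rightarrow>\<^sub>L 'h" where
  "op_sqrt Q = (THE R. symmetric_op R \<and> (\<forall>h. 0 \<le> R h \<bullet> h) \<and> R o\<^sub>L R = Q)"

text \<open>The squared Hilbert-Schmidt norm; it does not depend on the chosen basis.\<close>

definition hs_norm_sq :: "('h::real_inner \<Rightarrow>\<^sub>L 'h) \<Rightarrow> ennreal" where
  "hs_norm_sq T = (\<Sum>\<^sub>\<infinity>e\<in>(SOME E. orthonormal_basis E). ennreal ((norm (T e))\<^sup>2))"

definition c0_semigroup :: "(real \<Rightarrow> 'h::real_normed_vector \<Rightarrow>\<^sub>L 'h) \<Rightarrow> bool" where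
  "c0_semigroup U \<longleftrightarrow>
     U 0 = id_blinfun \<and> (\<forall>s\<ge>0. \<forall>t\<ge>0. U (s + t) = U s o\<^sub>L U t) \<and>
     (\<forall>h. ((\<lambda>t. U t h) \<longlongrightarrow> h) (at_right 0))"

definition generates ::
  "'h::real_normed_vector set \<Rightarrow> ('h \<Rightarrow> 'h) \<Rightarrow> (real \<Rightarrow> 'h \<Rightarrow>\<^sub>L 'h) \<Rightarrow> bool" where
  "generates D A U \<longleftrightarrow>
     c0_semigroup U \<and>
     D = {h. \<exists>l. ((\<lambda>t. (U t h - h) /\<^sub>R t) \<longlongrightarrow> l) (at_right 0)} \<and>
     (\<forall>h\<in>D. ((\<lambda>t. (U t h - h) /\<^sub>R t) \<longlongrightarrow> A h) (at_right 0))"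

definition derivative_operator ::
  "(real \<Rightarrow> 'h \<Rightarrow> real) \<Rightarrow> 'h set \<Rightarrow> ('h \<Rightarrow> 'h) \<Rightarrow> bool" where
  "derivative_operator \<delta> D C \<longleftrightarrow>
     D = {h. \<exists>g. \<forall>x\<ge>0. ((\<lambda>u. \<delta> u h) has_real_derivative \<delta> x g) (at x within {0..})} \<and>
     (\<forall>h\<in>D. \<forall>x\<ge>0. ((\<lambda>u. \<delta> u h) has_real_derivative \<delta> x (C h)) (at x within {0..}))"

definition left_shift :: "(real \<Rightarrow> 'h::real_normed_vector \<Rightarrow> real) \<Rightarrow> (real \<Rightarrow> 'h \<Rightarrow>\<^sub>L 'h) \<Rightarrow> bool" where
  "left_shift \<delta> S \<longleftrightarrow> (\<forall>t\<ge>0. \<forall>h. \<forall>x\<ge>0. \<delta> x (S t h) = \<delta> (x + t) h)"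

text \<open>Time is the half-line; values of processes and filtrations at negative times are irrelevant.\<close>

definition is_filtration :: "'o measure \<Rightarrow> (real \<Rightarrow> 'o measure) \<Rightarrow> bool" where
  "is_filtration M F \<longleftrightarrow>
     (\<forall>t\<ge>0. subalgebra M (F t)) \<and> (\<forall>s\<ge>0. \<forall>t\<ge>s. sets (F s) \<subseteq> sets (F t))"

definition adapted :: "(real \<Rightarrow> 'o measure) \<Rightarrow> (real \<Rightarrow> 'o \<Rightarrow> 'h::topological_space) \<Rightarrow> bool" where
  "adapted F X \<longleftrightarrow> (\<forall>t\<ge>0. X t \<in> borel_measurable (F t))"

definition predictable_algebra :: "'o measure \<Rightarrow> (real \<Rightarrow> 'o measure) \<Rightarrow> (real \<times> 'o) measure" where
  "predictable_algebra M F =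
     sigma ({0..} \<times> space M)
       ({{0} \<times> A | A. A \<in> sets (F 0)} \<union> {{s<..t} \<times> A | s t A. 0 \<le> s \<and> s < t \<and> A \<in> sets (F s)})"

definition predictable ::
  "'o measure \<Rightarrow> (real \<Rightarrow> 'o measure) \<Rightarrow> (real \<Rightarrow> 'o \<Rightarrow> 'h::topological_space) \<Rightarrow> bool" where
  "predictable M F X \<longleftrightarrow> (\<lambda>(t, \<omega>). X t \<omega>) \<in> borel_measurable (predictable_algebra M F)"

definition covariance :: "'o measure \<Rightarrow> ('o \<Rightarrow> real) \<Rightarrow> ('o \<Rightarrow> real) \<Rightarrow> real" where
  "covariance M X Y =
     (\<integral>\<omega>. (X \<omega> - (\<integral>\<omega>'. X \<omega>' \<partial>M)) * (Y \<omega> - (\<integral>\<omega>'. Y \<omega>' \<partial>M)) \<partial>M)"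

definition centered_normal :: "real \<Rightarrow> real measure" where
  "centered_normal v =
     (if v = 0 then return borel 0 else density lborel (normal_density 0 (sqrt v)))"

text \<open>
  A random variable with values in a Hilbert space is centered Gaussian with covariance operator
  \<open>(t - s) Q\<close> iff all its one-dimensional projections \<open>\<lambda>X. X \<bullet> h\<close> are centered normal with variance
  \<open>(t - s) (Q h \<bullet> h)\<close>.
\<close>

definition wiener_process ::
  "'o measure \<Rightarrow> (real \<Rightarrow> 'o measure) \<Rightarrow> ('h::{real_inner, second_countable_topology} \<Rightarrow>\<^sub>L 'h) \<Rightarrow>
   (real \<Rightarrow> 'o \<Rightarrow> 'h) \<Rightarrow> bool" where
  "wiener_process M F Q W \<longleftrightarrow>
     (AE \<omega> in M. W 0 \<omega> = 0) \<and>
     (AE \<omega> in M. continuous_on {0..} (\<lambda>t. W t \<omega>)) \<and>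
     adapted F W \<and>
     (\<forall>s\<ge>0. \<forall>t\<ge>s.
        prob_space.indep_set M (sets (F s))
          {(\<lambda>\<omega>. W t \<omega> - W s \<omega>) -` A \<inter> space M | A. A \<in> sets borel} \<and>
        (\<forall>h. distr M borel (\<lambda>\<omega>. (W t \<omega> - W s \<omega>) \<bullet> h) = centered_normal ((t - s) * (Q h \<bullet> h))))"

definition independent_processes ::
  "'o measure \<Rightarrow> (real \<Rightarrow> 'o \<Rightarrow> 'h::topological_space) \<Rightarrow> (real \<Rightarrow> 'o \<Rightarrow> 'h) \<Rightarrow> bool" where
  "independent_processes M W B \<longleftrightarrow>
     prob_space.indep_var M
       (Pi\<^sub>M {0..} (\<lambda>_. borel)) (\<lambda>\<omega>. \<lambda>t\<in>{0..}. W t \<omega>)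
       (Pi\<^sub>M {0..} (\<lambda>_. borel)) (\<lambda>\<omega>. \<lambda>t\<in>{0..}. B t \<omega>)"

text \<open>
  An elementary integrand on \<open>{0..t}\<close> is given by a partition \<open>\<tau> 0 \<le> \<dots> \<le> \<tau> n\<close> and operator-valued
  coefficients: it has the value \<open>c i\<close> on the interval \<open>{\<tau> i<..\<tau> (Suc i)}\<close>, where \<open>c i\<close> takes finitely
  many values and is measurable with respect to \<open>F (\<tau> i)\<close>.
\<close>

definition elementary ::
  "(real \<Rightarrow> 'o measure) \<Rightarrow> real \<Rightarrow> nat \<Rightarrow> (nat \<Rightarrow> real) \<Rightarrow>
   (nat \<Rightarrow> 'o \<Rightarrow> 'h::real_normed_vector \<Rightarrow>\<^sub>L 'h) \<Rightarrow> bool" where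
  "elementary F t n \<tau> c \<longleftrightarrow>
     0 \<le> \<tau> 0 \<and> \<tau> n \<le> t \<and> mono_on {..n} \<tau> \<and> (\<forall>i<n. simple_function (F (\<tau> i)) (c i))"

definition elementary_process ::
  "nat \<Rightarrow> (nat \<Rightarrow> real) \<Rightarrow> (nat \<Rightarrow> 'o \<Rightarrow> 'h::real_normed_vector \<Rightarrow>\<^sub>L 'h) \<Rightarrow> real \<Rightarrow> 'o \<Rightarrow> 'h \<Rightarrow>\<^sub>L 'h" where
  "elementary_process n \<tau> c s \<omega> = (\<Sum>i<n. indicat_real {\<tau> i<..\<tau> (Suc i)} s *\<^sub>R c i \<omega>)"

definition elementary_integral ::
  "(real \<Rightarrow> 'o \<Rightarrow> 'h) \<Rightarrow> nat \<Rightarrow> (nat \<Rightarrow> real) \<Rightarrow> (nat \<Rightarrow> 'o \<Rightarrow> 'h::real_normed_vector \<Rightarrow>\<^sub>L 'h) \<Rightarrow> 'o \<Rightarrow> 'h" where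
  "elementary_integral W n \<tau> c \<omega> = (\<Sum>i<n. c i \<omega> (W (\<tau> (Suc i)) \<omega> - W (\<tau> i) \<omega>))"

definition null_in_probability :: "'o measure \<Rightarrow> (nat \<Rightarrow> 'o \<Rightarrow> ennreal) \<Rightarrow> bool" where
  "null_in_probability M g \<longleftrightarrow>
     (\<forall>k. g k \<in> borel_measurable M) \<and>
     (\<forall>\<epsilon>>0. (\<lambda>k. measure M {\<omega> \<in> space M. ennreal \<epsilon> < g k \<omega>}) \<longlonglongrightarrow> 0)"

text \<open>
  The random variable \<open>I\<close> is (a version of) the Ito integral of the operator-valued process \<open>\<Phi>\<close> over
  \<open>{0..t}\<close> with respect to the Wiener process \<open>W\<close> with covariance operator \<open>Q\<close>: \<open>\<Phi>\<close> is (strongly)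
  predictable on \<open>{0..t}\<close>, and there are elementary integrands \<open>\<Phi>\<^sub>k\<close> such that
  \<open>\<integral>\<^sub>0\<^sup>t \<parallel>(\<Phi>\<^sub>k(s) - \<Phi>(s)) Q\<^sup>1\<^sup>/\<^sup>2\<parallel>\<^sup>2 ds \<rightarrow> 0\<close> (Hilbert-Schmidt norm) and \<open>\<integral>\<^sub>0\<^sup>t \<Phi>\<^sub>k dW \<rightarrow> I\<close>, both in probability.
  This is the usual integral for predictable \<open>\<Phi>\<close> with \<open>\<integral>\<^sub>0\<^sup>t \<parallel>\<Phi>(s) Q\<^sup>1\<^sup>/\<^sup>2\<parallel>\<^sup>2 ds < \<infinity>\<close> almost surely; it
  extends the \<open>L\<^sup>2\<close>-isometric one.
\<close>

definition has_stoch_integral ::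
  "'o measure \<Rightarrow> (real \<Rightarrow> 'o measure) \<Rightarrow>
   ('h::{real_inner, second_countable_topology} \<Rightarrow>\<^sub>L 'h) \<Rightarrow> (real \<Rightarrow> 'o \<Rightarrow> 'h) \<Rightarrow>
   real \<Rightarrow> (real \<Rightarrow> 'o \<Rightarrow> 'h \<Rightarrow>\<^sub>L 'h) \<Rightarrow> ('o \<Rightarrow> 'h) \<Rightarrow> bool" where
  "has_stoch_integral M F Q W t \<Phi> I \<longleftrightarrow>
     I \<in> borel_measurable M \<and>
     (\<forall>h. predictable M F (\<lambda>s \<omega>. indicat_real {0..t} s *\<^sub>R \<Phi> s \<omega> h)) \<and>
     (\<exists>n \<tau> c.
        (\<forall>k. elementary F t (n k) (\<tau> k) (c k)) \<and>
        null_in_probability M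
          (\<lambda>k \<omega>. \<integral>\<^sup>+s\<in>{0..t}.
             hs_norm_sq ((elementary_process (n k) (\<tau> k) (c k) s \<omega> - \<Phi> s \<omega>) o\<^sub>L op_sqrt Q) \<partial>lborel) \<and>
        null_in_probability M
          (\<lambda>k \<omega>. ennreal (norm (elementary_integral W (n k) (\<tau> k) (c k) \<omega> - I \<omega>))))"

definition mild_solution ::
  "'o measure \<Rightarrow> (real \<Rightarrow> 'o measure) \<Rightarrow>
   ('h::{real_inner, second_countable_topology} \<Rightarrow>\<^sub>L 'h) \<Rightarrow> (real \<Rightarrow> 'o \<Rightarrow> 'h) \<Rightarrow>
   (real \<Rightarrow> 'h \<Rightarrow>\<^sub>L 'h) \<Rightarrow> 'h \<Rightarrow> (real \<Rightarrow> 'o \<Rightarrow> 'h \<Rightarrow>\<^sub>L 'h) \<Rightarrow> (real \<Rightarrow> 'o \<Rightarrow> 'h) \<Rightarrow> bool" where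
  "mild_solution M F Q W U x\<^sub>0 \<Psi> X \<longleftrightarrow>
     (\<forall>t\<ge>0. has_stoch_integral M F Q W t (\<lambda>s \<omega>. U (t - s) o\<^sub>L \<Psi> s \<omega>) (\<lambda>\<omega>. X t \<omega> - U t x\<^sub>0))"

end

theory Submission
  imports Defs
begin

text \<open>
  For a continuous functional \<open>a\<close>, the Ito isometry gives \<open>E[(a \<bullet> I)\<^sup>2] = E \<integral> |Q\<^sup>1\<^sup>/\<^sup>2 \<Phi>(s)\<^sup>* a|\<^sup>2 ds\<close> for the Ito
  integral \<open>I\<close> of \<open>\<Phi>\<close>, as soon as the right-hand side is finite. For \<open>\<Phi>(s) = S(t - s) (Z(s) \<otimes> Y(s))\<close>
  and \<open>a\<close> representing the evaluation at \<open>x\<close>, the vector \<open>\<Phi>(s)\<^sup>* a\<close> is \<open>Y(s, x + t - s) Z(s)\<close>, so that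
  polarization yields the covariance. Finiteness follows by applying the isometry to \<open>Y\<close> itself,
  whose integrand is deterministic and bounded on compact time intervals.

  Since the integral is defined by limits in probability only, the isometry needs an argument: the
  given elementary integrands are stopped once their energy exceeds a level \<open>m\<close>, which makes them
  converge to \<open>\<Phi>\<close> in mean square along a diagonal sequence while the integrals still converge to
  \<open>I\<close>.
\<close>

subsection \<open>Riesz representation, adjoints and operator square roots\<close>

text \<open>Pairing with a fixed vector \<open>a\<close> takes place before any limit is taken: the
  Ito integral becomes a real random variable and its integrand the vector process
  \<open>op_sqrt Q (adj (\<Phi> s \<omega>) a)\<close>. Only an isometry between a scalar and a
  vector-valued L2 norm is then required, and the Hilbert-Schmidt norm in the definition of the
  integral serves as an upper bound for the operator norm. Since \<open>op_sqrt\<close> is a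
  definite description, nothing is known of it until existence and uniqueness of the positive root
  are established; this is why the development opens with operator theory. Two uniformities shape
  the estimates. The evaluation point \<open>x + t - s\<close> moves with \<open>s\<close>, so the
  representing vectors must be bounded independently of the point, and the second moments of
  \<open>Y\<close> must be uniform over a ball of functionals. And
  \<open>norm (Z s \<omega>) = 1\<close> holds almost surely for each \<open>s\<close> separately,
  so finiteness is shown by integrating over \<open>\<omega>\<close> first, for fixed
  \<open>s\<close>, with the integrals exchanged by Tonelli.\<close>

lemma quadratic_nonneg_imp_zero:
  fixes a b :: real
  assumes "\<And>t. 0 \<le> 2 * t * a + t\<^sup>2 * b"
  shows "a = 0"
proof (rule ccontr)
  assume "a \<noteq> 0"
  \<comment> \<open>A positive constant above \<open>b\<close>, whatever the sign of
    \<open>b\<close>: at \<open>t = - a / c\<close> the linear term then outweighs the quadratic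
    one.\<close>
  define c where "c = \<bar>b\<bar> + 1"
  have c: "c > 0" "b < c" by (auto simp: c_def)
  have "0 \<le> 2 * (- a / c) * a + (- a / c)\<^sup>2 * b" by (rule assms)
  also have "\<dots> = (a\<^sup>2 / c) * (b / c - 2)"
    using c by (simp add: field_simps power2_eq_square)
  also have "\<dots> < 0"
  proof (rule mult_pos_neg)
    show "0 < a\<^sup>2 / c" using \<open>a \<noteq> 0\<close> c by simp
    have "b / c < 1" using c by (simp add: field_simps)
    then show "b / c - 2 < 0" by simp
  qed
  finally show False by simp
qed

text \<open>The representing vector is found as the minimiser of \<open>J h = |h|^2 - 2 f h\<close>.
  Completeness enters through a minimising sequence, which the parallelogram identity makes
  Cauchy.\<close>

lemma riesz_representation:
  fixes f :: "'h::{real_inner, banach} \<Rightarrow> real"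
  assumes f: "bounded_linear f"
  shows "\<exists>v. \<forall>h. f h = v \<bullet> h"
proof -
  interpret f: bounded_linear f by fact
  obtain K where K: "\<And>h. \<bar>f h\<bar> \<le> norm h * K" using f.bounded by auto
  define J where "J h = (norm h)\<^sup>2 - 2 * f h" for h
  have lower: "- K\<^sup>2 \<le> J h" for h
  proof -
    have "0 \<le> (norm h - K)\<^sup>2" by simp
    then have "2 * (norm h * K) \<le> (norm h)\<^sup>2 + K\<^sup>2" by (simp add: power2_diff)
    moreover have "2 * f h \<le> 2 * (norm h * K)" using K[of h] by linarith
    ultimately show ?thesis unfolding J_def by linarith
  qed
  define d where "d = (INF h. J h)"
  have bdd: "bdd_below (range J)" using lower by (auto intro!: bdd_belowI[of _ "- K\<^sup>2"])
  have d_le: "d \<le> J h" for h unfolding d_def by (rule cINF_lower[OF bdd]) simp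
  have "\<exists>h. J h < d + inverse (Suc n)" for n
    using cInf_lessD[of "range J" "d + inverse (Suc n)"] unfolding d_def by auto
  then obtain X where X: "\<And>n. J (X n) < d + inverse (Suc n)" by metis
  \<comment> \<open>Parallelogram identity; the linear parts of \<open>J\<close> cancel at the
    midpoint. As \<open>J\<close> is at least \<open>d\<close> there, two near-minimisers must be
    close to each other.\<close>
  have par: "(norm (a - b))\<^sup>2 = 2 * J a + 2 * J b - 4 * J ((1/2) *\<^sub>R (a + b))" for a b
    unfolding J_def by (simp add: f.scaleR f.add power2_norm_eq_inner inner_diff inner_add
        inner_commute algebra_simps)
  have close: "(norm (X m - X n))\<^sup>2 \<le> 4 * inverse (Suc N)" if "N \<le> m" "N \<le> n" for m n N
  proof -
    have "inverse (real (Suc m)) \<le> inverse (Suc N)" "inverse (real (Suc n)) \<le> inverse (Suc N)"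
      using that by (auto intro!: le_imp_inverse_le)
    then show ?thesis
      using X[of m] X[of n] d_le[of "(1/2) *\<^sub>R (X m + X n)"] unfolding par by linarith
  qed
  have "Cauchy X"
  proof (rule metric_CauchyI)
    fix e :: real assume "0 < e"
    then obtain N where N: "inverse (real (Suc N)) < e\<^sup>2 / 4"
      using reals_Archimedean[of "e\<^sup>2 / 4"] by auto
    have "dist (X m) (X n) < e" if "N \<le> m" "N \<le> n" for m n
    proof -
      have "(norm (X m - X n))\<^sup>2 < e\<^sup>2" using close[OF that] N by linarith
      then show ?thesis using \<open>0 < e\<close> by (simp add: dist_norm power2_less_imp_less)
    qed
    then show "\<exists>M. \<forall>m\<ge>M. \<forall>n\<ge>M. dist (X m) (X n) < e" by blast
  qed
  then obtain v where v: "X \<longlonglongrightarrow> v" using Cauchy_convergent_iff convergent_def by blast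
  have "(\<lambda>n. J (X n)) \<longlonglongrightarrow> J v"
    unfolding J_def by (intro tendsto_intros v f.tendsto)
  moreover have "(\<lambda>n. d + inverse (real (Suc n))) \<longlonglongrightarrow> d + 0"
    by (intro tendsto_intros LIMSEQ_inverse_real_of_nat)
  ultimately have Jv: "J v \<le> d"
    using LIMSEQ_le[of "\<lambda>n. J (X n)" "J v" "\<lambda>n. d + inverse (real (Suc n))" "d + 0"] X
    by (metis add.right_neutral less_imp_le)
  \<comment> \<open>The first variation of \<open>J\<close> at the minimiser \<open>v\<close>
    vanishes in every direction \<open>h\<close>.\<close>
  have "v \<bullet> h - f h = 0" for h
  proof (rule quadratic_nonneg_imp_zero)
    fix t :: real
    have "J v \<le> J (v + t *\<^sub>R h)" using Jv d_le[of "v + t *\<^sub>R h"] by linarith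
    then show "0 \<le> 2 * t * (v \<bullet> h - f h) + t\<^sup>2 * (h \<bullet> h)"
      unfolding J_def power2_norm_eq_inner
      by (simp add: f.add f.scaleR inner_add inner_commute power2_eq_square algebra_simps)
  qed
  then show ?thesis by (intro exI[of _ v]) auto
qed

text \<open>The Hilbert space adjoint, kept as a plain function of the vector because only its
  values at given vectors are needed.\<close>

definition adj :: "('h::{real_inner, banach} \<Rightarrow>\<^sub>L 'h) \<Rightarrow> 'h \<Rightarrow> 'h" where
  "adj T a = (SOME v. \<forall>h. a \<bullet> T h = v \<bullet> h)"

lemma adj_inner: "adj T a \<bullet> h = a \<bullet> blinfun_apply T h"
proof -
  have "bounded_linear (\<lambda>h. a \<bullet> T h)"
    by (intro bounded_linear_intros blinfun.bounded_linear_right)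
  from riesz_representation[OF this] have "\<exists>v. \<forall>h. a \<bullet> T h = v \<bullet> h" .
  then have "\<forall>h. a \<bullet> T h = adj T a \<bullet> h" unfolding adj_def by (rule someI_ex)
  then show ?thesis by metis
qed

lemma eq_if_inner_eq:
  fixes a b :: "'h::real_inner"
  assumes "\<And>h. a \<bullet> h = b \<bullet> h"
  shows "a = b"
  using assms[of "a - b"] by (metis eq_iff_diff_eq_0 inner_diff_left inner_eq_zero_iff)

lemma adj_eqI: "(\<And>h. v \<bullet> h = a \<bullet> blinfun_apply T h) \<Longrightarrow> adj T a = v"
  by (rule eq_if_inner_eq) (simp add: adj_inner)

lemma adj_diff: "adj (S - T) a = adj S a - adj T a"
  by (rule adj_eqI) (simp add: adj_inner blinfun.diff_left inner_diff)

lemma adj_scaleR: "adj (r *\<^sub>R T) a = r *\<^sub>R adj T a"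
  by (rule adj_eqI) (simp add: adj_inner blinfun.scaleR_left)

lemma adj_sum: "adj (sum T K) a = (\<Sum>k\<in>K. adj (T k) a)"
  by (rule adj_eqI) (simp add: adj_inner blinfun.sum_left inner_sum_left inner_sum_right)

lemma adj_compose: "adj (S o\<^sub>L T) a = adj T (adj S a)"
  by (rule adj_eqI) (simp add: adj_inner)

lemma symmetric_op_adj: "symmetric_op T \<Longrightarrow> adj T a = T a"
  by (rule adj_eqI) (simp add: symmetric_op_def)

lemma norm_adj_le: "norm (adj T a) \<le> norm T * norm a"
proof -
  have "norm (adj T a) * norm (adj T a) = a \<bullet> T (adj T a)"
    by (simp add: adj_inner[symmetric] norm_eq_sqrt_inner)
  also have "\<dots> \<le> norm a * norm (T (adj T a))" by (rule norm_cauchy_schwarz)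
  also have "\<dots> \<le> norm a * (norm T * norm (adj T a))"
    by (intro mult_left_mono norm_blinfun) auto
  finally have "norm (adj T a) * norm (adj T a) \<le> (norm T * norm a) * norm (adj T a)"
    by (simp add: ac_simps)
  then show ?thesis
    by (metis mult_nonneg_nonneg mult_right_le_imp_le norm_ge_zero norm_zero zero_less_norm_iff)
qed

text \<open>The form \<open>T g \<bullet> h\<close> is a semidefinite inner product; the inequality
  says that the nonnegative quadratic \<open>t \<mapsto> T (g + t h) \<bullet> (g + t h)\<close> has
  no positive discriminant.\<close>

lemma positive_op_cauchy_schwarz:
  fixes T :: "'h::real_inner \<Rightarrow>\<^sub>L 'h"
  assumes sym: "symmetric_op T" and pos: "\<And>h. 0 \<le> T h \<bullet> h"
  shows "(T g \<bullet> h)\<^sup>2 \<le> (T g \<bullet> g) * (T h \<bullet> h)"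
proof -
  have *: "0 \<le> T g \<bullet> g + 2 * t * (T g \<bullet> h) + t\<^sup>2 * (T h \<bullet> h)" for t
  proof -
    have "T h \<bullet> g = T g \<bullet> h" using sym by (metis inner_commute symmetric_op_def)
    then show ?thesis
      using pos[of "g + t *\<^sub>R h"]
      by (simp add: blinfun.add_right blinfun.scaleR_right inner_add power2_eq_square algebra_simps)
  qed
  show ?thesis
  proof (cases "T h \<bullet> h = 0")
    case True
    have "T g \<bullet> h = 0"
    proof (rule ccontr)
      assume "T g \<bullet> h \<noteq> 0"
      \<comment> \<open>For a degenerate form the quadratic is affine in \<open>t\<close>; at the
        chosen \<open>t\<close> it takes the value -1.\<close>
      then show False
        using *[of "- (T g \<bullet> g + 1) / (2 * (T g \<bullet> h))"] True by (simp add: field_simps)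
    qed
    with True show ?thesis by simp
  next
    case False
    then have p: "T h \<bullet> h > 0" using pos[of h] by linarith
    \<comment> \<open>The value of \<open>t\<close> inserted here minimises the quadratic.\<close>
    have "0 \<le> T g \<bullet> g + 2 * (- (T g \<bullet> h) / (T h \<bullet> h)) * (T g \<bullet> h)
        + (- (T g \<bullet> h) / (T h \<bullet> h))\<^sup>2 * (T h \<bullet> h)" by (rule *)
    also have "\<dots> = T g \<bullet> g - (T g \<bullet> h)\<^sup>2 / (T h \<bullet> h)"
      using p by (simp add: field_simps power2_eq_square)
    finally show ?thesis using p by (simp add: field_simps)
  qed
qed

text \<open>With second vector \<open>T g\<close> the left side of Cauchy-Schwarz is the fourth
  power of the norm of \<open>T g\<close>.\<close>

lemma positive_op_zero:
  fixes T :: "'h::real_inner \<Rightarrow>\<^sub>L 'h"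
  assumes "symmetric_op T" "\<And>h. 0 \<le> T h \<bullet> h" "T g \<bullet> g = 0"
  shows "T g = 0"
  using positive_op_cauchy_schwarz[OF assms(1,2), of g "T g"] assms(3) by simp

text \<open>Cauchy-Schwarz for the form of \<open>T\<close>, with second vector \<open>T h\<close>,
  gives \<open>|T h|^4 \<le> |h|^2 |T h|^2\<close>, and a factor cancels. Bounds on the quadratic
  form thus control the operator norm.\<close>

lemma norm_le_one_if_between:
  fixes T :: "'h::real_inner \<Rightarrow>\<^sub>L 'h"
  assumes sym: "symmetric_op T" and pos: "\<And>h. 0 \<le> T h \<bullet> h" and le: "\<And>h. T h \<bullet> h \<le> h \<bullet> h"
  shows "norm T \<le> 1"
proof (rule norm_blinfun_bound)
  fix h
  have "(T h \<bullet> T h)\<^sup>2 \<le> (T h \<bullet> h) * (T (T h) \<bullet> T h)"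
    by (rule positive_op_cauchy_schwarz[OF sym pos])
  also have "\<dots> \<le> (h \<bullet> h) * (T h \<bullet> T h)"
    by (intro mult_mono le pos inner_ge_zero)
  finally have "(T h \<bullet> T h) * (T h \<bullet> T h) \<le> (h \<bullet> h) * (T h \<bullet> T h)" by (simp add: power2_eq_square)
  then have "T h \<bullet> T h \<le> h \<bullet> h"
    by (metis inner_ge_zero inner_gt_zero_iff inner_zero_left mult_right_le_imp_le)
  then show "norm (T h) \<le> 1 * norm h"
    by (simp add: norm_eq_sqrt_inner)
qed simp

lemma blinfun_compose_diff_left: "(A - B) o\<^sub>L C = (A o\<^sub>L C) - (B o\<^sub>L C)"
  by (rule blinfun_eqI) (simp add: blinfun.diff_left)

lemma blinfun_compose_diff_right: "C o\<^sub>L (A - B) = (C o\<^sub>L A) - (C o\<^sub>L B)"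
  by (rule blinfun_eqI) (simp add: blinfun.diff_left blinfun.diff_right)

section \<open>Successive approximation of the positive square root\<close>

primrec sqrt_iterate :: "('h::real_normed_vector \<Rightarrow>\<^sub>L 'h) \<Rightarrow> nat \<Rightarrow> 'h \<Rightarrow>\<^sub>L 'h" where
  "sqrt_iterate T 0 = 0"
| "sqrt_iterate T (Suc n) = (1/2) *\<^sub>R (T + (sqrt_iterate T n o\<^sub>L sqrt_iterate T n))"

text \<open>The same iteration for the number 1 in place of \<open>T\<close>. When
  \<open>norm T = 1\<close> the iteration has no uniform contraction factor on the unit ball, so
  convergence is obtained by domination: the scalar sequence is increasing and bounded, which makes
  its increments summable.\<close>

primrec sqrt_majorant :: "nat \<Rightarrow> real" where
  "sqrt_majorant 0 = 0"
| "sqrt_majorant (Suc n) = (1 + (sqrt_majorant n)\<^sup>2) / 2"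

lemma sqrt_majorant_bounds: "0 \<le> sqrt_majorant n \<and> sqrt_majorant n \<le> 1"
proof (induction n)
  case (Suc n)
  then have "(sqrt_majorant n)\<^sup>2 \<le> 1" by (simp add: power_le_one)
  then show ?case by simp
qed simp

lemma sqrt_majorant_mono: "sqrt_majorant n \<le> sqrt_majorant (Suc n)"
proof -
  have "0 \<le> (1 - sqrt_majorant n)\<^sup>2" by simp
  then show ?thesis by (simp add: power2_diff)
qed

lemma norm_sqrt_iterate_le:
  assumes "norm T \<le> 1"
  shows "norm (sqrt_iterate T n) \<le> sqrt_majorant n"
proof (induction n)
  case (Suc n)
  have "norm (T + (sqrt_iterate T n o\<^sub>L sqrt_iterate T n))
      \<le> norm T + norm (sqrt_iterate T n) * norm (sqrt_iterate T n)"
    by (intro order.trans[OF norm_triangle_ineq] add_mono norm_blinfun_compose order.refl)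
  also have "\<dots> \<le> 1 + sqrt_majorant n * sqrt_majorant n"
    using assms Suc sqrt_majorant_bounds[of n] by (intro add_mono mult_mono) auto
  finally show ?case by (simp add: power2_eq_square)
qed simp

text \<open>Without commutativity, the difference of two squares still factors as
  \<open>A A - B B = A D + D B\<close> with \<open>D = A - B\<close>. Taking norms reproduces
  exactly the recursion for the increments of the majorant.\<close>

lemma norm_sqrt_iterate_diff_le:
  assumes "norm T \<le> 1"
  shows "norm (sqrt_iterate T (Suc n) - sqrt_iterate T n) \<le> sqrt_majorant (Suc n) - sqrt_majorant n"
proof (induction n)
  case 0
  then show ?case using assms by simp
next
  case (Suc n)
  let ?Y = "sqrt_iterate T" and ?y = "sqrt_majorant"
  define D where "D = ?Y (Suc n) - ?Y n"
  have "?Y (Suc (Suc n)) - ?Y (Suc n)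
      = (1/2) *\<^sub>R ((?Y (Suc n) o\<^sub>L ?Y (Suc n)) - (?Y n o\<^sub>L ?Y n))"
    by (simp only: sqrt_iterate.simps(2)[of T "Suc n"] sqrt_iterate.simps(2)[of T n] scaleR_diff_right[symmetric]) simp
  also have "\<dots> = (1/2) *\<^sub>R ((?Y (Suc n) o\<^sub>L D) + (D o\<^sub>L ?Y n))"
    by (simp only: D_def blinfun_compose_diff_left blinfun_compose_diff_right) simp
  finally have "norm (?Y (Suc (Suc n)) - ?Y (Suc n))
      = (1/2) * norm ((?Y (Suc n) o\<^sub>L D) + (D o\<^sub>L ?Y n))" by simp
  also have "\<dots> \<le> (1/2) * (norm (?Y (Suc n)) * norm D + norm D * norm (?Y n))"
    by (intro mult_left_mono order.trans[OF norm_triangle_ineq] add_mono norm_blinfun_compose) auto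
  also have "\<dots> \<le> (1/2) * (?y (Suc n) * (?y (Suc n) - ?y n) + (?y (Suc n) - ?y n) * ?y n)"
    using Suc sqrt_majorant_bounds[of n] sqrt_majorant_bounds[of "Suc n"] sqrt_majorant_mono[of n]
    unfolding D_def by (intro mult_left_mono add_mono mult_mono norm_sqrt_iterate_le assms) auto
  also have "\<dots> = ?y (Suc (Suc n)) - ?y (Suc n)"
    by (simp only: sqrt_majorant.simps(2)[of "Suc n"] sqrt_majorant.simps(2)[of n])
       (simp add: power2_eq_square field_simps)
  finally show ?case .
qed

text \<open>The increments are dominated by a telescoping series with bounded monotone partial
  sums.\<close>

lemma convergent_sqrt_iterate:
  fixes T :: "'h::banach \<Rightarrow>\<^sub>L 'h"
  assumes "norm T \<le> 1"
  shows "convergent (sqrt_iterate T)"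
proof -
  have "incseq sqrt_majorant" using sqrt_majorant_mono by (rule incseq_SucI)
  then have "convergent sqrt_majorant"
    using sqrt_majorant_bounds
    by (intro Bseq_mono_convergent BseqI'[of _ 1]) (auto simp: incseq_def abs_le_iff)
  then have s: "summable (\<lambda>n. sqrt_majorant (Suc n) - sqrt_majorant n)"
    using telescope_summable convergent_def by blast
  have "summable (\<lambda>n. sqrt_iterate T (Suc n) - sqrt_iterate T n)"
    by (rule summable_comparison_test'[OF s, of 0]) (rule norm_sqrt_iterate_diff_le[OF assms])
  then have "convergent (\<lambda>n. \<Sum>i<n. sqrt_iterate T (Suc i) - sqrt_iterate T i)"
    by (simp only: summable_iff_convergent)
  then show ?thesis by (simp only: sum_lessThan_telescope) simp
qed

text \<open>If \<open>Y = (T + Y\<^sup>2) / 2\<close> then \<open>(1 - Y)\<^sup>2 = 1 - T\<close>.\<close>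

lemma ex_sqrt_contraction:
  fixes Q :: "'h::{real_inner, banach} \<Rightarrow>\<^sub>L 'h"
  assumes sym: "symmetric_op Q" and pos: "\<And>h. 0 \<le> Q h \<bullet> h" and le: "norm Q \<le> 1"
  shows "\<exists>R. symmetric_op R \<and> (\<forall>h. 0 \<le> R h \<bullet> h) \<and> R o\<^sub>L R = Q \<and>
    (\<forall>S. S o\<^sub>L Q = Q o\<^sub>L S \<longrightarrow> S o\<^sub>L R = R o\<^sub>L S)"
proof -
  define T where "T = id_blinfun - Q"
  have T: "symmetric_op T"
    using sym by (simp add: T_def symmetric_op_def blinfun.diff_left inner_diff)
  have Qle: "Q h \<bullet> h \<le> h \<bullet> h" for h
  proof -
    have "Q h \<bullet> h \<le> norm (Q h) * norm h" by (rule norm_cauchy_schwarz)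
    also have "\<dots> \<le> (1 * norm h) * norm h"
      by (intro mult_right_mono order.trans[OF norm_blinfun] le) auto
    finally show ?thesis by (simp add: power2_norm_eq_inner[symmetric] power2_eq_square)
  qed
  \<comment> \<open>As quadratic forms \<open>0 \<le> Q \<le> 1\<close>, hence also
    \<open>0 \<le> T \<le> 1\<close>. The triangle inequality alone would only give the bound
    2.\<close>
  have "norm T \<le> 1"
    using Qle pos by (intro norm_le_one_if_between T)
      (auto simp: T_def blinfun.diff_left inner_diff_left)
  from convergent_sqrt_iterate[OF this] obtain Y where Y: "sqrt_iterate T \<longlonglongrightarrow> Y"
    by (auto simp: convergent_def)
  have Yh: "(\<lambda>n. sqrt_iterate T n h) \<longlonglongrightarrow> Y h" for h
    by (intro tendsto_intros Y)
  have "(\<lambda>n. sqrt_iterate T (Suc n)) \<longlonglongrightarrow> (1/2) *\<^sub>R (T + (Y o\<^sub>L Y))"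
    unfolding sqrt_iterate.simps
    by (intro tendsto_intros bounded_bilinear.tendsto[OF bounded_bilinear_blinfun_compose] Y)
  with LIMSEQ_Suc[OF Y] have fp: "Y = (1/2) *\<^sub>R (T + (Y o\<^sub>L Y))"
    by (rule LIMSEQ_unique)
  then have fp2: "2 *\<^sub>R Y = T + (Y o\<^sub>L Y)" by (metis scaleR_half_double scaleR_2 scaleR_right_distrib)
  have symn: "symmetric_op (sqrt_iterate T n)" for n
  proof (induction n)
    case 0 then show ?case by (simp add: symmetric_op_def)
  next
    case (Suc n)
    with T show ?case
      by (simp add: symmetric_op_def blinfun.add_left blinfun.scaleR_left inner_add)
  qed
  have Ysym: "symmetric_op Y"
    unfolding symmetric_op_def
  proof (intro allI)
    fix f g
    have "(\<lambda>n. sqrt_iterate T n f \<bullet> g) \<longlonglongrightarrow> Y f \<bullet> g" by (intro tendsto_intros Yh)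
    moreover have "(\<lambda>n. f \<bullet> sqrt_iterate T n g) \<longlonglongrightarrow> f \<bullet> Y g" by (intro tendsto_intros Yh)
    ultimately show "Y f \<bullet> g = f \<bullet> Y g"
      using symn LIMSEQ_unique unfolding symmetric_op_def by fastforce
  qed
  have Ynorm: "norm Y \<le> 1"
  proof (rule LIMSEQ_le_const2[OF tendsto_norm[OF Y]])
    show "\<exists>N. \<forall>n\<ge>N. norm (sqrt_iterate T n) \<le> 1"
      using norm_sqrt_iterate_le[OF \<open>norm T \<le> 1\<close>] sqrt_majorant_bounds by (meson order.trans)
  qed
  define R where "R = id_blinfun - Y"
  have "symmetric_op R"
    using Ysym by (simp add: R_def symmetric_op_def blinfun.diff_left inner_diff)
  moreover have "0 \<le> R h \<bullet> h" for h
  proof -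
    have "Y h \<bullet> h \<le> norm (Y h) * norm h" by (rule norm_cauchy_schwarz)
    also have "\<dots> \<le> (1 * norm h) * norm h"
      by (intro mult_right_mono order.trans[OF norm_blinfun] Ynorm) auto
    finally show ?thesis
      by (simp add: R_def blinfun.diff_left inner_diff_left power2_norm_eq_inner[symmetric] power2_eq_square)
  qed
  moreover have "R o\<^sub>L R = Q"
  proof (rule blinfun_eqI)
    fix h
    have "2 *\<^sub>R Y h = T h + Y (Y h)"
      using fp2 by (metis blinfun.add_left blinfun.scaleR_left blinfun_apply_blinfun_compose)
    then show "(R o\<^sub>L R) h = Q h"
      by (simp add: R_def T_def blinfun.diff_left blinfun.diff_right algebra_simps scaleR_2)
  qed
  moreover have "S o\<^sub>L R = R o\<^sub>L S" if S: "S o\<^sub>L Q = Q o\<^sub>L S" for S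
  proof (rule blinfun_eqI)
    fix h
    have ST: "S (T h) = T (S h)" for h
      using S by (simp add: T_def blinfun.diff_left blinfun.diff_right)
        (metis blinfun_apply_blinfun_compose)
    \<comment> \<open>The iterates are polynomials in \<open>T\<close>, so whatever commutes with
      \<open>Q\<close> commutes with each of them and with their limit.\<close>
    have comm: "S (sqrt_iterate T n h) = sqrt_iterate T n (S h)" for n h
      by (induction n arbitrary: h)
        (simp_all add: blinfun.add_left blinfun.scaleR_left blinfun.add_right blinfun.scaleR_right
          blinfun.zero_left blinfun.zero_right ST)
    have "(\<lambda>n. S (sqrt_iterate T n h)) \<longlonglongrightarrow> S (Y h)" by (intro tendsto_intros Yh)
    then have "S (Y h) = Y (S h)"
      unfolding comm using LIMSEQ_unique Yh by blast
    then show "(S o\<^sub>L R) h = (R o\<^sub>L S) h"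
      by (simp add: R_def blinfun.diff_left blinfun.diff_right)
  qed
  ultimately show ?thesis by blast
qed

lemma ex_sqrt_commuting:
  fixes Q :: "'h::{real_inner, banach} \<Rightarrow>\<^sub>L 'h"
  assumes sym: "symmetric_op Q" and pos: "\<And>h. 0 \<le> Q h \<bullet> h"
  shows "\<exists>R. symmetric_op R \<and> (\<forall>h. 0 \<le> R h \<bullet> h) \<and> R o\<^sub>L R = Q \<and>
    (\<forall>S. S o\<^sub>L Q = Q o\<^sub>L S \<longrightarrow> S o\<^sub>L R = R o\<^sub>L S)"
proof -
  \<comment> \<open>Dividing by \<open>c\<close> brings \<open>Q\<close> into the unit ball, and the
    root is rescaled by \<open>sqrt c\<close>; the summand 1 keeps \<open>c\<close> positive when
    \<open>Q = 0\<close>.\<close>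
  define c where "c = norm Q + 1"
  have c: "c > 0" by (simp add: c_def add_nonneg_pos)
  have "norm ((1/c) *\<^sub>R Q) \<le> 1" using c by (simp add: c_def)
  moreover have "symmetric_op ((1/c) *\<^sub>R Q)" "\<And>h. 0 \<le> ((1/c) *\<^sub>R Q) h \<bullet> h"
    using sym pos c by (simp_all add: symmetric_op_def blinfun.scaleR_left)
  ultimately obtain R where R: "symmetric_op R" "\<And>h. 0 \<le> R h \<bullet> h" "R o\<^sub>L R = (1/c) *\<^sub>R Q"
    "\<And>S. S o\<^sub>L ((1/c) *\<^sub>R Q) = ((1/c) *\<^sub>R Q) o\<^sub>L S \<Longrightarrow> S o\<^sub>L R = R o\<^sub>L S"
    using ex_sqrt_contraction[of "(1/c) *\<^sub>R Q"] by blast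
  have scaled: "S o\<^sub>L (r *\<^sub>R P) = r *\<^sub>R (S o\<^sub>L P)" "(r *\<^sub>R P) o\<^sub>L S = r *\<^sub>R (P o\<^sub>L S)"
    for r and S P :: "'h \<Rightarrow>\<^sub>L 'h"
    by (auto intro!: blinfun_eqI simp: blinfun.scaleR_left blinfun.scaleR_right)
  have "symmetric_op (sqrt c *\<^sub>R R)" "\<And>h. 0 \<le> (sqrt c *\<^sub>R R) h \<bullet> h"
    using R(1,2) c by (simp_all add: symmetric_op_def blinfun.scaleR_left)
  moreover have "(sqrt c *\<^sub>R R) o\<^sub>L (sqrt c *\<^sub>R R) = Q"
    using c by (simp add: scaled R(3))
  moreover have "S o\<^sub>L (sqrt c *\<^sub>R R) = (sqrt c *\<^sub>R R) o\<^sub>L S" if "S o\<^sub>L Q = Q o\<^sub>L S" for S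
    using R(4)[of S] that by (simp add: scaled)
  ultimately show ?thesis by blast
qed

text \<open>Put \<open>D = R - P\<close>. Commutation gives
  \<open>(R + P) D = R R - P P = 0\<close>, so the two nonnegative forms of \<open>R\<close> and
  \<open>P\<close> sum to zero on the range of \<open>D\<close> and each vanishes there. Then
  \<open>R D = P D = 0\<close>, hence \<open>D D = 0\<close>, and a symmetric operator with zero
  square is zero.\<close>

lemma sqrt_unique:
  fixes R P :: "'h::real_inner \<Rightarrow>\<^sub>L 'h"
  assumes R: "symmetric_op R" "\<And>h. 0 \<le> R h \<bullet> h" and P: "symmetric_op P" "\<And>h. 0 \<le> P h \<bullet> h"
    and eq: "R o\<^sub>L R = P o\<^sub>L P" and comm: "P o\<^sub>L R = R o\<^sub>L P"
  shows "R = P"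
proof (rule blinfun_eqI)
  fix h
  define D where "D = R - P"
  have D: "D f \<bullet> g = f \<bullet> D g" for f g
    using R(1) P(1) by (simp add: D_def symmetric_op_def blinfun.diff_left inner_diff)
  have c: "P (R u) = R (P u)" "R (R u) = P (P u)" for u
    using comm eq by (metis blinfun_apply_blinfun_compose)+
  have "R (D u) \<bullet> D u + P (D u) \<bullet> D u = 0" for u
  proof -
    have "R (D u) + P (D u) = 0"
      by (simp add: D_def blinfun.diff_left blinfun.diff_right c)
    then show ?thesis by (metis inner_add_left inner_zero_left)
  qed
  then have "R (D u) \<bullet> D u = 0" "P (D u) \<bullet> D u = 0" for u
    using R(2)[of "D u"] P(2)[of "D u"] by (metis add_nonneg_eq_0_iff)+
  then have RD: "R (D u) = 0" "P (D u) = 0" for u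
    using positive_op_zero[OF R] positive_op_zero[OF P] by blast+
  have "D (D h) = 0" by (subst D_def) (simp add: blinfun.diff_left RD)
  then have "D h \<bullet> D h = 0" by (simp add: D)
  then show "R h = P h" by (simp add: D_def blinfun.diff_left)
qed

text \<open>Any competing root \<open>P\<close> commutes with \<open>Q = P P\<close>, hence with the
  constructed root, which commutes with everything that commutes with \<open>Q\<close>. This
  supplies the commutation needed in \<open>sqrt_unique\<close>, so the definite description is
  justified.\<close>

lemma op_sqrt:
  fixes Q :: "'h::{real_inner, banach} \<Rightarrow>\<^sub>L 'h"
  assumes "symmetric_op Q" and "\<And>h. 0 \<le> Q h \<bullet> h"
  shows "symmetric_op (op_sqrt Q)" and "op_sqrt Q o\<^sub>L op_sqrt Q = Q"
proof -
  let ?P = "\<lambda>R. symmetric_op R \<and> (\<forall>h. 0 \<le> R h \<bullet> h) \<and> R o\<^sub>L R = Q"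
  obtain R where R: "?P R" "\<And>S. S o\<^sub>L Q = Q o\<^sub>L S \<Longrightarrow> S o\<^sub>L R = R o\<^sub>L S"
    using ex_sqrt_commuting[OF assms] by blast
  have "P = R" if "?P P" for P
  proof -
    from that have eq: "P o\<^sub>L P = Q" by blast
    have "P o\<^sub>L Q = Q o\<^sub>L P" unfolding eq[symmetric] by (rule blinfun_eqI) simp
    note comm = R(2)[OF this]
    have "R o\<^sub>L R = P o\<^sub>L P" using eq R(1) by simp
    then show ?thesis using that R(1) by (intro sqrt_unique[OF _ _ _ _ _ comm, symmetric]) blast+
  qed
  then have "?P (op_sqrt Q)" unfolding op_sqrt_def by (intro theI[of ?P, OF R(1)]) blast
  then show "symmetric_op (op_sqrt Q)" "op_sqrt Q o\<^sub>L op_sqrt Q = Q" by blast+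
qed

lemma covariance_operator_sqrt:
  fixes Q :: "'h::{real_inner, banach} \<Rightarrow>\<^sub>L 'h"
  assumes "covariance_operator Q"
  shows "symmetric_op (op_sqrt Q)" and "op_sqrt Q g \<bullet> op_sqrt Q h = Q g \<bullet> h"
proof -
  have sym: "symmetric_op Q" using assms by (simp add: covariance_operator_def)
  have pos: "0 \<le> Q h \<bullet> h" for h
    using assms by (cases "h = 0") (auto simp: covariance_operator_def intro: less_imp_le)
  note op = op_sqrt[OF sym pos]
  show "symmetric_op (op_sqrt Q)" by (rule op)
  have "op_sqrt Q (op_sqrt Q g) = Q g" using op(2) by (metis blinfun_apply_blinfun_compose)
  then show "op_sqrt Q g \<bullet> op_sqrt Q h = Q g \<bullet> h"
    using op(1) by (metis symmetric_op_def)
qed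

subsection \<open>Operator bounds\<close>

text \<open>Cauchy-Schwarz for the finite expansion of \<open>h\<close>: its coefficients have l2
  norm \<open>norm h\<close> by Pythagoras, and the images of the basis vectors have l2 norm at most
  \<open>sqrt c\<close>.\<close>

lemma bounded_on_orthonormal_span:
  fixes T :: "'h::real_inner \<Rightarrow>\<^sub>L 'h"
  assumes orth: "pairwise orthogonal E" and unit: "\<And>e. e \<in> E \<Longrightarrow> norm e = 1"
    and le: "\<And>D. finite D \<Longrightarrow> D \<subseteq> E \<Longrightarrow> (\<Sum>e\<in>D. (norm (T e))\<^sup>2) \<le> c"
    and h: "h \<in> span E"
  shows "norm (T h) \<le> sqrt c * norm h"
proof -
  from h obtain D r where D: "finite D" "D \<subseteq> E" and h_eq: "h = (\<Sum>e\<in>D. r e *\<^sub>R e)"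
    unfolding span_explicit by blast
  have "(norm h)\<^sup>2 = (\<Sum>e\<in>D. (norm (r e *\<^sub>R e))\<^sup>2)"
    unfolding h_eq using orth D
    by (intro norm_sum_Pythagorean) (auto simp: pairwise_def orthogonal_def)
  also have "\<dots> = (\<Sum>e\<in>D. (r e)\<^sup>2)"
    using unit D by (intro sum.cong) auto
  finally have norm_h: "norm h = L2_set r D"
    by (simp add: L2_set_def real_sqrt_unique)
  have "norm (T h) \<le> (\<Sum>e\<in>D. norm (r e *\<^sub>R T e))"
    by (simp add: h_eq blinfun.sum_right blinfun.scaleR_right sum_norm_le)
  also have "\<dots> = (\<Sum>e\<in>D. \<bar>r e\<bar> * \<bar>norm (T e)\<bar>)" by simp
  also have "\<dots> \<le> L2_set r D * L2_set (\<lambda>e. norm (T e)) D" by (rule L2_set_mult_ineq)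
  also have "\<dots> \<le> norm h * sqrt c"
    unfolding norm_h
    by (intro mult_left_mono L2_set_nonneg) (simp add: L2_set_def le[OF D])
  finally show ?thesis by (simp add: mult.commute)
qed

text \<open>The bound on the span of the basis extends by density. The existence hypothesis ensures
  that the basis picked by \<open>SOME\<close> in \<open>hs_norm_sq\<close> really is one.\<close>

lemma norm_sq_le_hs_norm_sq:
  fixes T :: "'h::real_inner \<Rightarrow>\<^sub>L 'h"
  assumes "\<exists>E::'h set. orthonormal_basis E"
  shows "ennreal ((norm T)\<^sup>2) \<le> hs_norm_sq T"
proof (cases "hs_norm_sq T")
  case (real c)
  define E where "E = (SOME E::'h set. orthonormal_basis E)"
  have E: "orthonormal_basis E" unfolding E_def by (rule someI_ex) fact
  have le: "(\<Sum>e\<in>D. (norm (T e))\<^sup>2) \<le> c" if D: "finite D" "D \<subseteq> E" for D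
  proof -
    have "ennreal (\<Sum>e\<in>D. (norm (T e))\<^sup>2) = (\<Sum>e\<in>D. ennreal ((norm (T e))\<^sup>2))"
      by (simp add: sum_ennreal)
    also have "\<dots> \<le> hs_norm_sq T"
      unfolding hs_norm_sq_def E_def[symmetric] nonneg_infsum_complete[OF zero_le]
      using D by (intro SUP_upper) auto
    finally show ?thesis using real by (simp add: sum_nonneg)
  qed
  have "norm (T h) \<le> sqrt c * norm h" for h
  proof -
    have "closed {h. norm (T h) \<le> sqrt c * norm h}"
      by (intro closed_Collect_le continuous_intros)
    moreover have "span E \<subseteq> {h. norm (T h) \<le> sqrt c * norm h}"
      using bounded_on_orthonormal_span[of E T c] E le by (auto simp: orthonormal_basis_def)
    ultimately have "closure (span E) \<subseteq> {h. norm (T h) \<le> sqrt c * norm h}"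
      by (rule closure_minimal[rotated])
    then show ?thesis using E by (auto simp: orthonormal_basis_def)
  qed
  then have "norm T \<le> sqrt c" using real by (intro norm_blinfun_bound) auto
  then have "(norm T)\<^sup>2 \<le> c" using real by (metis norm_ge_zero power_mono real_sqrt_pow2)
  then show ?thesis using real by simp
qed simp

text \<open>A Baire category argument: strong continuity at 0 gives each vector its own bound on its
  own short interval, and some set of vectors sharing one bound and one interval has interior
  points.\<close>

lemma c0_semigroup_bounded_near_0:
  fixes U :: "real \<Rightarrow> 'h::banach \<Rightarrow>\<^sub>L 'h"
  assumes "c0_semigroup U"
  shows "\<exists>d>0. \<exists>K. \<forall>u. 0 \<le> u \<and> u \<le> d \<longrightarrow> norm (U u) \<le> K"
proof -
  from assms have U0: "U 0 = id_blinfun" and lim: "\<And>h. ((\<lambda>t. U t h) \<longlongrightarrow> h) (at_right 0)"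
    by (auto simp: c0_semigroup_def)
  \<comment> \<open>One index governs both the bound and the interval: increasing \<open>n\<close>
    relaxes both conditions, so a countable family covers the space.\<close>
  define A where "A n = {h. \<forall>u\<in>{0..inverse (real (Suc n))}. norm (U u h) \<le> real n}" for n
  have closed: "closed (A n)" for n
  proof -
    have "A n = (\<Inter>u\<in>{0..inverse (real (Suc n))}. {h. norm (U u h) \<le> real n})" by (auto simp: A_def)
    also have "closed \<dots>" by (intro closed_INT ballI closed_Collect_le continuous_intros)
    finally show ?thesis .
  qed
  have "h \<in> (\<Union>n. A n)" for h
  proof -
    have "eventually (\<lambda>t. dist (U t h) h < 1) (at_right 0)"
      using lim[of h] by (rule tendstoD) simp
    then obtain b where b: "b > 0" "\<And>t. 0 < t \<Longrightarrow> t < b \<Longrightarrow> dist (U t h) h < 1"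
      unfolding eventually_at_right_field by auto
    obtain n1 where n1: "inverse (real (Suc n1)) < b" using reals_Archimedean[OF b(1)] by auto
    obtain n2 where n2: "norm h + 1 < real n2" using reals_Archimedean2 by auto
    define n where "n = max n1 n2"
    have "inverse (real (Suc n)) \<le> inverse (real (Suc n1))" by (simp add: n_def le_imp_inverse_le)
    with n1 have n_b: "inverse (real (Suc n)) < b" by linarith
    have n_h: "norm h + 1 < real n" using n2 by (simp add: n_def)
    have "norm (U u h) \<le> real n" if u: "u \<in> {0..inverse (real (Suc n))}" for u
    proof (cases "u = 0")
      case True
      then show ?thesis using n_h by (simp add: U0)
    next
      case False
      then have "dist (U u h) h < 1" using u n_b by (intro b(2)) auto
      then have "norm (U u h - h) < 1" by (simp add: dist_norm)
      then show ?thesis using n_h norm_triangle_sub[of "U u h" h] by linarith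
    qed
    then show ?thesis unfolding A_def by blast
  qed
  then have "(\<Union>n. A n) = UNIV" by blast
  moreover have "interior (\<Union>(range A)) = {}" if "\<And>n. interior (A n) = {}"
  proof -
    have "Met_TC.mtopology interior_of \<Union>(range A) = {}"
      using closed that
      by (intro Met_TC.metric_Baire_category_alt) (auto simp: complete_UNIV)
    then show ?thesis by simp
  qed
  ultimately obtain n where "interior (A n) \<noteq> {}" by (metis UNIV_not_empty interior_UNIV)
  then obtain h0 r where r: "r > 0" "cball h0 r \<subseteq> A n"
    by (metis all_not_in_conv interior_subset mem_interior_cball)
  \<comment> \<open>A vector of length \<open>r\<close> is the difference of two points of the ball
    around \<open>h0\<close>, each mapped to norm at most \<open>n\<close>.\<close>
  have "norm (U u) \<le> 2 * real n / r" if u: "0 \<le> u" "u \<le> inverse (real (Suc n))" for u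
  proof (rule norm_blinfun_bound)
    fix h
    show "norm (U u h) \<le> 2 * real n / r * norm h"
    proof (cases "h = 0")
      case False
      define g where "g = (r / norm h) *\<^sub>R h"
      have "norm g = r" using False r by (simp add: g_def)
      then have "h0 + g \<in> A n" "h0 \<in> A n" using r by (auto simp: dist_norm)
      then have "norm (U u (h0 + g)) \<le> real n" "norm (U u h0) \<le> real n"
        using u by (auto simp: A_def)
      moreover have "norm (U u g) = norm (U u (h0 + g) - U u h0)" by (simp add: blinfun.add_right)
      ultimately have "norm (U u g) \<le> 2 * real n"
        using norm_triangle_ineq4[of "U u (h0 + g)" "U u h0"] by linarith
      then show ?thesis using False r by (simp add: g_def blinfun.scaleR_right field_simps)
    qed simp
  qed (use r in simp)
  then show ?thesis by (intro exI[of _ "inverse (real (Suc n))"]) auto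
qed

lemma c0_semigroup_locally_bounded:
  fixes U :: "real \<Rightarrow> 'h::banach \<Rightarrow>\<^sub>L 'h"
  assumes "c0_semigroup U"
  shows "\<exists>K\<ge>0. \<forall>u. 0 \<le> u \<and> u \<le> t \<longrightarrow> norm (U u) \<le> K"
proof -
  obtain d L where d: "d > 0" and L: "\<And>u. 0 \<le> u \<Longrightarrow> u \<le> d \<Longrightarrow> norm (U u) \<le> L"
    using c0_semigroup_bounded_near_0[OF assms] by blast
  have add: "U (u + v) = U u o\<^sub>L U v" if "0 \<le> u" "0 \<le> v" for u v
    using assms that by (auto simp: c0_semigroup_def)
  have L0: "0 \<le> L" using L[of 0] d norm_ge_zero[of "U 0"] by linarith
  have "\<exists>K\<ge>0. \<forall>u. 0 \<le> u \<and> u \<le> real n * d \<longrightarrow> norm (U u) \<le> K" for n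
  proof (induction n)
    case 0
    then show ?case using L d L0 by (intro exI[of _ L]) auto
  next
    case (Suc n)
    then obtain K where K: "K \<ge> 0" "\<And>u. 0 \<le> u \<Longrightarrow> u \<le> real n * d \<Longrightarrow> norm (U u) \<le> K" by blast
    \<comment> \<open>\<open>K * L\<close> covers \<open>u > d\<close>, where \<open>U u\<close>
      factors through \<open>U d\<close>; the summand \<open>L\<close> covers
      \<open>u \<le> d\<close>.\<close>
    have "norm (U u) \<le> K * L + L" if u: "0 \<le> u" "u \<le> real (Suc n) * d" for u
    proof (cases "u \<le> d")
      case True
      then show ?thesis using L[of u] u K(1) L0 by (metis add_increasing mult_nonneg_nonneg)
    next
      case False
      then have "U u = U (u - d) o\<^sub>L U d" using add[of "u - d" d] d by simp
      then have "norm (U u) \<le> norm (U (u - d)) * norm (U d)" using norm_blinfun_compose by metis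
      also have "\<dots> \<le> K * L"
        using False u d K L by (intro mult_mono K(2) L) (auto simp: algebra_simps)
      finally show ?thesis using L0 by linarith
    qed
    then show ?case using K(1) L0 by (intro exI[of _ "K * L + L"]) auto
  qed
  moreover obtain n where "t \<le> real n * d"
    using reals_Archimedean3[OF d] by (metis less_imp_le)
  ultimately show ?thesis by (meson order.trans)
qed

subsection \<open>Measurability and convergence\<close>

text \<open>Pettis' argument: by separability, membership of \<open>f x\<close> in a closed ball is
  tested by countably many functionals, and every open set is a countable union of closed balls with
  dense centres and rational radii.\<close>

lemma borel_measurable_weak:
  fixes f :: "'a \<Rightarrow> 'h::{real_inner, second_countable_topology}"
  assumes weak: "\<And>h. (\<lambda>x. f x \<bullet> h) \<in> borel_measurable M"
  shows "f \<in> borel_measurable M"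
proof (rule borel_measurableI)
  note [measurable] = weak
  obtain D :: "'h set" where D: "countable D" "\<And>X. open X \<Longrightarrow> X \<noteq> {} \<Longrightarrow> \<exists>d\<in>D. d \<in> X"
    using countable_dense_exists[where 'a='h] by blast
  have norm_le: "norm v \<le> r \<longleftrightarrow> (\<forall>d\<in>D. v \<bullet> d \<le> r * norm d)" if "0 \<le> r" for v :: 'h and r
  proof
    assume "norm v \<le> r"
    then have "v \<bullet> d \<le> r * norm d" for d
      by (intro order.trans[OF norm_cauchy_schwarz] mult_right_mono) auto
    then show "\<forall>d\<in>D. v \<bullet> d \<le> r * norm d" by blast
  next
    assume le: "\<forall>d\<in>D. v \<bullet> d \<le> r * norm d"
    \<comment> \<open>If this open set were nonempty it would meet \<open>D\<close>, contradicting
      \<open>le\<close>. Its emptiness is then exploited at the point \<open>v\<close>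
      itself.\<close>
    have "open {d. r * norm d < v \<bullet> d}"
      by (intro open_Collect_less continuous_intros)
    then have "{d. r * norm d < v \<bullet> d} = {}" using D(2) le by force
    then have "\<not> r * norm v < v \<bullet> v" by blast
    then have "norm v * norm v \<le> r * norm v" by (simp add: norm_eq_sqrt_inner)
    then show "norm v \<le> r" using that by (cases "v = 0") auto
  qed
  have ball: "{x \<in> space M. norm (f x - d) \<le> r} \<in> sets M" if "0 \<le> r" for d r
    unfolding norm_le[OF that] inner_diff_left using D(1) by measurable
  fix S :: "'h set" assume S: "open S"
  define I where "I = {(d, q). d \<in> D \<and> 0 \<le> q \<and> cball d (real_of_rat q) \<subseteq> S}"
  have "countable I"
    by (rule countable_subset[of _ "D \<times> UNIV"]) (use D(1) in \<open>auto simp: I_def\<close>)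
  have "f -` S \<inter> space M = (\<Union>(d, q)\<in>I. {x \<in> space M. norm (f x - d) \<le> real_of_rat q})"
  proof (intro set_eqI iffI)
    fix x assume x: "x \<in> f -` S \<inter> space M"
    then obtain e where e: "e > 0" "ball (f x) e \<subseteq> S" using S by (auto elim!: openE)
    obtain q where q: "0 < real_of_rat q" "real_of_rat q < e / 2"
      using of_rat_dense[of 0 "e / 2"] e(1) by auto
    obtain d where d: "d \<in> D" "d \<in> ball (f x) (real_of_rat q)"
      using D(2)[of "ball (f x) (real_of_rat q)"] q by auto
    have "cball d (real_of_rat q) \<subseteq> ball (f x) e"
    proof
      fix z assume "z \<in> cball d (real_of_rat q)"
      then show "z \<in> ball (f x) e"
        using d(2) q dist_triangle[of "f x" z d] by auto
    qed
    then have "(d, q) \<in> I" using d q e(2) by (auto simp: I_def)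
    moreover have "norm (f x - d) \<le> real_of_rat q" using d(2) by (simp add: dist_norm)
    ultimately show "x \<in> (\<Union>(d, q)\<in>I. {x \<in> space M. norm (f x - d) \<le> real_of_rat q})"
      using x by auto
  next
    fix x assume "x \<in> (\<Union>(d, q)\<in>I. {x \<in> space M. norm (f x - d) \<le> real_of_rat q})"
    then obtain d q where dq: "(d, q) \<in> I" "x \<in> space M" "norm (f x - d) \<le> real_of_rat q" by auto
    then have "f x \<in> cball d (real_of_rat q)" by (simp add: dist_norm norm_minus_commute)
    then show "x \<in> f -` S \<inter> space M" using dq by (auto simp: I_def)
  qed
  also have "\<dots> \<in> sets M"
    using \<open>countable I\<close> by (intro sets.countable_UN'') (auto simp: I_def intro!: ball)
  finally show "f -` S \<inter> space M \<in> sets M" .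
qed

text \<open>Generators of the predictable sigma-algebra are rectangles with a Borel time side and an
  event of some \<open>F s\<close>, so they are measurable in the product. The restriction matches
  the half-line on which the predictable sigma-algebra lives.\<close>

lemma predictable_algebra_swap_measurable:
  assumes F: "is_filtration M F"
  shows "(\<lambda>(\<omega>, s). (s, \<omega>)) \<in>
    measurable (restrict_space (M \<Otimes>\<^sub>M lborel) (space M \<times> {0..})) (predictable_algebra M F)"
proof -
  have sub: "sets (F s) \<subseteq> sets M" if "0 \<le> s" for s
    using F that by (auto simp: is_filtration_def subalgebra_def)
  have pre: "(\<lambda>(\<omega>, s). (s, \<omega>)) -` (T \<times> A) \<inter> space (restrict_space (M \<Otimes>\<^sub>M lborel) (space M \<times> {0..}))
      \<in> sets (restrict_space (M \<Otimes>\<^sub>M lborel) (space M \<times> {0..}))"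
    if "A \<in> sets M" "T \<in> sets borel" for A and T :: "real set"
  proof -
    have "(\<lambda>(\<omega>, s). (s, \<omega>)) -` (T \<times> A) \<inter> space (restrict_space (M \<Otimes>\<^sub>M lborel) (space M \<times> {0..}))
        = (A \<times> T) \<inter> (space M \<times> {0..})"
      using sets.sets_into_space[OF that(1)] by (auto simp: space_restrict_space space_pair_measure)
    moreover have "A \<times> T \<in> sets (M \<Otimes>\<^sub>M lborel)" using that by (intro pair_measureI) auto
    moreover have "space M \<times> {0..} \<in> sets (M \<Otimes>\<^sub>M (lborel :: real measure))"
      by (intro pair_measureI) auto
    ultimately show ?thesis by (auto simp: sets_restrict_space_iff)
  qed
  show ?thesis
    unfolding predictable_algebra_def
  proof (rule measurable_measure_of)
    show "{{0} \<times> A |A. A \<in> sets (F 0)} \<union> {{s<..t} \<times> A |s t A. 0 \<le> s \<and> s < t \<and> A \<in> sets (F s)}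
        \<subseteq> Pow ({0..} \<times> space M)"
    proof (intro subsetI, elim UnE CollectE exE conjE)
      fix y :: "(real \<times> _) set" and A assume "y = {0} \<times> A" "A \<in> sets (F 0)"
      then have "A \<subseteq> space M" using sub[of 0] sets.sets_into_space[of A M] by auto
      then show "y \<in> Pow ({0..} \<times> space M)" using \<open>y = _\<close> by auto
    next
      fix y :: "(real \<times> _) set" and s t A assume *: "y = {s<..t} \<times> A" "0 \<le> s" "A \<in> sets (F s)"
      then have "A \<subseteq> space M" using sub[of s] sets.sets_into_space[of A M] by auto
      then show "y \<in> Pow ({0..} \<times> space M)" using *(1,2) by auto
    qed
    show "(\<lambda>(\<omega>, s). (s, \<omega>)) \<in> space (restrict_space (M \<Otimes>\<^sub>M lborel) (space M \<times> {0..})) \<rightarrow> {0..} \<times> space M"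
      by (auto simp: space_restrict_space)
  next
    fix y assume "y \<in> {{0} \<times> A |A. A \<in> sets (F 0)}
        \<union> {{s<..t} \<times> A |s t A. 0 \<le> s \<and> s < t \<and> A \<in> sets (F s)}"
    then have "\<exists>T A. y = T \<times> A \<and> A \<in> sets M \<and> T \<in> sets borel"
    proof (elim UnE CollectE exE conjE)
      fix A assume "y = {0} \<times> A" "A \<in> sets (F 0)"
      then show ?thesis using sub[of 0] by (intro exI[of _ "{0}"] exI[of _ A]) auto
    next
      fix s t A assume "y = {s<..t} \<times> A" "0 \<le> s" "A \<in> sets (F s)"
      then show ?thesis using sub[of s] by (intro exI[of _ "{s<..t}"] exI[of _ A]) auto
    qed
    then show "(\<lambda>(\<omega>, s). (s, \<omega>)) -` y \<inter> space (restrict_space (M \<Otimes>\<^sub>M lborel) (space M \<times> {0..}))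
      \<in> sets (restrict_space (M \<Otimes>\<^sub>M lborel) (space M \<times> {0..}))"
      using pre by blast
  qed
qed

text \<open>The indicator extends the process by 0 to negative times, about which predictability
  says nothing.\<close>

lemma predictable_imp_measurable:
  fixes X :: "real \<Rightarrow> 'o \<Rightarrow> 'h::{real_normed_vector, second_countable_topology}"
  assumes F: "is_filtration M F" and X: "predictable M F X"
  shows "(\<lambda>(\<omega>, s). indicat_real {0..} s *\<^sub>R X s \<omega>) \<in> borel_measurable (M \<Otimes>\<^sub>M lborel)"
proof -
  have "(\<lambda>(t, \<omega>). X t \<omega>) \<circ> (\<lambda>(\<omega>, s). (s, \<omega>)) \<in>
      borel_measurable (restrict_space (M \<Otimes>\<^sub>M lborel) (space M \<times> {0..}))"
    by (rule measurable_comp[OF predictable_algebra_swap_measurable[OF F]])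
      (use X in \<open>simp add: predictable_def\<close>)
  then have "(\<lambda>z. indicat_real (space M \<times> {0..}) z *\<^sub>R ((\<lambda>(t, \<omega>). X t \<omega>) \<circ> (\<lambda>(\<omega>, s). (s, \<omega>))) z)
      \<in> borel_measurable (M \<Otimes>\<^sub>M lborel)"
    by (subst (asm) borel_measurable_restrict_space_iff) auto
  then show ?thesis
    by (rule measurable_cong[THEN iffD1, rotated])
      (auto simp: space_pair_measure indicator_def)
qed

text \<open>Cutting off at 1 turns convergence in probability into convergence in L1, where an
  almost surely convergent subsequence exists. For the limit 0 the cut-off is eventually
  inactive.\<close>

lemma (in prob_space) null_in_probability_AE_subseq:
  assumes "null_in_probability M g"
  shows "\<exists>r::nat \<Rightarrow> nat. strict_mono r \<and> (AE \<omega> in M. (\<lambda>k. g (r k) \<omega>) \<longlonglongrightarrow> 0)"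
proof -
  have g [measurable]: "g k \<in> borel_measurable M" for k
    using assms by (simp add: null_in_probability_def)
  have lim: "(\<lambda>k. prob {\<omega> \<in> space M. ennreal \<epsilon> < g k \<omega>}) \<longlonglongrightarrow> 0" if "\<epsilon> > 0" for \<epsilon>
    using assms that by (simp add: null_in_probability_def)
  define u where "u k \<omega> = enn2real (min (g k \<omega>) 1)" for k \<omega>
  have u [measurable]: "u k \<in> borel_measurable M" for k unfolding u_def by measurable
  have u01: "0 \<le> u k \<omega>" "u k \<omega> \<le> 1" for k \<omega>
    unfolding u_def by (auto intro: enn2real_leI)
  have int: "integrable M (u k)" for k
    using u01 by (intro integrable_const_bound[of _ 1]) auto
  have "(\<lambda>k. expectation (\<lambda>\<omega>. norm (u k \<omega>))) \<longlonglongrightarrow> 0"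
  proof (rule LIMSEQ_I)
    fix e :: real assume e: "0 < e"
    define \<epsilon> where "\<epsilon> = min (e / 2) 1"
    have \<epsilon>: "0 < \<epsilon>" "\<epsilon> \<le> e / 2" using e by (auto simp: \<epsilon>_def)
    obtain k0 where k0: "\<And>k. k \<ge> k0 \<Longrightarrow> prob {\<omega> \<in> space M. ennreal \<epsilon> < g k \<omega>} < e / 2"
      using LIMSEQ_D[OF lim[OF \<epsilon>(1)], of "e / 2"] e by fastforce
    have "expectation (\<lambda>\<omega>. norm (u k \<omega>)) < e" if "k \<ge> k0" for k
    proof -
      have "norm (u k \<omega>) \<le> \<epsilon> + indicat_real {\<omega> \<in> space M. ennreal \<epsilon> < g k \<omega>} \<omega>"
        if "\<omega> \<in> space M" for \<omega>
      proof (cases "ennreal \<epsilon> < g k \<omega>")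
        case False
        then have "u k \<omega> \<le> \<epsilon>" using \<epsilon> unfolding u_def
          by (intro enn2real_leI min.coboundedI1) auto
        then show ?thesis using False u01 by simp
      next
        case True
        then show ?thesis using that u01(2)[of k \<omega>] u01(1)[of k \<omega>] \<epsilon>(1) by simp
      qed
      moreover have [simp]: "integrable M (indicat_real {\<omega> \<in> space M. ennreal \<epsilon> < g k \<omega>})"
        by (rule integrable_real_indicator) (auto simp: less_top[symmetric])
      ultimately have "expectation (\<lambda>\<omega>. norm (u k \<omega>))
          \<le> expectation (\<lambda>\<omega>. \<epsilon> + indicat_real {\<omega> \<in> space M. ennreal \<epsilon> < g k \<omega>} \<omega>)"
        using int by (intro integral_mono) auto
      also have "\<dots> = \<epsilon> + prob {\<omega> \<in> space M. ennreal \<epsilon> < g k \<omega>}"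
        by (subst Bochner_Integration.integral_add) (auto simp: prob_space)
      also have "\<dots> < e" using k0[OF that] \<epsilon>(2) by linarith
      finally show ?thesis .
    qed
    then show "\<exists>no. \<forall>n\<ge>no. norm (expectation (\<lambda>\<omega>. norm (u n \<omega>)) - 0) < e" by auto
  qed
  from tendsto_L1_AE_subseq[OF int this]
  obtain r where r: "strict_mono r" "AE \<omega> in M. (\<lambda>k. u (r k) \<omega>) \<longlonglongrightarrow> 0" by blast
  have "(\<lambda>k. g (r k) \<omega>) \<longlonglongrightarrow> 0" if u0: "(\<lambda>k. u (r k) \<omega>) \<longlonglongrightarrow> 0" for \<omega>
  proof -
    have eq: "min (g k \<omega>) 1 = ennreal (u k \<omega>)" for k
      unfolding u_def by (simp add: min_less_iff_disj)
    have lim0: "(\<lambda>k. min (g (r k) \<omega>) 1) \<longlonglongrightarrow> 0"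
      unfolding eq using tendsto_ennrealI[OF u0] by simp
    have "eventually (\<lambda>k. min (g (r k) \<omega>) 1 < 1) sequentially"
      using lim0 by (rule order_tendstoD) simp
    then have "eventually (\<lambda>k. min (g (r k) \<omega>) 1 = g (r k) \<omega>) sequentially"
      by eventually_elim (auto simp: min_def split: if_splits)
    with lim0 show ?thesis by (rule Lim_transform_eventually)
  qed
  with r(2) have "AE \<omega> in M. (\<lambda>k. g (r k) \<omega>) \<longlonglongrightarrow> 0" by auto
  with r(1) show ?thesis by blast
qed

lemma null_in_probability_subseq:
  assumes "null_in_probability M g" "strict_mono r"
  shows "null_in_probability M (\<lambda>k. g (r k))"
  unfolding null_in_probability_def
proof safe
  fix k show "g (r k) \<in> borel_measurable M" using assms(1) by (simp add: null_in_probability_def)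
next
  fix e :: real assume "e > 0"
  then have "(\<lambda>k. measure M {\<omega> \<in> space M. ennreal e < g k \<omega>}) \<longlonglongrightarrow> 0"
    using assms(1) by (simp add: null_in_probability_def)
  from LIMSEQ_subseq_LIMSEQ[OF this assms(2)]
  show "(\<lambda>k. measure M {\<omega> \<in> space M. ennreal e < g (r k) \<omega>}) \<longlonglongrightarrow> 0" by (simp add: o_def)
qed

text \<open>Young's inequality \<open>2 n d \<le> \<epsilon> n^2 + d^2 / \<epsilon>\<close>. The
  coefficient of \<open>(norm b)\<^sup>2\<close> can be made small at the cost of a large one on the
  difference; this yields continuity of the L2 norm after integration.\<close>

lemma norm_sq_diff_le:
  fixes a b :: "'b::real_normed_vector"
  assumes "\<epsilon> > 0"
  shows "\<bar>(norm a)\<^sup>2 - (norm b)\<^sup>2\<bar> \<le> \<epsilon> * (norm b)\<^sup>2 + (1 + 1 / \<epsilon>) * (norm (a - b))\<^sup>2"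
proof -
  define d where "d = norm (a - b)"
  define n where "n = norm b"
  have n: "0 \<le> n" "0 \<le> d" by (auto simp: n_def d_def)
  have "\<bar>norm a - n\<bar> \<le> d" unfolding n_def d_def by (rule norm_triangle_ineq3)
  then have a: "norm a \<le> n + d" "n \<le> norm a + d" by auto
  have "0 \<le> (\<epsilon> * n - d)\<^sup>2 / \<epsilon>" using assms by simp
  also have "\<dots> = \<epsilon> * n\<^sup>2 - 2 * n * d + d\<^sup>2 / \<epsilon>"
    using assms by (simp add: power2_diff field_simps power2_eq_square)
  finally have am: "2 * n * d \<le> \<epsilon> * n\<^sup>2 + d\<^sup>2 / \<epsilon>" by simp
  have "(norm a)\<^sup>2 \<le> (n + d)\<^sup>2" using a(1) by (intro power_mono) auto
  then have 1: "(norm a)\<^sup>2 - n\<^sup>2 \<le> 2 * n * d + d\<^sup>2" by (simp add: power2_sum)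
  have 2: "n\<^sup>2 - (norm a)\<^sup>2 \<le> 2 * n * d + d\<^sup>2"
  \<comment> \<open>Squaring \<open>n - d \<le> norm a\<close> is legitimate only if
    \<open>n - d\<close> is nonnegative.\<close>
  proof (cases "n \<le> d")
    case True
    then have "n\<^sup>2 \<le> d\<^sup>2" using n by (intro power_mono) auto
    moreover have "0 \<le> 2 * n * d" "0 \<le> (norm a)\<^sup>2" using n by auto
    ultimately show ?thesis by linarith
  next
    case False
    then have "(n - d)\<^sup>2 \<le> (norm a)\<^sup>2" using a(2) by (intro power_mono) auto
    then show ?thesis using zero_le_power2[of d] unfolding power2_diff by linarith
  qed
  from 1 2 am have "\<bar>(norm a)\<^sup>2 - n\<^sup>2\<bar> \<le> \<epsilon> * n\<^sup>2 + d\<^sup>2 / \<epsilon> + d\<^sup>2" by linarith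
  then show ?thesis using assms by (simp add: n_def d_def algebra_simps)
qed

lemma norm_sq_add_le:
  fixes a b :: "'b::real_normed_vector"
  shows "(norm (a + b))\<^sup>2 \<le> 2 * (norm a)\<^sup>2 + 2 * (norm b)\<^sup>2"
proof -
  have "(norm (a + b))\<^sup>2 \<le> (norm a + norm b)\<^sup>2" by (intro power_mono norm_triangle_ineq) auto
  also have "\<dots> \<le> 2 * (norm a)\<^sup>2 + 2 * (norm b)\<^sup>2"
    using sum_squares_ge_zero[of "norm a - norm b" 0]
    by (simp add: power2_eq_square algebra_simps)
  finally show ?thesis .
qed

text \<open>Only the limit is assumed square integrable; the \<open>f n\<close> are so eventually,
  because their distance to \<open>g\<close> becomes finite.\<close>

lemma nn_integral_norm_sq_tendsto:
  fixes f :: "nat \<Rightarrow> 'a \<Rightarrow> 'b::{real_normed_vector, second_countable_topology}"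
  assumes f [measurable]: "\<And>n. f n \<in> borel_measurable N" and g [measurable]: "g \<in> borel_measurable N"
    and lim: "(\<lambda>n. \<integral>\<^sup>+x. ennreal ((norm (f n x - g x))\<^sup>2) \<partial>N) \<longlonglongrightarrow> 0"
    and fin: "(\<integral>\<^sup>+x. ennreal ((norm (g x))\<^sup>2) \<partial>N) < \<infinity>"
  shows "(\<lambda>n. \<integral>\<^sup>+x. ennreal ((norm (f n x))\<^sup>2) \<partial>N) \<longlonglongrightarrow> (\<integral>\<^sup>+x. ennreal ((norm (g x))\<^sup>2) \<partial>N)"
proof -
  let ?e = "\<lambda>n. \<integral>\<^sup>+x. ennreal ((norm (f n x - g x))\<^sup>2) \<partial>N"
  have ig: "integrable N (\<lambda>x. (norm (g x))\<^sup>2)"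
    using fin by (intro integrableI_nonneg) auto
  define s where "s = (\<integral>x. (norm (g x))\<^sup>2 \<partial>N)"
  have s: "0 \<le> s" by (simp add: s_def)
  have ev: "eventually (\<lambda>n. ?e n < \<infinity>) sequentially"
    using lim by (rule order_tendstoD) simp
  have id: "integrable N (\<lambda>x. (norm (f n x - g x))\<^sup>2)" if "?e n < \<infinity>" for n
    using that by (intro integrableI_nonneg) auto
  have if': "integrable N (\<lambda>x. (norm (f n x))\<^sup>2)" if "?e n < \<infinity>" for n
  proof (rule Bochner_Integration.integrable_bound)
    show "integrable N (\<lambda>x. 2 * (norm (f n x - g x))\<^sup>2 + 2 * (norm (g x))\<^sup>2)"
      using id[OF that] ig by auto
    show "AE x in N. norm ((norm (f n x))\<^sup>2) \<le> norm (2 * (norm (f n x - g x))\<^sup>2 + 2 * (norm (g x))\<^sup>2)"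
      using norm_sq_add_le[of "f n x - g x" "g x" for x] by (intro AE_I2) simp
  qed simp
  define r where "r n = (\<integral>x. (norm (f n x))\<^sup>2 \<partial>N)" for n
  have bound: "\<bar>r n - s\<bar> \<le> \<epsilon> * s + (1 + 1 / \<epsilon>) * enn2real (?e n)"
    if fin: "?e n < \<infinity>" and \<epsilon>: "\<epsilon> > 0" for n \<epsilon>
  proof -
    have "\<bar>r n - s\<bar> = \<bar>\<integral>x. (norm (f n x))\<^sup>2 - (norm (g x))\<^sup>2 \<partial>N\<bar>"
      unfolding r_def s_def using if'[OF fin] ig by (subst Bochner_Integration.integral_diff) auto
    also have "\<dots> \<le> (\<integral>x. \<bar>(norm (f n x))\<^sup>2 - (norm (g x))\<^sup>2\<bar> \<partial>N)" by (rule integral_abs_bound)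
    also have "\<dots> \<le> (\<integral>x. \<epsilon> * (norm (g x))\<^sup>2 + (1 + 1 / \<epsilon>) * (norm (f n x - g x))\<^sup>2 \<partial>N)"
      using if'[OF fin] ig id[OF fin] by (intro integral_mono norm_sq_diff_le \<epsilon>) auto
    also have "\<dots> = \<epsilon> * s + (1 + 1 / \<epsilon>) * (\<integral>x. (norm (f n x - g x))\<^sup>2 \<partial>N)"
      unfolding s_def using ig id[OF fin] by (subst Bochner_Integration.integral_add) auto
    also have "(\<integral>x. (norm (f n x - g x))\<^sup>2 \<partial>N) = enn2real (?e n)"
      by (rule integral_eq_nn_integral) auto
    finally show ?thesis .
  qed
  have e0: "(\<lambda>n. enn2real (?e n)) \<longlonglongrightarrow> 0"
    using tendsto_enn2real[of _ 0] lim by simp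
  have "r \<longlonglongrightarrow> s"
  proof (rule LIMSEQ_I)
    fix \<eta> :: real assume \<eta>: "0 < \<eta>"
    \<comment> \<open>Makes \<open>\<epsilon> * s\<close> less than \<open>\<eta> / 2\<close>, also
      when \<open>s = 0\<close>.\<close>
    define \<epsilon> where "\<epsilon> = \<eta> / (2 * (s + 1))"
    have \<epsilon>: "\<epsilon> > 0" using \<eta> s by (simp add: \<epsilon>_def)
    have "\<epsilon> * s < \<eta> / 2" using \<eta> s by (simp add: \<epsilon>_def field_simps)
    moreover have "(\<lambda>n. \<epsilon> * s + (1 + 1 / \<epsilon>) * enn2real (?e n)) \<longlonglongrightarrow> \<epsilon> * s + (1 + 1 / \<epsilon>) * 0"
      by (intro tendsto_intros e0)
    ultimately have "eventually (\<lambda>n. \<epsilon> * s + (1 + 1 / \<epsilon>) * enn2real (?e n) < \<eta>) sequentially"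
      using \<eta> by (intro order_tendstoD(2)[of _ "\<epsilon> * s + (1 + 1 / \<epsilon>) * 0"]) auto
    with ev have "eventually (\<lambda>n. norm (r n - s) < \<eta>) sequentially"
      by eventually_elim (use bound[OF _ \<epsilon>] in force)
    then show "\<exists>no. \<forall>n\<ge>no. norm (r n - s) < \<eta>" by (simp add: eventually_sequentially)
  qed
  then have "(\<lambda>n. ennreal (r n)) \<longlonglongrightarrow> ennreal s" by (rule tendsto_ennrealI)
  moreover have "eventually (\<lambda>n. ennreal (r n) = (\<integral>\<^sup>+x. ennreal ((norm (f n x))\<^sup>2) \<partial>N)) sequentially"
    using ev by eventually_elim (simp add: r_def nn_integral_eq_integral if')
  moreover have "ennreal s = (\<integral>\<^sup>+x. ennreal ((norm (g x))\<^sup>2) \<partial>N)"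
    using ig by (simp add: s_def nn_integral_eq_integral)
  ultimately show ?thesis using Lim_transform_eventually by fastforce
qed

subsection \<open>Increments of a Wiener process\<close>

lemma centered_normal_moments:
  assumes v: "0 \<le> v"
  shows "integrable (centered_normal v) (\<lambda>x. x)" "(\<integral>x. x \<partial>centered_normal v) = 0"
    "integrable (centered_normal v) (\<lambda>x. x\<^sup>2)" "(\<integral>x. x\<^sup>2 \<partial>centered_normal v) = v"
proof -
  have "integrable (centered_normal v) (\<lambda>x. x) \<and> (\<integral>x. x \<partial>centered_normal v) = 0
    \<and> integrable (centered_normal v) (\<lambda>x. x\<^sup>2) \<and> (\<integral>x. x\<^sup>2 \<partial>centered_normal v) = v"
  proof (cases "v = 0")
    case True
    interpret prob_space "return borel (0::real)" by (rule prob_space_return) simp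
    have *: "AE x in return borel (0::real). x = 0" by (subst AE_return) auto
    have "integrable (return borel (0::real)) (\<lambda>x. x)" "integrable (return borel (0::real)) (\<lambda>x. x\<^sup>2)"
      using * by (auto intro!: integrable_const_bound[of _ 0] elim: eventually_mono)
    moreover have "(\<integral>x. x \<partial>return borel (0::real)) = 0" "(\<integral>x. x\<^sup>2 \<partial>return borel (0::real)) = 0"
      by (simp_all add: integral_return[where g="\<lambda>x. x"] integral_return[where g="\<lambda>x. x\<^sup>2"])
    ultimately show ?thesis unfolding centered_normal_def if_P[OF True] using True by blast
  next
    case False
    then have s: "0 < sqrt v" using v by simp
    have "has_bochner_integral lborel (\<lambda>x. normal_density 0 (sqrt v) x * x) 0"
      using normal_moment_odd[OF s, of 0 0] by simp
    moreover have "has_bochner_integral lborel (\<lambda>x. normal_density 0 (sqrt v) x * x\<^sup>2) v"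
      using normal_moment_even[OF s, of 0 1] v by simp
    ultimately show ?thesis
      using False
      by (auto simp: centered_normal_def integrable_density integral_density has_bochner_integral_iff)
  qed
  then show "integrable (centered_normal v) (\<lambda>x. x)" "(\<integral>x. x \<partial>centered_normal v) = 0"
    "integrable (centered_normal v) (\<lambda>x. x\<^sup>2)" "(\<integral>x. x\<^sup>2 \<partial>centered_normal v) = v" by auto
qed

lemma integrable_mult_squares:
  fixes f g :: "'a \<Rightarrow> real"
  assumes [measurable]: "f \<in> borel_measurable M" "g \<in> borel_measurable M"
    and "integrable M (\<lambda>x. (f x)\<^sup>2)" "integrable M (\<lambda>x. (g x)\<^sup>2)"
  shows "integrable M (\<lambda>x. f x * g x)"
proof (rule Bochner_Integration.integrable_bound)
  show "integrable M (\<lambda>x. (f x)\<^sup>2 + (g x)\<^sup>2)" using assms by auto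
  have "\<bar>a * b\<bar> \<le> a\<^sup>2 + b\<^sup>2" for a b :: real
  proof -
    have "2 * (\<bar>a\<bar> * \<bar>b\<bar>) \<le> a\<^sup>2 + b\<^sup>2" using zero_le_power2[of "\<bar>a\<bar> - \<bar>b\<bar>"] by (simp add: power2_diff)
    moreover have "0 \<le> \<bar>a\<bar> * \<bar>b\<bar>" by simp
    ultimately show ?thesis unfolding abs_mult by linarith
  qed
  then show "AE x in M. norm (f x * g x) \<le> norm ((f x)\<^sup>2 + (g x)\<^sup>2)" by (intro AE_I2) simp
qed simp

text \<open>Used to replace a random coefficient by deterministic vectors on its level sets, which
  belong to the sigma-algebra of the left end point of the interval.\<close>

lemma simple_function_inner_sum:
  fixes c :: "'a \<Rightarrow> 'h::real_inner"
  assumes "simple_function M c" "x \<in> space M"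
  shows "d \<bullet> c x = (\<Sum>v\<in>c ` space M. indicat_real (c -` {v} \<inter> space M) x * (d \<bullet> v))"
proof -
  have "(\<Sum>v\<in>c ` space M. indicat_real (c -` {v} \<inter> space M) x * (d \<bullet> v))
      = (\<Sum>v\<in>c ` space M. if v = c x then d \<bullet> c x else 0)"
    using assms(2) by (intro sum.cong) (auto simp: indicator_def)
  also have "\<dots> = d \<bullet> c x"
    using assms by (simp add: simple_functionD)
  finally show ?thesis by simp
qed

locale wiener = prob_space M for M :: "'o measure" +
  fixes F :: "real \<Rightarrow> 'o measure"
    and W :: "real \<Rightarrow> 'o \<Rightarrow> 'h::{real_inner, banach, second_countable_topology}"
    and Q :: "'h \<Rightarrow>\<^sub>L 'h"
  assumes filtration: "is_filtration M F"
    and covariance: "covariance_operator Q"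
    and wiener: "wiener_process M F Q W"
begin

lemma subalgebra_F: "0 \<le> s \<Longrightarrow> subalgebra M (F s)"
  using filtration by (simp add: is_filtration_def)

lemma space_F: "0 \<le> s \<Longrightarrow> space (F s) = space M"
  using subalgebra_F by (simp add: subalgebra_def)

lemma measurable_F_imp: "0 \<le> s \<Longrightarrow> f \<in> measurable (F s) N \<Longrightarrow> f \<in> measurable M N"
  using subalgebra_F measurable_from_subalg by blast

lemma subalgebra_F_mono: "0 \<le> s \<Longrightarrow> s \<le> t \<Longrightarrow> subalgebra (F t) (F s)"
  using filtration subalgebra_F[of s] subalgebra_F[of t] by (simp add: is_filtration_def subalgebra_def)

lemma measurable_F_mono: "0 \<le> s \<Longrightarrow> s \<le> t \<Longrightarrow> f \<in> measurable (F s) N \<Longrightarrow> f \<in> measurable (F t) N"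
  using subalgebra_F_mono measurable_from_subalg by blast

lemma sets_F_mono: "0 \<le> s \<Longrightarrow> s \<le> t \<Longrightarrow> A \<in> sets (F s) \<Longrightarrow> A \<in> sets (F t)"
  using filtration by (auto simp: is_filtration_def)

lemma measurable_W_F: "0 \<le> s \<Longrightarrow> s \<le> t \<Longrightarrow> W s \<in> borel_measurable (F t)"
  using wiener measurable_F_mono[of s t "W s"] by (simp add: wiener_process_def adapted_def)

lemma measurable_W: "0 \<le> s \<Longrightarrow> W s \<in> borel_measurable M"
  using measurable_W_F[of s s] measurable_F_imp by auto

lemma Q_nonneg: "0 \<le> Q h \<bullet> h"
  using covariance by (cases "h = 0") (auto simp: covariance_operator_def intro: less_imp_le)

lemma Q_symmetric: "Q g \<bullet> h = Q h \<bullet> g"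
  using covariance by (metis covariance_operator_def inner_commute symmetric_op_def)

lemma increment_moments:
  assumes "0 \<le> s" "s \<le> t"
  shows "integrable M (\<lambda>\<omega>. (W t \<omega> - W s \<omega>) \<bullet> h)" "expectation (\<lambda>\<omega>. (W t \<omega> - W s \<omega>) \<bullet> h) = 0"
    "integrable M (\<lambda>\<omega>. ((W t \<omega> - W s \<omega>) \<bullet> h)\<^sup>2)"
    "expectation (\<lambda>\<omega>. ((W t \<omega> - W s \<omega>) \<bullet> h)\<^sup>2) = (t - s) * (Q h \<bullet> h)"
proof -
  have [measurable]: "W s \<in> borel_measurable M" "W t \<in> borel_measurable M"
    using assms by (auto intro: measurable_W)
  have d: "distr M borel (\<lambda>\<omega>. (W t \<omega> - W s \<omega>) \<bullet> h) = centered_normal ((t - s) * (Q h \<bullet> h))"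
    using wiener assms by (auto simp: wiener_process_def)
  have v: "0 \<le> (t - s) * (Q h \<bullet> h)" using assms Q_nonneg by simp
  note m = centered_normal_moments[OF v, folded d]
  show "integrable M (\<lambda>\<omega>. (W t \<omega> - W s \<omega>) \<bullet> h)" using m(1) by (simp add: integrable_distr_eq)
  show "expectation (\<lambda>\<omega>. (W t \<omega> - W s \<omega>) \<bullet> h) = 0" using m(2) by (simp add: integral_distr)
  show "integrable M (\<lambda>\<omega>. ((W t \<omega> - W s \<omega>) \<bullet> h)\<^sup>2)" using m(3) by (simp add: integrable_distr_eq)
  show "expectation (\<lambda>\<omega>. ((W t \<omega> - W s \<omega>) \<bullet> h)\<^sup>2) = (t - s) * (Q h \<bullet> h)"
    using m(4) by (simp add: integral_distr)
qed

lemma increment_product: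
  assumes st: "0 \<le> s" "s \<le> t" "0 \<le> s'" "s' \<le> t'"
  shows "integrable M (\<lambda>\<omega>. ((W t \<omega> - W s \<omega>) \<bullet> g) * ((W t' \<omega> - W s' \<omega>) \<bullet> h))"
proof -
  have [measurable]: "W s \<in> borel_measurable M" "W t \<in> borel_measurable M"
    "W s' \<in> borel_measurable M" "W t' \<in> borel_measurable M"
    using st by (auto intro: measurable_W)
  show ?thesis using st by (intro integrable_mult_squares increment_moments) auto
qed

text \<open>Polarization, since only the variances of one-dimensional projections are given.\<close>

lemma increment_covariance:
  assumes st: "0 \<le> s" "s \<le> t"
  shows "expectation (\<lambda>\<omega>. ((W t \<omega> - W s \<omega>) \<bullet> g) * ((W t \<omega> - W s \<omega>) \<bullet> h)) = (t - s) * (Q g \<bullet> h)"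
proof -
  let ?D = "\<lambda>\<omega>. W t \<omega> - W s \<omega>"
  have "(?D \<omega> \<bullet> g) * (?D \<omega> \<bullet> h) = ((?D \<omega> \<bullet> (g + h))\<^sup>2 - (?D \<omega> \<bullet> (g - h))\<^sup>2) / 4" for \<omega>
    unfolding inner_add_right inner_diff_right by (simp add: power2_eq_square field_simps)
  then have "expectation (\<lambda>\<omega>. (?D \<omega> \<bullet> g) * (?D \<omega> \<bullet> h)) =
      expectation (\<lambda>\<omega>. ((?D \<omega> \<bullet> (g + h))\<^sup>2 - (?D \<omega> \<bullet> (g - h))\<^sup>2) / 4)" by (simp only:)
  also have "\<dots> = (expectation (\<lambda>\<omega>. (?D \<omega> \<bullet> (g + h))\<^sup>2) - expectation (\<lambda>\<omega>. (?D \<omega> \<bullet> (g - h))\<^sup>2)) / 4"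
    using increment_moments(3)[OF st] by (simp only: integral_divide_zero Bochner_Integration.integral_diff)
  also have "\<dots> = ((t - s) * (Q (g + h) \<bullet> (g + h)) - (t - s) * (Q (g - h) \<bullet> (g - h))) / 4"
    by (simp only: increment_moments(4)[OF st])
  also have "\<dots> = (t - s) * (Q (g + h) \<bullet> (g + h) - Q (g - h) \<bullet> (g - h)) / 4"
    by (simp only: right_diff_distrib)
  also have "Q (g + h) \<bullet> (g + h) - Q (g - h) \<bullet> (g - h) = 4 * (Q g \<bullet> h)"
    using Q_symmetric[of g h]
    by (simp add: blinfun.add_right blinfun.diff_right inner_add inner_diff)
  finally show ?thesis by simp
qed

text \<open>The definition states independence for families of events. Both are stable under
  intersection, so it passes to the generated sigma-algebras, which contain those of
  \<open>X\<close> and of functions of the increment.\<close>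

lemma independent_increment:
  assumes st: "0 \<le> s" "s \<le> t" and X: "X \<in> borel_measurable (F s)"
    and g: "g \<in> borel_measurable borel"
  shows "indep_var borel (X :: 'o \<Rightarrow> real) borel (\<lambda>\<omega>. g (W t \<omega> - W s \<omega>) :: real)"
proof -
  have [measurable]: "W s \<in> borel_measurable M" "W t \<in> borel_measurable M" "X \<in> borel_measurable M"
    using st X by (auto intro: measurable_W measurable_F_imp)
  let ?B = "{(\<lambda>\<omega>. W t \<omega> - W s \<omega>) -` A \<inter> space M | A. A \<in> sets borel}"
  have "indep_set (sets (F s)) ?B" using wiener st by (auto simp: wiener_process_def)
  then have "indep_set (sigma_sets (space M) (sets (F s))) (sigma_sets (space M) ?B)"
  proof (rule indep_set_sigma_sets)
    show "Int_stable (sets (F s))" by (rule sets.Int_stable)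
    show "Int_stable ?B"
    proof (rule Int_stableI)
      fix a b assume "a \<in> ?B" "b \<in> ?B"
      then obtain A A' where "a = (\<lambda>\<omega>. W t \<omega> - W s \<omega>) -` A \<inter> space M" "A \<in> sets borel"
        "b = (\<lambda>\<omega>. W t \<omega> - W s \<omega>) -` A' \<inter> space M" "A' \<in> sets borel" by blast
      then show "a \<inter> b \<in> ?B" by (intro CollectI exI[of _ "A \<inter> A'"]) auto
    qed
  qed
  moreover have "sigma_sets (space M) {X -` A \<inter> space M | A. A \<in> sets borel}
      \<subseteq> sigma_sets (space M) (sets (F s))"
    using measurable_sets[OF X] space_F[OF st(1)] by (intro sigma_sets_mono') auto
  moreover have "sigma_sets (space M) {(\<lambda>\<omega>. g (W t \<omega> - W s \<omega>)) -` A \<inter> space M | A. A \<in> sets borel}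
      \<subseteq> sigma_sets (space M) ?B"
  proof (intro sigma_sets_mono' subsetI, elim CollectE exE conjE)
    fix y and A :: "real set" assume A: "y = (\<lambda>\<omega>. g (W t \<omega> - W s \<omega>)) -` A \<inter> space M" "A \<in> sets borel"
    then have "g -` A \<in> sets borel" using measurable_sets[OF g A(2)] by simp
    then show "y \<in> ?B" using A(1) by (intro CollectI exI[of _ "g -` A"]) auto
  qed
  ultimately have "indep_set (sigma_sets (space M) {X -` A \<inter> space M | A. A \<in> sets borel})
      (sigma_sets (space M) {(\<lambda>\<omega>. g (W t \<omega> - W s \<omega>)) -` A \<inter> space M | A. A \<in> sets borel})"
    unfolding indep_sets2_eq by blast
  then show ?thesis
    unfolding indep_var_eq using g by (intro conjI) auto
qed

lemma expectation_mult_increment: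
  assumes st: "0 \<le> s" "s \<le> t" and X: "X \<in> borel_measurable (F s)" "integrable M X"
  shows "integrable M (\<lambda>\<omega>. X \<omega> * ((W t \<omega> - W s \<omega>) \<bullet> h))"
    and "expectation (\<lambda>\<omega>. X \<omega> * ((W t \<omega> - W s \<omega>) \<bullet> h)) = 0"
  using indep_var_integrable[OF independent_increment[OF st X(1), of "\<lambda>x. x \<bullet> h"] X(2)]
    indep_var_lebesgue_integral[OF independent_increment[OF st X(1), of "\<lambda>x. x \<bullet> h"] X(2)]
    increment_moments(1,2)[OF st] by simp_all

lemma expectation_indicator_increment_product:
  assumes st: "0 \<le> s" "s \<le> t" and G: "G \<in> sets (F s)"
  shows "expectation (\<lambda>\<omega>. indicat_real G \<omega> * (((W t \<omega> - W s \<omega>) \<bullet> g) * ((W t \<omega> - W s \<omega>) \<bullet> h)))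
    = prob G * ((t - s) * (Q g \<bullet> h))"
proof -
  have GM: "G \<in> sets M" using G subalgebra_F[OF st(1)] by (auto simp: subalgebra_def)
  have i: "integrable M (indicat_real G)"
    using GM by (intro integrable_real_indicator) (auto simp: less_top[symmetric])
  have "indep_var borel (indicat_real G) borel (\<lambda>\<omega>. ((W t \<omega> - W s \<omega>) \<bullet> g) * ((W t \<omega> - W s \<omega>) \<bullet> h))"
    using G by (intro independent_increment[OF st, where g="\<lambda>x. (x \<bullet> g) * (x \<bullet> h)"]) auto
  from indep_var_lebesgue_integral[OF this i increment_product[OF st st]]
  show ?thesis using GM by (simp add: increment_covariance[OF st])
qed

lemma indicator_increment_integrable:
  assumes "A \<in> sets M" "0 \<le> s" "s \<le> t"
  shows "integrable M (\<lambda>\<omega>. indicat_real A \<omega> * ((W t \<omega> - W s \<omega>) \<bullet> h))"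
  using integrable_mult_indicator[OF assms(1) increment_moments(1)[OF assms(2,3), of h]] by simp

definition overlap :: "real \<Rightarrow> real \<Rightarrow> real \<Rightarrow> real \<Rightarrow> real" where
  "overlap a b a' b' = measure lborel ({a<..b} \<inter> {a'<..b'})"

lemma overlap_eq: "overlap a b a' b' = max 0 (min b b' - max a a')"
proof -
  have "{a<..b} \<inter> {a'<..b'} = {max a a'<..min b b'}" by auto
  moreover have "measure lborel {p<..q} = max 0 (q - p)" for p q :: real
    by (cases "p \<le> q") auto
  ultimately show ?thesis by (simp only: overlap_def)
qed

text \<open>Both events are known at the later left end point \<open>a'\<close>. Cutting the
  intervals at the remaining end points leaves products of increments over ordered disjoint
  intervals, which have mean zero, and one product over the common interval.\<close>

lemma indicator_increments_ordered:
  assumes ab: "0 \<le> a" "a \<le> b" "a \<le> a'" "a' \<le> b'" and G: "G \<in> sets (F a)" "G' \<in> sets (F a')"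
  shows "expectation (\<lambda>\<omega>. (indicat_real G \<omega> * ((W b \<omega> - W a \<omega>) \<bullet> v))
      * (indicat_real G' \<omega> * ((W b' \<omega> - W a' \<omega>) \<bullet> v')))
    = overlap a b a' b' * (prob (G \<inter> G') * (Q v \<bullet> v'))"
proof -
  define H where "H = G \<inter> G'"
  have a': "0 \<le> a'" using ab by simp
  have Ga': "G \<in> sets (F a')" using G sets_F_mono[OF ab(1,3)] by simp
  have HF: "H \<in> sets (F u)" if "a' \<le> u" for u
    using sets_F_mono[OF a' that] Ga' G(2) by (auto simp: H_def)
  have HM: "H \<in> sets M" using HF[of a'] subalgebra_F[OF a'] by (auto simp: subalgebra_def)
  have prod_eq: "(indicat_real G \<omega> * x) * (indicat_real G' \<omega> * y) = indicat_real H \<omega> * x * y" for x y \<omega>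
    by (auto simp: H_def indicator_def)
  have X: "(\<lambda>\<omega>. indicat_real H \<omega> * ((W q \<omega> - W p \<omega>) \<bullet> h)) \<in> borel_measurable (F u)"
    "integrable M (\<lambda>\<omega>. indicat_real H \<omega> * ((W q \<omega> - W p \<omega>) \<bullet> h))"
    if "0 \<le> p" "p \<le> q" "q \<le> u" "a' \<le> u" for p q u h
  proof -
    have [measurable]: "W p \<in> borel_measurable (F u)" "W q \<in> borel_measurable (F u)" "H \<in> sets (F u)"
      using that HF by (auto intro: measurable_W_F)
    show "(\<lambda>\<omega>. indicat_real H \<omega> * ((W q \<omega> - W p \<omega>) \<bullet> h)) \<in> borel_measurable (F u)" by measurable
    show "integrable M (\<lambda>\<omega>. indicat_real H \<omega> * ((W q \<omega> - W p \<omega>) \<bullet> h))"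
      using that HM by (intro indicator_increment_integrable)
  qed
  \<comment> \<open>The factor with \<open>H\<close> is known at time \<open>u\<close>; the
    increment after \<open>u\<close> is independent of it and centred.\<close>
  have Z: "integrable M (\<lambda>\<omega>. indicat_real H \<omega> * ((W q \<omega> - W p \<omega>) \<bullet> h) * ((W r \<omega> - W u \<omega>) \<bullet> k))"
    "expectation (\<lambda>\<omega>. indicat_real H \<omega> * ((W q \<omega> - W p \<omega>) \<bullet> h) * ((W r \<omega> - W u \<omega>) \<bullet> k)) = 0"
    if "0 \<le> p" "p \<le> q" "q \<le> u" "a' \<le> u" "u \<le> r" for p q u r h k
    using expectation_mult_increment[OF _ that(5) X[OF that(1-4)]] that by simp_all
  have S: "integrable M (\<lambda>\<omega>. indicat_real H \<omega> * ((W u \<omega> - W a' \<omega>) \<bullet> v) * ((W u \<omega> - W a' \<omega>) \<bullet> v'))"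
    "expectation (\<lambda>\<omega>. indicat_real H \<omega> * ((W u \<omega> - W a' \<omega>) \<bullet> v) * ((W u \<omega> - W a' \<omega>) \<bullet> v'))
      = prob H * ((u - a') * (Q v \<bullet> v'))" if "a' \<le> u" for u
    using integrable_mult_indicator[OF HM increment_product[OF a' that a' that, of v v']]
      expectation_indicator_increment_product[OF a' that HF[of a'], of v v'] by (simp_all add: mult.assoc)
  show ?thesis unfolding prod_eq H_def[symmetric] overlap_eq
  proof (cases "b \<le> a'")
    case True
    then show "expectation (\<lambda>\<omega>. indicat_real H \<omega> * ((W b \<omega> - W a \<omega>) \<bullet> v) * ((W b' \<omega> - W a' \<omega>) \<bullet> v'))
      = max 0 (min b b' - max a a') * (prob H * (Q v \<bullet> v'))"
      using ab by (simp add: Z(2))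
  next
    case False
    show "expectation (\<lambda>\<omega>. indicat_real H \<omega> * ((W b \<omega> - W a \<omega>) \<bullet> v) * ((W b' \<omega> - W a' \<omega>) \<bullet> v'))
      = max 0 (min b b' - max a a') * (prob H * (Q v \<bullet> v'))"
    proof (cases "b \<le> b'")
      case True
      \<comment> \<open>The first interval is cut at \<open>a'\<close> and the second at
        \<open>b\<close>, so that \<open>{a'<..b}\<close> is common to both.\<close>
      have "expectation (\<lambda>\<omega>. indicat_real H \<omega> * ((W b \<omega> - W a \<omega>) \<bullet> v) * ((W b' \<omega> - W a' \<omega>) \<bullet> v'))
        = expectation (\<lambda>\<omega>. indicat_real H \<omega> * ((W a' \<omega> - W a \<omega>) \<bullet> v) * ((W b' \<omega> - W a' \<omega>) \<bullet> v')
          + (indicat_real H \<omega> * ((W b \<omega> - W a' \<omega>) \<bullet> v) * ((W b \<omega> - W a' \<omega>) \<bullet> v')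
            + indicat_real H \<omega> * ((W b \<omega> - W a' \<omega>) \<bullet> v) * ((W b' \<omega> - W b \<omega>) \<bullet> v')))"
        by (intro Bochner_Integration.integral_cong refl) (simp add: inner_diff_left algebra_simps)
      also have "\<dots> = prob H * ((b - a') * (Q v \<bullet> v'))"
        using True False ab a'
        by (subst Bochner_Integration.integral_add, (intro Bochner_Integration.integrable_add Z S; simp)+)+
          (simp add: Z(2) S(2))
      finally show ?thesis using True False ab by simp
    next
      case b: False
      \<comment> \<open>Here the second interval ends first and is itself the common part. In the
        last term the factors are exchanged, because the piece after \<open>b'\<close> must be the
        later increment.\<close>
      have "expectation (\<lambda>\<omega>. indicat_real H \<omega> * ((W b \<omega> - W a \<omega>) \<bullet> v) * ((W b' \<omega> - W a' \<omega>) \<bullet> v'))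
        = expectation (\<lambda>\<omega>. indicat_real H \<omega> * ((W a' \<omega> - W a \<omega>) \<bullet> v) * ((W b' \<omega> - W a' \<omega>) \<bullet> v')
          + (indicat_real H \<omega> * ((W b' \<omega> - W a' \<omega>) \<bullet> v) * ((W b' \<omega> - W a' \<omega>) \<bullet> v')
            + indicat_real H \<omega> * ((W b' \<omega> - W a' \<omega>) \<bullet> v') * ((W b \<omega> - W b' \<omega>) \<bullet> v)))"
        by (intro Bochner_Integration.integral_cong refl) (simp add: inner_diff_left algebra_simps)
      also have "\<dots> = prob H * ((b' - a') * (Q v \<bullet> v'))"
        using b False ab a'
        by (subst Bochner_Integration.integral_add, (intro Bochner_Integration.integrable_add Z S; simp)+)+
          (simp add: Z(2) S(2))
      finally show ?thesis using b False ab by simp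
    qed
  qed
qed

lemma indicator_increments:
  assumes ab: "0 \<le> a" "a \<le> b" "0 \<le> a'" "a' \<le> b'" and G: "G \<in> sets (F a)" "G' \<in> sets (F a')"
  shows "expectation (\<lambda>\<omega>. (indicat_real G \<omega> * ((W b \<omega> - W a \<omega>) \<bullet> v))
      * (indicat_real G' \<omega> * ((W b' \<omega> - W a' \<omega>) \<bullet> v')))
    = overlap a b a' b' * (prob (G \<inter> G') * (Q v \<bullet> v'))"
proof (cases "a \<le> a'")
  case True
  then show ?thesis using assms by (intro indicator_increments_ordered) auto
next
  case False
  have "expectation (\<lambda>\<omega>. (indicat_real G \<omega> * ((W b \<omega> - W a \<omega>) \<bullet> v))
      * (indicat_real G' \<omega> * ((W b' \<omega> - W a' \<omega>) \<bullet> v')))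
    = expectation (\<lambda>\<omega>. (indicat_real G' \<omega> * ((W b' \<omega> - W a' \<omega>) \<bullet> v'))
      * (indicat_real G \<omega> * ((W b \<omega> - W a \<omega>) \<bullet> v)))"
    by (simp only: mult.commute)
  also have "\<dots> = overlap a' b' a b * (prob (G' \<inter> G) * (Q v' \<bullet> v))"
    using False assms by (intro indicator_increments_ordered) auto
  finally show ?thesis by (simp add: overlap_def Int_commute Q_symmetric[of v'])
qed

lemma indicator_increments_integrable:
  assumes ab: "0 \<le> a" "a \<le> b" "0 \<le> a'" "a' \<le> b'" and G: "G \<in> sets M" "G' \<in> sets M"
  shows "integrable M (\<lambda>\<omega>. (indicat_real G \<omega> * ((W b \<omega> - W a \<omega>) \<bullet> v))
      * (indicat_real G' \<omega> * ((W b' \<omega> - W a' \<omega>) \<bullet> v')))"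
proof -
  have "G \<inter> G' \<in> sets M" using G by auto
  from integrable_mult_indicator[OF this increment_product[OF ab, of v v']]
  show ?thesis by (rule Bochner_Integration.integrable_cong[OF refl, THEN iffD1, rotated])
      (auto simp: indicator_def)
qed

lemma simple_increment_expectation:
  assumes ab: "0 \<le> a" "a \<le> b" and c: "simple_function (F a) c"
  shows "integrable M (\<lambda>\<omega>. (W b \<omega> - W a \<omega>) \<bullet> c \<omega>)" "expectation (\<lambda>\<omega>. (W b \<omega> - W a \<omega>) \<bullet> c \<omega>) = 0"
proof -
  define G where "G v = c -` {v} \<inter> space M" for v
  have sp: "space (F a) = space M" using ab space_F by simp
  have G: "G v \<in> sets (F a)" for v using simple_functionD(2)[OF c, of "{v}"] by (simp add: G_def sp)
  have GM: "G v \<in> sets M" for v using G subalgebra_F[OF ab(1)] by (auto simp: subalgebra_def)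
  have i: "integrable M (indicat_real (G v))" for v
    using GM by (intro integrable_real_indicator) (auto simp: less_top[symmetric])
  have eq: "(W b \<omega> - W a \<omega>) \<bullet> c \<omega> = (\<Sum>v\<in>c ` space M. indicat_real (G v) \<omega> * ((W b \<omega> - W a \<omega>) \<bullet> v))"
    if "\<omega> \<in> space M" for \<omega>
    using simple_function_inner_sum[OF c, of \<omega>] that by (simp add: sp G_def)
  have z: "integrable M (\<lambda>\<omega>. indicat_real (G v) \<omega> * ((W b \<omega> - W a \<omega>) \<bullet> v))"
    "expectation (\<lambda>\<omega>. indicat_real (G v) \<omega> * ((W b \<omega> - W a \<omega>) \<bullet> v)) = 0" for v
    using expectation_mult_increment[OF ab _ i, of v v] G[of v] by auto
  show "integrable M (\<lambda>\<omega>. (W b \<omega> - W a \<omega>) \<bullet> c \<omega>)"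
    using z(1) by (simp add: eq cong: Bochner_Integration.integrable_cong)
  show "expectation (\<lambda>\<omega>. (W b \<omega> - W a \<omega>) \<bullet> c \<omega>) = 0"
    using z by (simp add: eq cong: Bochner_Integration.integral_cong)
qed

text \<open>Expanding both coefficients over their level sets reduces this to
  \<open>indicator_increments\<close>.\<close>

lemma simple_increments:
  assumes ab: "0 \<le> a" "a \<le> b" "0 \<le> a'" "a' \<le> b'"
    and c: "simple_function (F a) c" "simple_function (F a') c'"
  shows "integrable M (\<lambda>\<omega>. ((W b \<omega> - W a \<omega>) \<bullet> c \<omega>) * ((W b' \<omega> - W a' \<omega>) \<bullet> c' \<omega>))"
    and "integrable M (\<lambda>\<omega>. Q (c \<omega>) \<bullet> c' \<omega>)"
    and "expectation (\<lambda>\<omega>. ((W b \<omega> - W a \<omega>) \<bullet> c \<omega>) * ((W b' \<omega> - W a' \<omega>) \<bullet> c' \<omega>))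
      = overlap a b a' b' * expectation (\<lambda>\<omega>. Q (c \<omega>) \<bullet> c' \<omega>)"
proof -
  define G where "G v = c -` {v} \<inter> space M" for v
  define G' where "G' v = c' -` {v} \<inter> space M" for v
  have sp: "space (F a) = space M" "space (F a') = space M" using ab space_F by auto
  have G: "G v \<in> sets (F a)" "G' v \<in> sets (F a')" for v
    using simple_functionD(2)[OF c(1), of "{v}"] simple_functionD(2)[OF c(2), of "{v}"]
    by (simp_all add: G_def G'_def sp)
  have GM: "G v \<in> sets M" "G' v \<in> sets M" for v
    using G subalgebra_F[OF ab(1)] subalgebra_F[OF ab(3)] by (auto simp: subalgebra_def)
  note sum_eq = simple_function_inner_sum[OF c(1), unfolded sp, folded G_def]
    simple_function_inner_sum[OF c(2), unfolded sp, folded G'_def]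
  let ?I = "\<lambda>v v' \<omega>. (indicat_real (G v) \<omega> * ((W b \<omega> - W a \<omega>) \<bullet> v))
      * (indicat_real (G' v') \<omega> * ((W b' \<omega> - W a' \<omega>) \<bullet> v'))"
  have eq: "((W b \<omega> - W a \<omega>) \<bullet> c \<omega>) * ((W b' \<omega> - W a' \<omega>) \<bullet> c' \<omega>)
      = (\<Sum>v\<in>c ` space M. \<Sum>v'\<in>c' ` space M. ?I v v' \<omega>)" if "\<omega> \<in> space M" for \<omega>
    by (simp only: sum_eq[OF that] sum_product)
  have Qeq: "Q (c \<omega>) \<bullet> c' \<omega> = (\<Sum>v\<in>c ` space M. \<Sum>v'\<in>c' ` space M.
      indicat_real (G v \<inter> G' v') \<omega> * (Q v \<bullet> v'))" if "\<omega> \<in> space M" for \<omega>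
  proof -
    have "Q (c \<omega>) \<bullet> c' \<omega> = (\<Sum>v'\<in>c' ` space M. indicat_real (G' v') \<omega> * (Q (c \<omega>) \<bullet> v'))"
      by (rule sum_eq(2)[OF that])
    also have "\<dots> = (\<Sum>v'\<in>c' ` space M. indicat_real (G' v') \<omega> * (Q v' \<bullet> c \<omega>))"
      by (simp add: Q_symmetric)
    also have "\<dots> = (\<Sum>v'\<in>c' ` space M. \<Sum>v\<in>c ` space M.
        indicat_real (G v \<inter> G' v') \<omega> * (Q v \<bullet> v'))"
      by (simp add: sum_eq(1)[OF that, of "Q _"] sum_distrib_left indicator_inter_arith Q_symmetric ac_simps)
    finally show ?thesis by (subst sum.swap)
  qed
  have int: "integrable M (?I v v')" for v v'
    by (rule indicator_increments_integrable[OF ab GM])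
  show "integrable M (\<lambda>\<omega>. ((W b \<omega> - W a \<omega>) \<bullet> c \<omega>) * ((W b' \<omega> - W a' \<omega>) \<bullet> c' \<omega>))"
    using int by (simp add: eq cong: Bochner_Integration.integrable_cong)
  have intQ: "integrable M (\<lambda>\<omega>. indicat_real (G v \<inter> G' v') \<omega> * (Q v \<bullet> v'))" for v v'
    using GM by (intro integrable_mult_left integrable_real_indicator) (auto simp: less_top[symmetric])
  show "integrable M (\<lambda>\<omega>. Q (c \<omega>) \<bullet> c' \<omega>)"
    using intQ by (simp add: Qeq cong: Bochner_Integration.integrable_cong)
  have "expectation (\<lambda>\<omega>. ((W b \<omega> - W a \<omega>) \<bullet> c \<omega>) * ((W b' \<omega> - W a' \<omega>) \<bullet> c' \<omega>))
      = (\<Sum>v\<in>c ` space M. \<Sum>v'\<in>c' ` space M. expectation (?I v v'))"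
    using int by (simp add: eq cong: Bochner_Integration.integral_cong)
  also have "\<dots> = (\<Sum>v\<in>c ` space M. \<Sum>v'\<in>c' ` space M.
      overlap a b a' b' * (prob (G v \<inter> G' v') * (Q v \<bullet> v')))"
    by (simp only: indicator_increments[OF ab G])
  also have "\<dots> = overlap a b a' b' * (\<Sum>v\<in>c ` space M. \<Sum>v'\<in>c' ` space M.
      expectation (\<lambda>\<omega>. indicat_real (G v \<inter> G' v') \<omega> * (Q v \<bullet> v')))"
    using GM by (simp add: sum_distrib_left)
  also have "\<dots> = overlap a b a' b' * expectation (\<lambda>\<omega>. Q (c \<omega>) \<bullet> c' \<omega>)"
    using intQ by (simp add: Qeq cong: Bochner_Integration.integral_cong)
  finally show "expectation (\<lambda>\<omega>. ((W b \<omega> - W a \<omega>) \<bullet> c \<omega>) * ((W b' \<omega> - W a' \<omega>) \<bullet> c' \<omega>))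
      = overlap a b a' b' * expectation (\<lambda>\<omega>. Q (c \<omega>) \<bullet> c' \<omega>)" .
qed

subsection \<open>Isometry for step integrands\<close>

text \<open>The product of two interval indicators integrates to the overlap. The same weight
  multiplies the expected products of increments in \<open>simple_increments\<close>; this
  coincidence is the isometry for step integrands.\<close>

lemma has_integral_step_norm_sq:
  fixes x :: "'i \<Rightarrow> 'h"
  assumes "finite K"
  shows "has_bochner_integral lborel (\<lambda>s. (norm (\<Sum>k\<in>K. indicat_real {a k<..b k} s *\<^sub>R x k))\<^sup>2)
    (\<Sum>k\<in>K. \<Sum>l\<in>K. overlap (a k) (b k) (a l) (b l) * (x k \<bullet> x l))"
proof -
  have eq: "(norm (\<Sum>k\<in>K. indicat_real {a k<..b k} s *\<^sub>R x k))\<^sup>2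
      = (\<Sum>k\<in>K. \<Sum>l\<in>K. indicat_real ({a k<..b k} \<inter> {a l<..b l}) s * (x k \<bullet> x l))" for s
    unfolding power2_norm_eq_inner inner_sum_left unfolding inner_sum_right
    by (intro sum.cong refl) (simp only: indicator_inter_arith inner_scaleR_left inner_scaleR_right ac_simps)
  have "has_bochner_integral lborel (indicat_real ({a k<..b k} \<inter> {a l<..b l}))
      (overlap (a k) (b k) (a l) (b l))" for k l
    unfolding overlap_def
  proof (rule has_bochner_integral_real_indicator)
    have "emeasure lborel ({a k<..b k} \<inter> {a l<..b l}) \<le> emeasure lborel {a k<..b k}"
      by (intro emeasure_mono) auto
    then show "emeasure lborel ({a k<..b k} \<inter> {a l<..b l}) < \<infinity>"
      by (rule le_less_trans) (cases "a k \<le> b k"; simp)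
  qed simp
  then show ?thesis
    unfolding eq by (intro has_bochner_integral_sum has_bochner_integral_mult_left)
qed

abbreviation "R \<equiv> op_sqrt Q"

lemma R_inner: "R g \<bullet> R h = Q g \<bullet> h"
  using covariance_operator_sqrt(2)[OF covariance] .

lemma R_adj: "R (adj T a) = adj (T o\<^sub>L R) a"
  by (simp add: adj_compose symmetric_op_adj covariance_operator_sqrt(1)[OF covariance])

text \<open>
  The intervals may overlap: this covers the difference of two step integrals over different
  partitions without a common refinement.
\<close>

lemma step_isometry:
  fixes c :: "'i \<Rightarrow> 'o \<Rightarrow> 'h"
  assumes K: "finite K" and ab: "\<And>k. k \<in> K \<Longrightarrow> 0 \<le> a k \<and> a k \<le> b k"
    and c: "\<And>k. k \<in> K \<Longrightarrow> simple_function (F (a k)) (c k)"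
  defines "J \<equiv> \<lambda>\<omega>. \<Sum>k\<in>K. (W (b k) \<omega> - W (a k) \<omega>) \<bullet> c k \<omega>"
  shows "integrable M J" "expectation J = 0" "integrable M (\<lambda>\<omega>. (J \<omega>)\<^sup>2)"
    and "(\<integral>\<^sup>+\<omega>. ennreal ((J \<omega>)\<^sup>2) \<partial>M) =
      (\<integral>\<^sup>+\<omega>. \<integral>\<^sup>+s. ennreal ((norm (R (\<Sum>k\<in>K. indicat_real {a k<..b k} s *\<^sub>R c k \<omega>)))\<^sup>2) \<partial>lborel \<partial>M)"
proof -
  have m: "integrable M (\<lambda>\<omega>. (W (b k) \<omega> - W (a k) \<omega>) \<bullet> c k \<omega>)"
    "expectation (\<lambda>\<omega>. (W (b k) \<omega> - W (a k) \<omega>) \<bullet> c k \<omega>) = 0" if "k \<in> K" for k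
    using simple_increment_expectation[OF _ _ c[OF that]] ab[OF that] by auto
  show "integrable M J" unfolding J_def using m by auto
  show "expectation J = 0" unfolding J_def using m by (subst Bochner_Integration.integral_sum) auto
  let ?P = "\<lambda>k l \<omega>. ((W (b k) \<omega> - W (a k) \<omega>) \<bullet> c k \<omega>) * ((W (b l) \<omega> - W (a l) \<omega>) \<bullet> c l \<omega>)"
  let ?o = "\<lambda>k l. overlap (a k) (b k) (a l) (b l)"
  have J2: "(J \<omega>)\<^sup>2 = (\<Sum>k\<in>K. \<Sum>l\<in>K. ?P k l \<omega>)" for \<omega>
    by (simp add: J_def power2_eq_square sum_product)
  have P: "integrable M (?P k l)" "integrable M (\<lambda>\<omega>. Q (c k \<omega>) \<bullet> c l \<omega>)"
    "expectation (?P k l) = ?o k l * expectation (\<lambda>\<omega>. Q (c k \<omega>) \<bullet> c l \<omega>)" if "k \<in> K" "l \<in> K" for k l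
    using simple_increments[OF _ _ _ _ c[OF that(1)] c[OF that(2)]] ab[OF that(1)] ab[OF that(2)] by auto
  show int: "integrable M (\<lambda>\<omega>. (J \<omega>)\<^sup>2)"
    unfolding J2 using P by auto
  \<comment> \<open>The time integral in closed form: a finite sum, so its integrability in
    \<open>\<omega>\<close> is immediate and no exchange of integrals is required.\<close>
  define q where "q \<omega> = (\<Sum>k\<in>K. \<Sum>l\<in>K. ?o k l * (Q (c k \<omega>) \<bullet> c l \<omega>))" for \<omega>
  have iq: "integrable M q" unfolding q_def using P by auto
  have hq: "has_bochner_integral lborel
      (\<lambda>s. (norm (R (\<Sum>k\<in>K. indicat_real {a k<..b k} s *\<^sub>R c k \<omega>)))\<^sup>2) (q \<omega>)" for \<omega>
    using has_integral_step_norm_sq[OF K, of a b "\<lambda>k. R (c k \<omega>)"]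
    by (simp add: blinfun.sum_right blinfun.scaleR_right R_inner q_def)
  have q: "(\<integral>\<^sup>+s. ennreal ((norm (R (\<Sum>k\<in>K. indicat_real {a k<..b k} s *\<^sub>R c k \<omega>)))\<^sup>2) \<partial>lborel)
      = ennreal (q \<omega>)" for \<omega>
    using hq by (subst nn_integral_eq_integral) (auto simp: has_bochner_integral_iff)
  have q0: "0 \<le> q \<omega>" for \<omega>
    using hq[of \<omega>, THEN has_bochner_integral_integral_eq, symmetric] by simp
  have "(\<integral>\<^sup>+\<omega>. ennreal ((J \<omega>)\<^sup>2) \<partial>M) = ennreal (expectation (\<lambda>\<omega>. (J \<omega>)\<^sup>2))"
    using int by (intro nn_integral_eq_integral) auto
  also have "expectation (\<lambda>\<omega>. (J \<omega>)\<^sup>2) = (\<Sum>k\<in>K. \<Sum>l\<in>K. expectation (?P k l))"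
    unfolding J2 using P by (subst Bochner_Integration.integral_sum; auto)+
  also have "\<dots> = expectation q"
    unfolding q_def using P by (simp add: Bochner_Integration.integral_sum)
  also have "ennreal (expectation q) = (\<integral>\<^sup>+\<omega>. ennreal (q \<omega>) \<partial>M)"
    using iq q0 by (intro nn_integral_eq_integral[symmetric]) auto
  finally show "(\<integral>\<^sup>+\<omega>. ennreal ((J \<omega>)\<^sup>2) \<partial>M) =
      (\<integral>\<^sup>+\<omega>. \<integral>\<^sup>+s. ennreal ((norm (R (\<Sum>k\<in>K. indicat_real {a k<..b k} s *\<^sub>R c k \<omega>)))\<^sup>2) \<partial>lborel \<partial>M)"
    by (simp only: q)
qed

section \<open>Vector-valued step processes over a partition and their truncation\<close>

definition admissible :: "nat \<Rightarrow> (nat \<Rightarrow> real) \<Rightarrow> (nat \<Rightarrow> 'o \<Rightarrow> 'h) \<Rightarrow> bool" where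
  "admissible n \<tau> c \<longleftrightarrow>
     0 \<le> \<tau> 0 \<and> mono_on {..n} \<tau> \<and> (\<forall>i<n. simple_function (F (\<tau> i)) (c i))"

text \<open>\<open>R\<close> is built in so that the isometry relates unweighted L2 norms.\<close>

definition step :: "nat \<Rightarrow> (nat \<Rightarrow> real) \<Rightarrow> (nat \<Rightarrow> 'o \<Rightarrow> 'h) \<Rightarrow> real \<Rightarrow> 'o \<Rightarrow> 'h" where
  "step n \<tau> c s \<omega> = R (\<Sum>i<n. indicat_real {\<tau> i<..\<tau> (Suc i)} s *\<^sub>R c i \<omega>)"

definition step_integral :: "nat \<Rightarrow> (nat \<Rightarrow> real) \<Rightarrow> (nat \<Rightarrow> 'o \<Rightarrow> 'h) \<Rightarrow> 'o \<Rightarrow> real" where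
  "step_integral n \<tau> c \<omega> = (\<Sum>i<n. (W (\<tau> (Suc i)) \<omega> - W (\<tau> i) \<omega>) \<bullet> c i \<omega>)"

text \<open>For an admissible family this is the time integral of the squared norm of
  \<open>step\<close>, see \<open>step_energy\<close>; the finite sum makes visible which
  coefficients it depends on.\<close>

definition energy :: "(nat \<Rightarrow> real) \<Rightarrow> (nat \<Rightarrow> 'o \<Rightarrow> 'h) \<Rightarrow> nat \<Rightarrow> 'o \<Rightarrow> real" where
  "energy \<tau> c n \<omega> = (\<Sum>i<n. (\<tau> (Suc i) - \<tau> i) * (norm (R (c i \<omega>)))\<^sup>2)"

text \<open>
  The energy up to and including interval \<open>i\<close> is already known at its left end point \<open>\<tau> i\<close>.
\<close>

definition truncate ::
  "real \<Rightarrow> (nat \<Rightarrow> real) \<Rightarrow> (nat \<Rightarrow> 'o \<Rightarrow> 'h) \<Rightarrow> nat \<Rightarrow> 'o \<Rightarrow> 'h" where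
  "truncate N \<tau> c i \<omega> = (if energy \<tau> c (Suc i) \<omega> \<le> N then c i \<omega> else 0)"

lemma admissible_tau:
  assumes "admissible n \<tau> c"
  shows "i \<le> j \<Longrightarrow> j \<le> n \<Longrightarrow> \<tau> i \<le> \<tau> j" "i \<le> n \<Longrightarrow> 0 \<le> \<tau> i"
proof -
  have m: "mono_on {..n} \<tau>" "0 \<le> \<tau> 0" using assms by (auto simp: admissible_def)
  show mono: "i \<le> j \<Longrightarrow> j \<le> n \<Longrightarrow> \<tau> i \<le> \<tau> j" for i j using m(1) by (auto simp: mono_on_def)
  show "i \<le> n \<Longrightarrow> 0 \<le> \<tau> i" using mono[of 0 i] m(2) by auto
qed

lemma admissible_simple:
  assumes "admissible n \<tau> c" "i < n"
  shows "simple_function (F (\<tau> i)) (c i)"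
  using assms by (simp add: admissible_def)

lemma simple_function_F_mono:
  "0 \<le> s \<Longrightarrow> s \<le> t \<Longrightarrow> simple_function (F s) f \<Longrightarrow> simple_function (F t) f"
  using subalgebra_F_mono[of s t] simple_function_subalgebra[of "F s" f "F t"]
  by (simp add: subalgebra_def)

lemma admissible_measurable:
  assumes "admissible n \<tau> c" "i < n"
  shows "c i \<in> borel_measurable M"
proof -
  have "simple_function M (c i)"
    using simple_function_subalgebra[OF admissible_simple[OF assms]] subalgebra_F[of "\<tau> i"]
      admissible_tau(2)[OF assms(1), of i] assms(2) by (auto simp: subalgebra_def)
  then show ?thesis by (rule borel_measurable_simple_function)
qed

lemma step_measurable:
  assumes "admissible n \<tau> c"
  shows "(\<lambda>(\<omega>, s). step n \<tau> c s \<omega>) \<in> borel_measurable (M \<Otimes>\<^sub>M lborel)"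
proof -
  have [measurable]: "i < n \<Longrightarrow> c i \<in> borel_measurable M" for i
    using admissible_measurable[OF assms] .
  have "(\<lambda>(\<omega>, s). \<Sum>i<n. indicat_real {\<tau> i<..\<tau> (Suc i)} s *\<^sub>R c i \<omega>) \<in> borel_measurable (M \<Otimes>\<^sub>M lborel)"
    unfolding case_prod_beta by (intro borel_measurable_sum) measurable
  then have "(\<lambda>z. R ((\<lambda>(\<omega>, s). \<Sum>i<n. indicat_real {\<tau> i<..\<tau> (Suc i)} s *\<^sub>R c i \<omega>) z))
      \<in> borel_measurable (M \<Otimes>\<^sub>M lborel)"
    by (rule borel_measurable_continuous_on[rotated]) (intro continuous_intros)
  then show ?thesis by (simp add: step_def case_prod_beta)
qed

text \<open>Intervals of one partition are disjoint, so the double sum of overlaps collapses to its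
  diagonal.\<close>

lemma step_energy:
  assumes "admissible n \<tau> c"
  shows "(\<integral>\<^sup>+s. ennreal ((norm (step n \<tau> c s \<omega>))\<^sup>2) \<partial>lborel) = ennreal (energy \<tau> c n \<omega>)"
proof -
  have o: "overlap (\<tau> i) (\<tau> (Suc i)) (\<tau> j) (\<tau> (Suc j)) = (if j = i then \<tau> (Suc i) - \<tau> i else 0)"
    if "i < n" "j < n" for i j
  proof -
    have "\<tau> i \<le> \<tau> (Suc i)" using admissible_tau(1)[OF assms] that by auto
    moreover have "\<tau> (Suc i) \<le> \<tau> j" if "i < j" using admissible_tau(1)[OF assms, of "Suc i" j] that \<open>j < n\<close> by auto
    moreover have "\<tau> (Suc j) \<le> \<tau> i" if "j < i" using admissible_tau(1)[OF assms, of "Suc j" i] that \<open>i < n\<close> by auto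
    ultimately show ?thesis by (cases i j rule: linorder_cases) (auto simp: overlap_eq max_def min_def)
  qed
  have "(\<Sum>i<n. \<Sum>j<n. overlap (\<tau> i) (\<tau> (Suc i)) (\<tau> j) (\<tau> (Suc j)) * (R (c i \<omega>) \<bullet> R (c j \<omega>)))
      = (\<Sum>i<n. \<Sum>j<n. if j = i then (\<tau> (Suc i) - \<tau> i) * (R (c i \<omega>) \<bullet> R (c i \<omega>)) else 0)"
    by (intro sum.cong refl) (simp add: o)
  also have "\<dots> = energy \<tau> c n \<omega>" by (simp add: energy_def power2_norm_eq_inner)
  finally have "has_bochner_integral lborel (\<lambda>s. (norm (step n \<tau> c s \<omega>))\<^sup>2) (energy \<tau> c n \<omega>)"
    using has_integral_step_norm_sq[of "{..<n}" \<tau> "\<lambda>i. \<tau> (Suc i)" "\<lambda>i. R (c i \<omega>)"]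
    by (simp add: step_def blinfun.sum_right blinfun.scaleR_right)
  then show ?thesis by (subst nn_integral_eq_integral) (auto simp: has_bochner_integral_iff)
qed

lemma energy_mono:
  assumes "admissible n \<tau> c" "i \<le> j" "j \<le> n"
  shows "energy \<tau> c i \<omega> \<le> energy \<tau> c j \<omega>"
  unfolding energy_def using assms admissible_tau(1)[OF assms(1)]
  by (intro sum_mono2) auto

lemma admissible_truncate:
  assumes "admissible n \<tau> c"
  shows "admissible n \<tau> (truncate N \<tau> c)"
  unfolding admissible_def
proof (intro conjI allI impI)
  show "0 \<le> \<tau> 0" "mono_on {..n} \<tau>" using assms by (auto simp: admissible_def)
  fix i assume i: "i < n"
  have c: "simple_function (F (\<tau> i)) (c j)" if "j < Suc i" for j
    using i that
    by (intro simple_function_F_mono[OF _ _ admissible_simple[OF assms, of j]] admissible_tau[OF assms]) simp_all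
  have e: "simple_function (F (\<tau> i)) (energy \<tau> c (Suc i))"
    unfolding energy_def[abs_def]
  proof (rule simple_function_sum)
    fix j assume "j \<in> {..<Suc i}"
    then show "simple_function (F (\<tau> i)) (\<lambda>\<omega>. (\<tau> (Suc j) - \<tau> j) * (norm (R (c j \<omega>)))\<^sup>2)"
      using simple_function_compose1[OF c[of j], of "\<lambda>x. (\<tau> (Suc j) - \<tau> j) * (norm (R x))\<^sup>2"] by simp
  qed
  have "{\<omega> \<in> space (F (\<tau> i)). energy \<tau> c (Suc i) \<omega> \<le> N} \<in> sets (F (\<tau> i))"
    using borel_measurable_simple_function[OF e] by measurable
  then show "simple_function (F (\<tau> i)) (truncate N \<tau> c i)"
    unfolding truncate_def[abs_def] by (intro simple_function_If c simple_function_const) simp_all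
qed

lemma energy_truncate_le:
  assumes c: "admissible n \<tau> c" and N: "0 \<le> N"
  shows "energy \<tau> (truncate N \<tau> c) n \<omega> \<le> N"
proof -
  \<comment> \<open>As the energy increases with the index, truncation keeps an initial block of
    coefficients and kills the rest. The induction must also carry the equality on that block: it
    bounds the new energy whenever a coefficient is kept.\<close>
  have "m \<le> n \<Longrightarrow> energy \<tau> (truncate N \<tau> c) m \<omega> \<le> N
      \<and> (energy \<tau> c m \<omega> \<le> N \<longrightarrow> energy \<tau> (truncate N \<tau> c) m \<omega> = energy \<tau> c m \<omega>)" for m
  proof (induction m)
    case 0
    then show ?case using N by (simp add: energy_def)
  next
    case (Suc m)
    have mono: "energy \<tau> c m \<omega> \<le> energy \<tau> c (Suc m) \<omega>" using energy_mono[OF c] Suc.prems by auto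
    have Suc_eq: "energy \<tau> d (Suc m) \<omega> = energy \<tau> d m \<omega> + (\<tau> (Suc m) - \<tau> m) * (norm (R (d m \<omega>)))\<^sup>2" for d
      by (simp add: energy_def)
    show ?case
    proof (cases "energy \<tau> c (Suc m) \<omega> \<le> N")
      case True
      then have "truncate N \<tau> c m \<omega> = c m \<omega>" by (simp add: truncate_def)
      then have "energy \<tau> (truncate N \<tau> c) (Suc m) \<omega> = energy \<tau> c (Suc m) \<omega>"
        using Suc mono True by (simp add: Suc_eq)
      then show ?thesis using True by simp
    next
      case False
      then have "truncate N \<tau> c m \<omega> = 0" by (simp add: truncate_def)
      then show ?thesis using Suc False by (simp add: Suc_eq blinfun.zero_right)
    qed
  qed
  then show ?thesis by blast
qed

lemma truncate_eq:
  assumes c: "admissible n \<tau> c" and le: "energy \<tau> c n \<omega> \<le> N" and "i < n"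
  shows "truncate N \<tau> c i \<omega> = c i \<omega>"
  using energy_mono[OF c, of "Suc i" n \<omega>] assms by (simp add: truncate_def)

lemma step_integral_facts:
  assumes "admissible n \<tau> c"
  shows "integrable M (step_integral n \<tau> c)" "expectation (step_integral n \<tau> c) = 0"
    "(\<integral>\<^sup>+\<omega>. ennreal ((step_integral n \<tau> c \<omega>)\<^sup>2) \<partial>M) =
      (\<integral>\<^sup>+\<omega>. \<integral>\<^sup>+s. ennreal ((norm (step n \<tau> c s \<omega>))\<^sup>2) \<partial>lborel \<partial>M)"
proof -
  have ab: "0 \<le> \<tau> k \<and> \<tau> k \<le> \<tau> (Suc k)" if "k \<in> {..<n}" for k
    using that admissible_tau[OF assms] by auto
  have c: "simple_function (F (\<tau> k)) (c k)" if "k \<in> {..<n}" for k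
    using that admissible_simple[OF assms] by auto
  show "integrable M (step_integral n \<tau> c)" "expectation (step_integral n \<tau> c) = 0"
    "(\<integral>\<^sup>+\<omega>. ennreal ((step_integral n \<tau> c \<omega>)\<^sup>2) \<partial>M) =
      (\<integral>\<^sup>+\<omega>. \<integral>\<^sup>+s. ennreal ((norm (step n \<tau> c s \<omega>))\<^sup>2) \<partial>lborel \<partial>M)"
    using step_isometry[of "{..<n}" \<tau> "\<lambda>i. \<tau> (Suc i)" c, OF finite_lessThan ab c]
    by (simp_all add: step_integral_def[abs_def] step_def)
qed

text \<open>The difference is itself a step integral, indexed by the disjoint union of the two
  partitions, with the second family of coefficients negated. It gives the Cauchy property of
  approximating integrals.\<close>

lemma step_integral_diff:
  assumes c: "admissible n \<tau> c" and c': "admissible n' \<tau>' c'"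
  shows "(\<integral>\<^sup>+\<omega>. ennreal ((step_integral n \<tau> c \<omega> - step_integral n' \<tau>' c' \<omega>)\<^sup>2) \<partial>M) =
    (\<integral>\<^sup>+\<omega>. \<integral>\<^sup>+s. ennreal ((norm (step n \<tau> c s \<omega> - step n' \<tau>' c' s \<omega>))\<^sup>2) \<partial>lborel \<partial>M)"
proof -
  define a where "a = case_sum \<tau> \<tau>'"
  define b where "b = case_sum (\<lambda>i. \<tau> (Suc i)) (\<lambda>i. \<tau>' (Suc i))"
  define d where "d = case_sum c (\<lambda>i \<omega>. - c' i \<omega>)"
  have K: "finite ({..<n} <+> {..<n'})" by simp
  have ab: "0 \<le> a k \<and> a k \<le> b k" if "k \<in> {..<n} <+> {..<n'}" for k
    using that admissible_tau[OF c] admissible_tau[OF c'] by (auto simp: a_def b_def)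
  have d: "simple_function (F (a k)) (d k)" if "k \<in> {..<n} <+> {..<n'}" for k
  proof (cases k)
    case (Inl i)
    then show ?thesis using that admissible_simple[OF c, of i] by (auto simp: a_def d_def)
  next
    case (Inr i)
    then show ?thesis
      using that simple_function_compose1[OF admissible_simple[OF c', of i], of uminus]
      by (auto simp: a_def d_def)
  qed
  have "(\<Sum>k\<in>{..<n} <+> {..<n'}. (W (b k) \<omega> - W (a k) \<omega>) \<bullet> d k \<omega>)
      = step_integral n \<tau> c \<omega> - step_integral n' \<tau>' c' \<omega>" for \<omega>
    by (simp add: sum.Plus a_def b_def d_def step_integral_def sum_negf)
  moreover have "R (\<Sum>k\<in>{..<n} <+> {..<n'}. indicat_real {a k<..b k} s *\<^sub>R d k \<omega>)
      = step n \<tau> c s \<omega> - step n' \<tau>' c' s \<omega>" for s \<omega>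
    unfolding step_def blinfun.diff_right[symmetric]
    by (simp only: sum.Plus[OF finite_lessThan finite_lessThan] o_def a_def b_def d_def sum.case
        scaleR_minus_right sum_negf diff_conv_add_uminus)
  ultimately show ?thesis
    using step_isometry(4)[of "{..<n} <+> {..<n'}" a b d, OF K ab d] by simp
qed

end

subsection \<open>The Ito isometry\<close>

lemma nn_integral_norm_sq_add_le:
  fixes f g :: "'a \<Rightarrow> 'b::{real_normed_vector, second_countable_topology}"
  assumes [measurable]: "f \<in> borel_measurable N" "g \<in> borel_measurable N"
  shows "(\<integral>\<^sup>+x. ennreal ((norm (f x + g x))\<^sup>2) \<partial>N)
    \<le> 2 * (\<integral>\<^sup>+x. ennreal ((norm (f x))\<^sup>2) \<partial>N) + 2 * (\<integral>\<^sup>+x. ennreal ((norm (g x))\<^sup>2) \<partial>N)"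
proof -
  have "ennreal ((norm (f x + g x))\<^sup>2) \<le> 2 * ennreal ((norm (f x))\<^sup>2) + 2 * ennreal ((norm (g x))\<^sup>2)" for x
  proof -
    have "2 * ennreal ((norm (f x))\<^sup>2) + 2 * ennreal ((norm (g x))\<^sup>2)
        = ennreal (2 * (norm (f x))\<^sup>2 + 2 * (norm (g x))\<^sup>2)"
      by (simp add: ennreal_mult')
    then show ?thesis using norm_sq_add_le[of "f x" "g x"] by (simp only: ennreal_leI)
  qed
  then have "(\<integral>\<^sup>+x. ennreal ((norm (f x + g x))\<^sup>2) \<partial>N)
      \<le> (\<integral>\<^sup>+x. 2 * ennreal ((norm (f x))\<^sup>2) + 2 * ennreal ((norm (g x))\<^sup>2) \<partial>N)"
    by (rule nn_integral_mono)
  also have "\<dots> = 2 * (\<integral>\<^sup>+x. ennreal ((norm (f x))\<^sup>2) \<partial>N) + 2 * (\<integral>\<^sup>+x. ennreal ((norm (g x))\<^sup>2) \<partial>N)"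
    by (simp add: nn_integral_add nn_integral_cmult)
  finally show ?thesis .
qed

lemma nn_integral_norm_sq_diff_le:
  fixes f g :: "'a \<Rightarrow> 'b::{real_normed_vector, second_countable_topology}"
  assumes "f \<in> borel_measurable N" "g \<in> borel_measurable N"
  shows "(\<integral>\<^sup>+x. ennreal ((norm (f x - g x))\<^sup>2) \<partial>N)
    \<le> 2 * (\<integral>\<^sup>+x. ennreal ((norm (f x))\<^sup>2) \<partial>N) + 2 * (\<integral>\<^sup>+x. ennreal ((norm (g x))\<^sup>2) \<partial>N)"
  using nn_integral_norm_sq_add_le[OF assms(1) borel_measurable_uminus[OF assms(2)]] by simp

lemma pair_section_measurable:
  assumes "(\<lambda>(\<omega>, s). f s \<omega>) \<in> borel_measurable (M \<Otimes>\<^sub>M N)" "\<omega> \<in> space M"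
  shows "(\<lambda>s. f s \<omega>) \<in> borel_measurable N"
  using measurable_comp[OF measurable_Pair1'[OF assms(2)] assms(1)] by (simp add: o_def)

lemma pair_norm_sq_integral:
  fixes f :: "real \<Rightarrow> 'a \<Rightarrow> 'b::{real_normed_vector, second_countable_topology}"
  assumes [measurable]: "(\<lambda>(\<omega>, s). f s \<omega>) \<in> borel_measurable (M \<Otimes>\<^sub>M lborel)"
  shows "(\<lambda>\<omega>. \<integral>\<^sup>+s. ennreal ((norm (f s \<omega>))\<^sup>2) \<partial>lborel) \<in> borel_measurable M"
    and "(\<integral>\<^sup>+\<omega>. \<integral>\<^sup>+s. ennreal ((norm (f s \<omega>))\<^sup>2) \<partial>lborel \<partial>M)
      = (\<integral>\<^sup>+z. ennreal ((norm ((\<lambda>(\<omega>, s). f s \<omega>) z))\<^sup>2) \<partial>(M \<Otimes>\<^sub>M lborel))"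
proof -
  have m: "(\<lambda>z. ennreal ((norm ((\<lambda>(\<omega>, s). f s \<omega>) z))\<^sup>2)) \<in> borel_measurable (M \<Otimes>\<^sub>M lborel)"
    by measurable
  show "(\<lambda>\<omega>. \<integral>\<^sup>+s. ennreal ((norm (f s \<omega>))\<^sup>2) \<partial>lborel) \<in> borel_measurable M"
    using lborel.borel_measurable_nn_integral_fst[OF m] by simp
  show "(\<integral>\<^sup>+\<omega>. \<integral>\<^sup>+s. ennreal ((norm (f s \<omega>))\<^sup>2) \<partial>lborel \<partial>M)
      = (\<integral>\<^sup>+z. ennreal ((norm ((\<lambda>(\<omega>, s). f s \<omega>) z))\<^sup>2) \<partial>(M \<Otimes>\<^sub>M lborel))"
    using lborel.nn_integral_fst[OF m] by simp
qed

context wiener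
begin

text \<open>
  Stopping each step process when its energy exceeds \<open>m\<close>, along a diagonal sequence, upgrades
  pointwise convergence to convergence in mean square.
\<close>

lemma ex_mean_square_approximation:
  fixes n :: "nat \<Rightarrow> nat" and \<tau> :: "nat \<Rightarrow> nat \<Rightarrow> real" and c :: "nat \<Rightarrow> nat \<Rightarrow> 'o \<Rightarrow> 'h"
  assumes adm: "\<And>k. admissible (n k) (\<tau> k) (c k)"
    and V: "(\<lambda>(\<omega>, s). V s \<omega>) \<in> borel_measurable (M \<Otimes>\<^sub>M lborel)"
    and fin: "(\<integral>\<^sup>+\<omega>. \<integral>\<^sup>+s. ennreal ((norm (V s \<omega>))\<^sup>2) \<partial>lborel \<partial>M) < \<infinity>"
    and D: "AE \<omega> in M. (\<lambda>k. \<integral>\<^sup>+s. ennreal ((norm (step (n k) (\<tau> k) (c k) s \<omega> - V s \<omega>))\<^sup>2) \<partial>lborel) \<longlonglongrightarrow> 0"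
    and J: "AE \<omega> in M. (\<lambda>k. step_integral (n k) (\<tau> k) (c k) \<omega>) \<longlonglongrightarrow> J \<omega>"
  obtains n' \<tau>' c' where "\<And>k::nat. admissible (n' k) (\<tau>' k) (c' k)"
    and "(\<lambda>k. \<integral>\<^sup>+\<omega>. \<integral>\<^sup>+s. ennreal ((norm (step (n' k) (\<tau>' k) (c' k) s \<omega> - V s \<omega>))\<^sup>2) \<partial>lborel \<partial>M) \<longlonglongrightarrow> 0"
    and "AE \<omega> in M. (\<lambda>k. step_integral (n' k) (\<tau>' k) (c' k) \<omega>) \<longlonglongrightarrow> J \<omega>"
proof -
  define A where "A \<omega> = (\<integral>\<^sup>+s. ennreal ((norm (V s \<omega>))\<^sup>2) \<partial>lborel)" for \<omega>
  define d where "d m k = truncate (real m) (\<tau> k) (c k)" for m k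
  define D where "D k \<omega> = (\<integral>\<^sup>+s. ennreal ((norm (step (n k) (\<tau> k) (c k) s \<omega> - V s \<omega>))\<^sup>2) \<partial>lborel)" for k \<omega>
  define DM where "DM m k \<omega> = (\<integral>\<^sup>+s. ennreal ((norm (step (n k) (\<tau> k) (d m k) s \<omega> - V s \<omega>))\<^sup>2) \<partial>lborel)" for m k \<omega>
  define E where "E k \<omega> = energy (\<tau> k) (c k) (n k) \<omega>" for k \<omega>
  have admd: "admissible (n k) (\<tau> k) (d m k)" for m k
    unfolding d_def by (rule admissible_truncate[OF adm])
  have A [measurable]: "A \<in> borel_measurable M"
    unfolding A_def[abs_def] by (rule pair_norm_sq_integral(1)[OF V])
  have diff: "(\<lambda>(\<omega>, s). step n \<tau> c s \<omega> - V s \<omega>) \<in> borel_measurable (M \<Otimes>\<^sub>M lborel)"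
    if "admissible n \<tau> c" for n \<tau> c
    using borel_measurable_diff[OF step_measurable[OF that] V] by (simp add: case_prod_beta)
  have D_meas [measurable]: "D k \<in> borel_measurable M" for k
    unfolding D_def[abs_def] by (rule pair_norm_sq_integral(1)[OF diff[OF adm]])
  have finA: "(\<integral>\<^sup>+\<omega>. A \<omega> \<partial>M) < \<infinity>" using fin by (simp add: A_def)
  have AE_A: "AE \<omega> in M. A \<omega> \<noteq> \<infinity>"
    using finA by (intro nn_integral_PInf_AE A) auto
  \<comment> \<open>Where \<open>D k \<omega> \<le> 1\<close>, the energy is at most
    \<open>2 + 2 * A \<omega>\<close>, a bound independent of \<open>k\<close>.\<close>
  have E_le: "ennreal (E k \<omega>) \<le> 2 * D k \<omega> + 2 * A \<omega>" if "\<omega> \<in> space M" for k \<omega>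
  proof -
    have "ennreal (E k \<omega>) = (\<integral>\<^sup>+s. ennreal ((norm ((step (n k) (\<tau> k) (c k) s \<omega> - V s \<omega>) + V s \<omega>))\<^sup>2) \<partial>lborel)"
      by (simp add: E_def step_energy[OF adm])
    also have "\<dots> \<le> 2 * D k \<omega> + 2 * A \<omega>"
      unfolding D_def A_def using that
      by (intro nn_integral_norm_sq_add_le pair_section_measurable[OF V] pair_section_measurable[OF diff[OF adm]])
    finally show ?thesis .
  qed
  have d_eq: "d m k i \<omega> = c k i \<omega>" if "E k \<omega> \<le> real m" "i < n k" for m k i \<omega>
    unfolding d_def using truncate_eq[OF adm that(1)[unfolded E_def] that(2)] .
  \<comment> \<open>Bounds the error after truncation at level \<open>m\<close>, uniformly in
    \<open>k\<close>: the truncated energy is at most \<open>m\<close>.\<close>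
  define Bd where "Bd m \<omega> = 2 * ennreal (real m) + 2 * A \<omega>" for m \<omega>
  have DM_le: "DM m k \<omega> \<le> Bd m \<omega>" if "\<omega> \<in> space M" for m k \<omega>
  proof -
    have "DM m k \<omega> \<le> 2 * (\<integral>\<^sup>+s. ennreal ((norm (step (n k) (\<tau> k) (d m k) s \<omega>))\<^sup>2) \<partial>lborel) + 2 * A \<omega>"
      unfolding DM_def A_def using that
      by (intro nn_integral_norm_sq_diff_le pair_section_measurable[OF V]
          pair_section_measurable[OF step_measurable[OF admd]])
    also have "(\<integral>\<^sup>+s. ennreal ((norm (step (n k) (\<tau> k) (d m k) s \<omega>))\<^sup>2) \<partial>lborel) \<le> ennreal (real m)"
      unfolding step_energy[OF admd] unfolding d_def by (intro ennreal_leI energy_truncate_le adm) simp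
    finally show ?thesis unfolding Bd_def by (simp add: add_right_mono mult_left_mono)
  qed
  \<comment> \<open>The part of the error that vanishes as \<open>k\<close> grows for fixed
    \<open>m\<close>: the original error where truncation is inactive, and everything where
    \<open>D k \<omega>\<close> exceeds 1. Capping by \<open>Bd\<close> provides an integrable
    dominating function.\<close>
  define H where "H m k \<omega> = min (D k \<omega>) (Bd m \<omega>) + (if 1 < D k \<omega> then Bd m \<omega> else 0)" for m k \<omega>
  \<comment> \<open>What remains: truncation is active although \<open>D k \<omega> \<le> 1\<close>,
    which forces \<open>m \<le> 2 + 2 * A \<omega>\<close>. Replacing \<open>m\<close> in
    \<open>Bd\<close> by this bound gives a dominating function free of \<open>m\<close> and
    \<open>k\<close>; the event itself shrinks to a null set as \<open>m\<close> grows.\<close>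
  define G where "G m \<omega> = (if ennreal (real m) \<le> 2 + 2 * A \<omega> then 2 * (2 + 2 * A \<omega>) + 2 * A \<omega> else 0)" for m :: nat and \<omega>
  have Bd_meas [measurable]: "Bd m \<in> borel_measurable M" for m unfolding Bd_def[abs_def] by measurable
  have H_meas [measurable]: "H m k \<in> borel_measurable M" for m k unfolding H_def[abs_def] by measurable
  have G_meas [measurable]: "G m \<in> borel_measurable M" for m unfolding G_def[abs_def] by measurable
  have DM_HG: "DM m k \<omega> \<le> H m k \<omega> + G m \<omega>" if \<omega>: "\<omega> \<in> space M" for m k \<omega>
  proof (cases "E k \<omega> \<le> real m")
    case True
    have "step (n k) (\<tau> k) (d m k) s \<omega> = step (n k) (\<tau> k) (c k) s \<omega>" for s
      unfolding step_def using d_eq[OF True] by (intro arg_cong[where f="blinfun_apply R"] sum.cong) auto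
    then have "DM m k \<omega> = D k \<omega>" by (simp add: DM_def D_def)
    then have "DM m k \<omega> \<le> min (D k \<omega>) (Bd m \<omega>)" using DM_le[OF \<omega>, of m k] by simp
    also have "\<dots> \<le> H m k \<omega> + G m \<omega>" unfolding H_def by (simp add: add_increasing2)
    finally show ?thesis .
  next
    case F: False
    show ?thesis
    proof (cases "1 < D k \<omega>")
      case True
      then have "DM m k \<omega> \<le> H m k \<omega>"
        unfolding H_def using DM_le[OF \<omega>, of m k] by (simp add: add_increasing)
      then show ?thesis by (simp add: add_increasing2)
    next
      case False
      have "ennreal (real m) \<le> ennreal (E k \<omega>)" using F by (intro ennreal_leI) simp
      also have "\<dots> \<le> 2 * D k \<omega> + 2 * A \<omega>" by (rule E_le[OF \<omega>])
      also have "\<dots> \<le> 2 * 1 + 2 * A \<omega>" using False by (intro add_right_mono mult_left_mono) auto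
      finally have m: "ennreal (real m) \<le> 2 + 2 * A \<omega>" by simp
      have "DM m k \<omega> \<le> 2 * ennreal (real m) + 2 * A \<omega>" using DM_le[OF \<omega>] by (simp add: Bd_def)
      also have "\<dots> \<le> 2 * (2 + 2 * A \<omega>) + 2 * A \<omega>" by (intro add_right_mono mult_left_mono m) simp
      also have "\<dots> = G m \<omega>" using m by (simp add: G_def)
      finally show ?thesis by (simp add: add_increasing)
    qed
  qed
  have DD: "AE \<omega> in M. (\<lambda>k. D k \<omega>) \<longlonglongrightarrow> 0" using assms(4) by (simp add: D_def)
  have H_lim: "(\<lambda>k. \<integral>\<^sup>+\<omega>. H m k \<omega> \<partial>M) \<longlonglongrightarrow> 0" for m
  proof -
    have "(\<lambda>k. \<integral>\<^sup>+\<omega>. H m k \<omega> \<partial>M) \<longlonglongrightarrow> (\<integral>\<^sup>+\<omega>. 0 \<partial>M)"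
    proof (rule nn_integral_dominated_convergence[where w="\<lambda>\<omega>. Bd m \<omega> + Bd m \<omega>"])
      show "AE \<omega> in M. H m k \<omega> \<le> Bd m \<omega> + Bd m \<omega>" for k
        unfolding H_def by (intro AE_I2 add_mono) auto
      show "(\<integral>\<^sup>+\<omega>. Bd m \<omega> + Bd m \<omega> \<partial>M) < \<infinity>"
        using finA by (simp add: Bd_def nn_integral_add nn_integral_cmult ennreal_mult_less_top emeasure_space_1)
      show "AE \<omega> in M. (\<lambda>k. H m k \<omega>) \<longlonglongrightarrow> 0"
        using DD
      proof eventually_elim
        case (elim \<omega>)
        have "(\<lambda>k. min (D k \<omega>) (Bd m \<omega>)) \<longlonglongrightarrow> 0"
          by (rule tendsto_sandwich[OF _ _ tendsto_const elim]) auto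
        moreover have "eventually (\<lambda>k. D k \<omega> < 1) sequentially"
          using elim by (rule order_tendstoD) simp
        then have "eventually (\<lambda>k. min (D k \<omega>) (Bd m \<omega>) = H m k \<omega>) sequentially"
          by eventually_elim (auto simp: H_def)
        ultimately show ?case by (rule Lim_transform_eventually)
      qed
    qed simp_all
    then show ?thesis by simp
  qed
  have G_lim: "(\<lambda>m. \<integral>\<^sup>+\<omega>. G m \<omega> \<partial>M) \<longlonglongrightarrow> 0"
  proof -
    have "(\<lambda>m. \<integral>\<^sup>+\<omega>. G m \<omega> \<partial>M) \<longlonglongrightarrow> (\<integral>\<^sup>+\<omega>. 0 \<partial>M)"
    proof (rule nn_integral_dominated_convergence[where w="\<lambda>\<omega>. 2 * (2 + 2 * A \<omega>) + 2 * A \<omega>"])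
      show "AE \<omega> in M. G m \<omega> \<le> 2 * (2 + 2 * A \<omega>) + 2 * A \<omega>" for m
        unfolding G_def by (intro AE_I2) auto
      show "(\<integral>\<^sup>+\<omega>. 2 * (2 + 2 * A \<omega>) + 2 * A \<omega> \<partial>M) < \<infinity>"
        using finA by (simp add: nn_integral_add nn_integral_cmult ennreal_mult_less_top emeasure_space_1)
      show "AE \<omega> in M. (\<lambda>m. G m \<omega>) \<longlonglongrightarrow> 0"
        using AE_A
      proof eventually_elim
        case (elim \<omega>)
        then obtain x where x: "2 + 2 * A \<omega> = ennreal x" "0 \<le> x"
          by (cases "2 + 2 * A \<omega>") (auto simp: ennreal_mult_eq_top_iff)
        have "eventually (\<lambda>m. x < real m) sequentially"
          using filterlim_real_sequentially by (simp add: filterlim_at_top_dense)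
        then have "eventually (\<lambda>m. G m \<omega> = 0) sequentially"
          by eventually_elim (use x in \<open>simp add: G_def\<close>)
        then show ?case by (rule tendsto_eventually)
      qed
    qed simp_all
    then show ?thesis by simp
  qed
  \<comment> \<open>Choice of the diagonal sequence; \<open>k \<ge> m\<close> makes it tend to
    infinity, so the almost sure limits persist along it.\<close>
  have "\<exists>k\<ge>m. (\<integral>\<^sup>+\<omega>. H m k \<omega> \<partial>M) < ennreal (inverse (real (Suc m)))" for m
  proof -
    have "eventually (\<lambda>k. (\<integral>\<^sup>+\<omega>. H m k \<omega> \<partial>M) < ennreal (inverse (real (Suc m)))) sequentially"
      using H_lim by (rule order_tendstoD) simp
    then have "eventually (\<lambda>k. k \<ge> m \<and> (\<integral>\<^sup>+\<omega>. H m k \<omega> \<partial>M) < ennreal (inverse (real (Suc m)))) sequentially"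
      using eventually_ge_at_top by (rule eventually_conj[rotated])
    from eventually_happens'[OF sequentially_bot this] show ?thesis by blast
  qed
  then obtain kk where kk: "\<And>m. kk m \<ge> m" "\<And>m. (\<integral>\<^sup>+\<omega>. H m (kk m) \<omega> \<partial>M) < ennreal (inverse (real (Suc m)))"
    by metis
  have kk_top: "filterlim kk at_top sequentially"
    using kk(1) by (intro filterlim_at_top_mono[OF filterlim_ident]) auto
  show thesis
  proof (rule that[of "\<lambda>m. n (kk m)" "\<lambda>m. \<tau> (kk m)" "\<lambda>m. d m (kk m)"])
    show "admissible (n (kk m)) (\<tau> (kk m)) (d m (kk m))" for m by (rule admd)
    have "(\<lambda>m. \<integral>\<^sup>+\<omega>. DM m (kk m) \<omega> \<partial>M) \<longlonglongrightarrow> 0"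
    proof (rule tendsto_sandwich[OF _ _ tendsto_const])
      show "eventually (\<lambda>m. (\<integral>\<^sup>+\<omega>. DM m (kk m) \<omega> \<partial>M) \<le> ennreal (inverse (real (Suc m))) + (\<integral>\<^sup>+\<omega>. G m \<omega> \<partial>M)) sequentially"
      proof (rule always_eventually, rule allI)
        fix m
        have "(\<integral>\<^sup>+\<omega>. DM m (kk m) \<omega> \<partial>M) \<le> (\<integral>\<^sup>+\<omega>. H m (kk m) \<omega> + G m \<omega> \<partial>M)"
          by (intro nn_integral_mono DM_HG)
        also have "\<dots> = (\<integral>\<^sup>+\<omega>. H m (kk m) \<omega> \<partial>M) + (\<integral>\<^sup>+\<omega>. G m \<omega> \<partial>M)" by (rule nn_integral_add) simp_all
        also have "\<dots> \<le> ennreal (inverse (real (Suc m))) + (\<integral>\<^sup>+\<omega>. G m \<omega> \<partial>M)"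
          using kk(2)[of m] by (intro add_right_mono less_imp_le)
        finally show "(\<integral>\<^sup>+\<omega>. DM m (kk m) \<omega> \<partial>M) \<le> ennreal (inverse (real (Suc m))) + (\<integral>\<^sup>+\<omega>. G m \<omega> \<partial>M)" .
      qed
      have "(\<lambda>m. ennreal (inverse (real (Suc m))) + (\<integral>\<^sup>+\<omega>. G m \<omega> \<partial>M)) \<longlonglongrightarrow> ennreal 0 + 0"
        by (intro tendsto_add tendsto_ennrealI LIMSEQ_inverse_real_of_nat G_lim)
      then show "(\<lambda>m. ennreal (inverse (real (Suc m))) + (\<integral>\<^sup>+\<omega>. G m \<omega> \<partial>M)) \<longlonglongrightarrow> 0" by simp
    qed simp
    then show "(\<lambda>m. \<integral>\<^sup>+\<omega>. \<integral>\<^sup>+s. ennreal ((norm (step (n (kk m)) (\<tau> (kk m)) (d m (kk m)) s \<omega> - V s \<omega>))\<^sup>2) \<partial>lborel \<partial>M) \<longlonglongrightarrow> 0"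
      by (simp add: DM_def)
    show "AE \<omega> in M. (\<lambda>m. step_integral (n (kk m)) (\<tau> (kk m)) (d m (kk m)) \<omega>) \<longlonglongrightarrow> J \<omega>"
      using AE_A DD assms(5) AE_space
    proof eventually_elim
      case (elim \<omega>)
      obtain x where x: "2 + 2 * A \<omega> = ennreal x" "0 \<le> x"
        using elim(1) by (cases "2 + 2 * A \<omega>") (auto simp: ennreal_mult_eq_top_iff)
      have 1: "eventually (\<lambda>m. x < real m) sequentially"
        using filterlim_real_sequentially by (simp add: filterlim_at_top_dense)
      have "(\<lambda>m. D (kk m) \<omega>) \<longlonglongrightarrow> 0" by (rule filterlim_compose[OF elim(2) kk_top])
      then have "eventually (\<lambda>m. D (kk m) \<omega> < 1) sequentially"
        by (rule order_tendstoD) simp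
      \<comment> \<open>Along the diagonal the energy is eventually at most \<open>x\<close>, while
        the truncation level \<open>m\<close> exceeds \<open>x\<close>: at almost every
        \<open>\<omega>\<close> truncation finally changes nothing.\<close>
      with 1 have "eventually (\<lambda>m. step_integral (n (kk m)) (\<tau> (kk m)) (c (kk m)) \<omega>
          = step_integral (n (kk m)) (\<tau> (kk m)) (d m (kk m)) \<omega>) sequentially"
      proof eventually_elim
        case (elim m)
        have "ennreal (E (kk m) \<omega>) \<le> 2 * D (kk m) \<omega> + 2 * A \<omega>" by (rule E_le[OF \<open>\<omega> \<in> space M\<close>])
        also have "\<dots> \<le> 2 * 1 + 2 * A \<omega>" using elim(2) by (intro add_right_mono mult_left_mono) auto
        finally have "E (kk m) \<omega> \<le> real m" using x elim(1) by simp
        then show ?case unfolding step_integral_def by (intro sum.cong refl) (simp add: d_eq)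
      qed
      moreover have "(\<lambda>m. step_integral (n (kk m)) (\<tau> (kk m)) (c (kk m)) \<omega>) \<longlonglongrightarrow> J \<omega>"
        by (rule filterlim_compose[OF elim(3) kk_top])
      ultimately show ?case by (rule Lim_transform_eventually[rotated])
    qed
  qed
qed

end

lemma (in prob_space) expectation_eq_0_if_L2_limit:
  fixes f :: "nat \<Rightarrow> 'a \<Rightarrow> real"
  assumes f: "\<And>m. integrable M (f m)" "\<And>m. expectation (f m) = 0"
    and g: "integrable M g"
    and lim: "(\<lambda>m. \<integral>\<^sup>+\<omega>. ennreal ((f m \<omega> - g \<omega>)\<^sup>2) \<partial>M) \<longlonglongrightarrow> 0"
  shows "expectation g = 0"
proof -
  have [measurable]: "f m \<in> borel_measurable M" "g \<in> borel_measurable M" for m using f g by auto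
  have "\<bar>expectation g\<bar> \<le> e" if e: "0 < e" for e
  proof -
    have "eventually (\<lambda>m. (\<integral>\<^sup>+\<omega>. ennreal ((f m \<omega> - g \<omega>)\<^sup>2) \<partial>M) < ennreal ((e / 2)\<^sup>2)) sequentially"
      using lim e by (intro order_tendstoD) auto
    from eventually_happens'[OF sequentially_bot this] obtain m
      where m: "(\<integral>\<^sup>+\<omega>. ennreal ((f m \<omega> - g \<omega>)\<^sup>2) \<partial>M) < ennreal ((e / 2)\<^sup>2)" by blast
    have i: "integrable M (\<lambda>\<omega>. (f m \<omega> - g \<omega>)\<^sup>2)"
      using m by (intro integrableI_nonneg) (auto simp: less_top[symmetric] order.strict_trans)
    have "ennreal (expectation (\<lambda>\<omega>. (f m \<omega> - g \<omega>)\<^sup>2)) < ennreal ((e / 2)\<^sup>2)"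
      using m nn_integral_eq_integral[OF i] by simp
    then have le: "expectation (\<lambda>\<omega>. (f m \<omega> - g \<omega>)\<^sup>2) \<le> (e / 2)\<^sup>2"
      by (simp add: ennreal_less_iff)
    \<comment> \<open>Passes from mean square to mean error: with mean square at most
      \<open>(e / 2)\<^sup>2\<close>, each of the two terms contributes at most
      \<open>e / 2\<close>.\<close>
    have bound: "\<bar>x\<bar> \<le> e / 2 + x\<^sup>2 / (e / 2)" for x
    proof (cases "\<bar>x\<bar> \<le> e / 2")
      case True
      moreover have "0 \<le> x\<^sup>2 / (e / 2)" using e by simp
      ultimately show ?thesis by linarith
    next
      case False
      then have "\<bar>x\<bar> * (e / 2) \<le> \<bar>x\<bar> * \<bar>x\<bar>" by (intro mult_left_mono) auto
      then have "\<bar>x\<bar> \<le> x\<^sup>2 / (e / 2)" using e by (simp add: field_simps power2_eq_square)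
      then show ?thesis using e by linarith
    qed
    have "\<bar>expectation g\<bar> = \<bar>expectation (\<lambda>\<omega>. f m \<omega> - g \<omega>)\<bar>" using f g by simp
    also have "\<dots> \<le> expectation (\<lambda>\<omega>. \<bar>f m \<omega> - g \<omega>\<bar>)" by (rule integral_abs_bound)
    also have "\<dots> \<le> expectation (\<lambda>\<omega>. e / 2 + (f m \<omega> - g \<omega>)\<^sup>2 / (e / 2))"
      using f g i bound by (intro integral_mono) auto
    also have "\<dots> = e / 2 + expectation (\<lambda>\<omega>. (f m \<omega> - g \<omega>)\<^sup>2) / (e / 2)"
      using i by (simp add: prob_space)
    also have "\<dots> \<le> e / 2 + (e / 2)\<^sup>2 / (e / 2)"
      using le e by (intro add_left_mono divide_right_mono) auto
    also have "\<dots> = e" using e by (simp add: power2_eq_square)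
    finally show ?thesis .
  qed
  then show ?thesis by (metis abs_le_zero_iff field_le_epsilon add_0)
qed

context wiener
begin

text \<open>By the isometry the step integrals are Cauchy in L2. Fatou's lemma identifies their L2
  limit with the almost sure limit \<open>J\<close>, and the squared norms then converge on both
  sides.\<close>

lemma step_integral_limit:
  fixes n :: "nat \<Rightarrow> nat" and \<tau> :: "nat \<Rightarrow> nat \<Rightarrow> real" and c :: "nat \<Rightarrow> nat \<Rightarrow> 'o \<Rightarrow> 'h"
  assumes adm: "\<And>k. admissible (n k) (\<tau> k) (c k)"
    and V: "(\<lambda>(\<omega>, s). V s \<omega>) \<in> borel_measurable (M \<Otimes>\<^sub>M lborel)"
    and fin: "(\<integral>\<^sup>+\<omega>. \<integral>\<^sup>+s. ennreal ((norm (V s \<omega>))\<^sup>2) \<partial>lborel \<partial>M) < \<infinity>"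
    and L2: "(\<lambda>k. \<integral>\<^sup>+\<omega>. \<integral>\<^sup>+s. ennreal ((norm (step (n k) (\<tau> k) (c k) s \<omega> - V s \<omega>))\<^sup>2) \<partial>lborel \<partial>M) \<longlonglongrightarrow> 0"
    and J [measurable]: "J \<in> borel_measurable M"
    and J_lim: "AE \<omega> in M. (\<lambda>k. step_integral (n k) (\<tau> k) (c k) \<omega>) \<longlonglongrightarrow> J \<omega>"
  shows "integrable M J" "expectation J = 0"
    "(\<integral>\<^sup>+\<omega>. ennreal ((J \<omega>)\<^sup>2) \<partial>M) = (\<integral>\<^sup>+\<omega>. \<integral>\<^sup>+s. ennreal ((norm (V s \<omega>))\<^sup>2) \<partial>lborel \<partial>M)"
proof -
  let ?N = "M \<Otimes>\<^sub>M (lborel :: real measure)"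
  define v where "v k = (\<lambda>(\<omega>, s). step (n k) (\<tau> k) (c k) s \<omega>)" for k
  define V' where "V' = (\<lambda>(\<omega>, s). V s \<omega>)"
  define I where "I k = step_integral (n k) (\<tau> k) (c k)" for k
  define e where "e k = (\<integral>\<^sup>+z. ennreal ((norm (v k z - V' z))\<^sup>2) \<partial>?N)" for k
  have v [measurable]: "v k \<in> borel_measurable ?N" for k
    unfolding v_def by (rule step_measurable[OF adm])
  have V' [measurable]: "V' \<in> borel_measurable ?N" unfolding V'_def by (rule V)
  have e: "e \<longlonglongrightarrow> 0"
  proof -
    have "(\<lambda>(\<omega>, s). step (n k) (\<tau> k) (c k) s \<omega> - V s \<omega>) \<in> borel_measurable ?N" for k
      using borel_measurable_diff[OF v[of k] V'] by (simp add: v_def V'_def case_prod_beta)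
    from pair_norm_sq_integral(2)[OF this] show ?thesis
      using L2 by (simp add: e_def[abs_def] v_def V'_def case_prod_beta)
  qed
  have finV: "(\<integral>\<^sup>+z. ennreal ((norm (V' z))\<^sup>2) \<partial>?N) < \<infinity>"
    using fin unfolding pair_norm_sq_integral(2)[OF V] by (simp add: V'_def)
  note facts = step_integral_facts[OF adm, folded I_def]
  have I [measurable]: "I k \<in> borel_measurable M" for k
    using facts(1) by auto
  have I_sq: "(\<integral>\<^sup>+\<omega>. ennreal ((I k \<omega>)\<^sup>2) \<partial>M) = (\<integral>\<^sup>+z. ennreal ((norm (v k z))\<^sup>2) \<partial>?N)" for k
    unfolding facts(3) pair_norm_sq_integral(2)[OF step_measurable[OF adm]] by (simp add: v_def)
  have I_diff: "(\<integral>\<^sup>+\<omega>. ennreal ((I k \<omega> - I l \<omega>)\<^sup>2) \<partial>M) \<le> 2 * e k + 2 * e l" for k l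
  proof -
    have m: "(\<lambda>(\<omega>, s). step (n k) (\<tau> k) (c k) s \<omega> - step (n l) (\<tau> l) (c l) s \<omega>) \<in> borel_measurable ?N"
      using borel_measurable_diff[OF v[of k] v[of l]] by (simp add: v_def case_prod_beta)
    have "(\<integral>\<^sup>+\<omega>. ennreal ((I k \<omega> - I l \<omega>)\<^sup>2) \<partial>M)
        = (\<integral>\<^sup>+z. ennreal ((norm ((v k z - V' z) - (v l z - V' z)))\<^sup>2) \<partial>?N)"
      unfolding I_def step_integral_diff[OF adm adm] pair_norm_sq_integral(2)[OF m]
      by (simp add: v_def case_prod_beta)
    also have "\<dots> \<le> 2 * e k + 2 * e l"
      unfolding e_def by (rule nn_integral_norm_sq_diff_le) measurable
    finally show ?thesis .
  qed
  \<comment> \<open>Fatou in \<open>l\<close> for fixed \<open>k\<close>; the contribution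
    \<open>2 * e l\<close> disappears in the limit.\<close>
  have I_J: "(\<integral>\<^sup>+\<omega>. ennreal ((I k \<omega> - J \<omega>)\<^sup>2) \<partial>M) \<le> 2 * e k" for k
  proof -
    have "(\<integral>\<^sup>+\<omega>. ennreal ((I k \<omega> - J \<omega>)\<^sup>2) \<partial>M)
        = (\<integral>\<^sup>+\<omega>. liminf (\<lambda>l. ennreal ((I k \<omega> - I l \<omega>)\<^sup>2)) \<partial>M)"
    proof (rule nn_integral_cong_AE)
      show "AE \<omega> in M. ennreal ((I k \<omega> - J \<omega>)\<^sup>2) = liminf (\<lambda>l. ennreal ((I k \<omega> - I l \<omega>)\<^sup>2))"
        using J_lim
      proof eventually_elim
        case (elim \<omega>)
        then have "(\<lambda>l. ennreal ((I k \<omega> - I l \<omega>)\<^sup>2)) \<longlonglongrightarrow> ennreal ((I k \<omega> - J \<omega>)\<^sup>2)"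
          unfolding I_def by (intro tendsto_ennrealI tendsto_intros)
        from lim_imp_Liminf[OF sequentially_bot this] show ?case by (rule sym)
      qed
    qed
    also have "\<dots> \<le> liminf (\<lambda>l. \<integral>\<^sup>+\<omega>. ennreal ((I k \<omega> - I l \<omega>)\<^sup>2) \<partial>M)"
      by (rule nn_integral_liminf) measurable
    also have "\<dots> \<le> liminf (\<lambda>l. 2 * e k + 2 * e l)"
      by (intro Liminf_mono always_eventually allI I_diff)
    also have "\<dots> = 2 * e k"
    proof -
      have "(\<lambda>l. 2 * e k + 2 * e l) \<longlonglongrightarrow> 2 * e k + 2 * 0"
        by (intro tendsto_add tendsto_const ennreal_tendsto_cmult e) auto
      then show ?thesis by (simp add: lim_imp_Liminf)
    qed
    finally show ?thesis .
  qed
  have I_lim: "(\<lambda>k. \<integral>\<^sup>+\<omega>. ennreal ((I k \<omega> - J \<omega>)\<^sup>2) \<partial>M) \<longlonglongrightarrow> 0"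
  proof (rule tendsto_sandwich[OF _ _ tendsto_const])
    have "(\<lambda>k. 2 * e k) \<longlonglongrightarrow> 2 * 0" by (intro ennreal_tendsto_cmult e) auto
    then show "(\<lambda>k. 2 * e k) \<longlonglongrightarrow> 0" by simp
  qed (use I_J in auto)
  have v_lim: "(\<lambda>k. \<integral>\<^sup>+z. ennreal ((norm (v k z))\<^sup>2) \<partial>?N) \<longlonglongrightarrow> (\<integral>\<^sup>+z. ennreal ((norm (V' z))\<^sup>2) \<partial>?N)"
    by (rule nn_integral_norm_sq_tendsto[OF v V' _ finV]) (use e in \<open>simp add: e_def[abs_def]\<close>)
  \<comment> \<open>\<open>J\<close> is a priori only measurable; writing it as
    \<open>I k - (I k - J)\<close> for one good \<open>k\<close> bounds its second moment.\<close>
  have finJ: "(\<integral>\<^sup>+\<omega>. ennreal ((norm (J \<omega>))\<^sup>2) \<partial>M) < \<infinity>"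
  proof -
    have "eventually (\<lambda>k. e k < 1 \<and> (\<integral>\<^sup>+z. ennreal ((norm (v k z))\<^sup>2) \<partial>?N) < \<infinity>) sequentially"
      using order_tendstoD(2)[OF e, of 1] order_tendstoD(2)[OF v_lim finV] by (simp add: eventually_conj)
    from eventually_happens'[OF sequentially_bot this] obtain k
      where k: "e k < 1" "(\<integral>\<^sup>+z. ennreal ((norm (v k z))\<^sup>2) \<partial>?N) < \<infinity>" by blast
    have "(\<integral>\<^sup>+\<omega>. ennreal ((norm (I k \<omega> - (I k \<omega> - J \<omega>)))\<^sup>2) \<partial>M)
        \<le> 2 * (\<integral>\<^sup>+\<omega>. ennreal ((norm (I k \<omega>))\<^sup>2) \<partial>M) + 2 * (\<integral>\<^sup>+\<omega>. ennreal ((norm (I k \<omega> - J \<omega>))\<^sup>2) \<partial>M)"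
      by (rule nn_integral_norm_sq_diff_le) measurable
    also have "\<dots> \<le> 2 * (\<integral>\<^sup>+z. ennreal ((norm (v k z))\<^sup>2) \<partial>?N) + 2 * (2 * e k)"
      using I_J[of k] by (intro add_mono mult_left_mono) (simp_all add: I_sq)
    also have "\<dots> < \<infinity>"
    proof -
      have "e k < \<infinity>" using k(1) by (rule order.strict_trans) simp
      with k(2) show ?thesis by (auto simp: ennreal_mult_less_top ennreal_add_less_top)
    qed
    finally show ?thesis by simp
  qed
  have "(\<lambda>k. \<integral>\<^sup>+\<omega>. ennreal ((norm (I k \<omega>))\<^sup>2) \<partial>M) \<longlonglongrightarrow> (\<integral>\<^sup>+\<omega>. ennreal ((norm (J \<omega>))\<^sup>2) \<partial>M)"
    by (rule nn_integral_norm_sq_tendsto[OF I J _ finJ]) (use I_lim in simp)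
  then have "(\<lambda>k. \<integral>\<^sup>+z. ennreal ((norm (v k z))\<^sup>2) \<partial>?N) \<longlonglongrightarrow> (\<integral>\<^sup>+\<omega>. ennreal ((J \<omega>)\<^sup>2) \<partial>M)"
    by (simp add: I_sq)
  from LIMSEQ_unique[OF this v_lim]
  show "(\<integral>\<^sup>+\<omega>. ennreal ((J \<omega>)\<^sup>2) \<partial>M) = (\<integral>\<^sup>+\<omega>. \<integral>\<^sup>+s. ennreal ((norm (V s \<omega>))\<^sup>2) \<partial>lborel \<partial>M)"
    unfolding pair_norm_sq_integral(2)[OF V] by (simp add: V'_def)
  have "integrable M (\<lambda>\<omega>. (J \<omega>)\<^sup>2)"
    by (rule integrableI_nonneg) (use finJ in simp_all)
  then show iJ: "integrable M J" by (rule square_integrable_imp_integrable[OF J])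
  show "expectation J = 0"
    by (rule expectation_eq_0_if_L2_limit[OF facts(1,2) iJ I_lim])
qed

text \<open>Predictability is given only for \<open>\<Phi> s \<omega> h\<close> with
  \<open>h\<close> fixed. Pairing the transformed integrand with \<open>h\<close> gives
  \<open>a \<bullet> \<Phi> s \<omega> (R h)\<close>, so weak measurability applies.\<close>

lemma integrand_measurable:
  assumes "has_stoch_integral M F Q W t \<Phi> I"
  shows "(\<lambda>(\<omega>, s). indicat_real {0..t} s *\<^sub>R R (adj (\<Phi> s \<omega>) a)) \<in> borel_measurable (M \<Otimes>\<^sub>M lborel)"
proof (rule borel_measurable_weak)
  fix h
  have "predictable M F (\<lambda>s \<omega>. indicat_real {0..t} s *\<^sub>R \<Phi> s \<omega> (R h))"
    using assms by (simp add: has_stoch_integral_def)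
  from predictable_imp_measurable[OF filtration this]
  have "(\<lambda>z. (case z of (\<omega>, s) \<Rightarrow> indicat_real {0..} s *\<^sub>R indicat_real {0..t} s *\<^sub>R \<Phi> s \<omega> (R h)) \<bullet> a)
      \<in> borel_measurable (M \<Otimes>\<^sub>M lborel)" by measurable
  moreover have "(case z of (\<omega>, s) \<Rightarrow> indicat_real {0..} s *\<^sub>R indicat_real {0..t} s *\<^sub>R \<Phi> s \<omega> (R h)) \<bullet> a
      = (case z of (\<omega>, s) \<Rightarrow> indicat_real {0..t} s *\<^sub>R R (adj (\<Phi> s \<omega>) a)) \<bullet> h" for z
    by (cases z) (simp add: R_adj adj_inner inner_commute[of _ a] indicator_def)
  ultimately show "(\<lambda>z. (case z of (\<omega>, s) \<Rightarrow> indicat_real {0..t} s *\<^sub>R R (adj (\<Phi> s \<omega>) a)) \<bullet> h)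
      \<in> borel_measurable (M \<Otimes>\<^sub>M lborel)" by simp
qed

text \<open>Applying the adjoint of each elementary coefficient to \<open>a\<close> produces
  admissible vector coefficients. Both convergences in probability become almost sure along a
  subsequence, and the two preceding limit results apply.\<close>

theorem ito_isometry:
  assumes si: "has_stoch_integral M F Q W t \<Phi> I"
    and fin: "(\<integral>\<^sup>+\<omega>. \<integral>\<^sup>+s. ennreal ((norm (indicat_real {0..t} s *\<^sub>R R (adj (\<Phi> s \<omega>) a)))\<^sup>2) \<partial>lborel \<partial>M) < \<infinity>"
  shows "integrable M (\<lambda>\<omega>. a \<bullet> I \<omega>)" "expectation (\<lambda>\<omega>. a \<bullet> I \<omega>) = 0"
    "(\<integral>\<^sup>+\<omega>. ennreal ((a \<bullet> I \<omega>)\<^sup>2) \<partial>M)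
      = (\<integral>\<^sup>+\<omega>. \<integral>\<^sup>+s. ennreal ((norm (indicat_real {0..t} s *\<^sub>R R (adj (\<Phi> s \<omega>) a)))\<^sup>2) \<partial>lborel \<partial>M)"
proof -
  define V where "V s \<omega> = indicat_real {0..t} s *\<^sub>R R (adj (\<Phi> s \<omega>) a)" for s \<omega>
  have V: "(\<lambda>(\<omega>, s). V s \<omega>) \<in> borel_measurable (M \<Otimes>\<^sub>M lborel)"
    unfolding V_def by (rule integrand_measurable[OF si])
  have [measurable]: "I \<in> borel_measurable M" using si by (simp add: has_stoch_integral_def)
  obtain n \<tau> c where el: "\<And>k. elementary F t (n k) (\<tau> k) (c k)"
    and hs: "null_in_probability M (\<lambda>k \<omega>. \<integral>\<^sup>+s\<in>{0..t}.
             hs_norm_sq ((elementary_process (n k) (\<tau> k) (c k) s \<omega> - \<Phi> s \<omega>) o\<^sub>L R) \<partial>lborel)"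
    and el_I: "null_in_probability M
          (\<lambda>k \<omega>. ennreal (norm (elementary_integral W (n k) (\<tau> k) (c k) \<omega> - I \<omega>)))"
    using si unfolding has_stoch_integral_def by blast
  obtain r where r: "strict_mono r" "AE \<omega> in M. (\<lambda>k. \<integral>\<^sup>+s\<in>{0..t}.
      hs_norm_sq ((elementary_process (n (r k)) (\<tau> (r k)) (c (r k)) s \<omega> - \<Phi> s \<omega>) o\<^sub>L R) \<partial>lborel) \<longlonglongrightarrow> 0"
    using null_in_probability_AE_subseq[OF hs] by blast
  \<comment> \<open>Extracted from the first subsequence, so that along it both limits hold almost
    surely.\<close>
  obtain r' where r': "strict_mono r'" "AE \<omega> in M. (\<lambda>k. ennreal (norm
      (elementary_integral W (n (r (r' k))) (\<tau> (r (r' k))) (c (r (r' k))) \<omega> - I \<omega>))) \<longlonglongrightarrow> 0"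
    using null_in_probability_AE_subseq[OF null_in_probability_subseq[OF el_I r(1)]] by blast
  define n' where "n' k = n (r (r' k))" for k
  define \<tau>' where "\<tau>' k = \<tau> (r (r' k))" for k
  define c' where "c' k = c (r (r' k))" for k
  have el': "elementary F t (n' k) (\<tau>' k) (c' k)" for k
    unfolding n'_def \<tau>'_def c'_def by (rule el)
  define d where "d k i \<omega> = adj (c' k i \<omega>) a" for k i \<omega>
  have adm: "admissible (n' k) (\<tau>' k) (d k)" for k
  proof -
    have "simple_function (F (\<tau>' k i)) (d k i)" if "i < n' k" for i
      using el'[of k] that simple_function_compose1[of "F (\<tau>' k i)" "c' k i" "\<lambda>T. adj T a"]
      by (simp add: elementary_def d_def[abs_def])
    then show ?thesis using el'[of k] by (simp add: admissible_def elementary_def)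
  qed
  have integral_eq: "step_integral (n' k) (\<tau>' k) (d k) \<omega> = a \<bullet> elementary_integral W (n' k) (\<tau>' k) (c' k) \<omega>" for k \<omega>
    by (simp add: step_integral_def elementary_integral_def d_def inner_commute[of _ "adj _ _"]
        adj_inner inner_sum_right)
  have step_eq: "step (n' k) (\<tau>' k) (d k) s \<omega> = R (adj (elementary_process (n' k) (\<tau>' k) (c' k) s \<omega>) a)" for k s \<omega>
    by (simp only: step_def elementary_process_def d_def adj_sum adj_scaleR)
  \<comment> \<open>Like \<open>V\<close>, the steps live on \<open>{0..t}\<close>, so integrals
    over the whole line can be compared with the given ones over \<open>{0..t}\<close>.\<close>
  have step_out: "step (n' k) (\<tau>' k) (d k) s \<omega> = 0" if "s \<notin> {0..t}" for k s \<omega>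
  proof -
    have "s \<notin> {\<tau>' k i<..\<tau>' k (Suc i)}" if "i < n' k" for i
    proof -
      have "\<tau>' k (Suc i) \<le> \<tau>' k (n' k)" "0 \<le> \<tau>' k i"
        using admissible_tau[OF adm[of k]] that by auto
      moreover have "\<tau>' k (n' k) \<le> t" using el'[of k] by (simp add: elementary_def)
      ultimately show ?thesis using \<open>s \<notin> {0..t}\<close> by auto
    qed
    then show ?thesis by (simp add: step_def blinfun.zero_right)
  qed
  \<comment> \<open>The summand 1 allows division by \<open>C\<close> when
    \<open>a = 0\<close>.\<close>
  define C where "C = (norm a)\<^sup>2 + 1"
  have C: "C > 0" by (simp add: C_def add_nonneg_pos)
  have onb: "\<exists>E::'h set. orthonormal_basis E" using covariance by (auto simp: covariance_operator_def)
  \<comment> \<open>The constant stays on the left: the Hilbert-Schmidt norms are not known to be measurable in \<open>s\<close>,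
     so it could not be pulled out of their integral.\<close>
  have pointwise: "ennreal (inverse C) * ennreal ((norm (step (n' k) (\<tau>' k) (d k) s \<omega> - V s \<omega>))\<^sup>2)
      \<le> hs_norm_sq ((elementary_process (n' k) (\<tau>' k) (c' k) s \<omega> - \<Phi> s \<omega>) o\<^sub>L R) * indicator {0..t} s" for k s \<omega>
  proof (cases "s \<in> {0..t}")
    case True
    let ?T = "(elementary_process (n' k) (\<tau>' k) (c' k) s \<omega> - \<Phi> s \<omega>) o\<^sub>L R"
    have "step (n' k) (\<tau>' k) (d k) s \<omega> - V s \<omega> = adj ?T a"
      using True by (simp add: step_eq V_def R_adj[symmetric] adj_diff blinfun.diff_right)
    then have "(norm (step (n' k) (\<tau>' k) (d k) s \<omega> - V s \<omega>))\<^sup>2 \<le> (norm ?T * norm a)\<^sup>2"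
      by (simp add: norm_adj_le power_mono)
    also have "\<dots> \<le> (norm ?T)\<^sup>2 * C" by (simp add: power_mult_distrib C_def mult_left_mono)
    finally have "inverse C * (norm (step (n' k) (\<tau>' k) (d k) s \<omega> - V s \<omega>))\<^sup>2 \<le> (norm ?T)\<^sup>2"
      using C by (simp add: field_simps)
    then have "ennreal (inverse C) * ennreal ((norm (step (n' k) (\<tau>' k) (d k) s \<omega> - V s \<omega>))\<^sup>2) \<le> ennreal ((norm ?T)\<^sup>2)"
      using C by (simp add: ennreal_mult'[symmetric] ennreal_leI)
    also have "\<dots> \<le> hs_norm_sq ?T" by (rule norm_sq_le_hs_norm_sq[OF onb])
    finally show ?thesis using True by simp
  next
    case False
    then show ?thesis by (simp add: step_out V_def)
  qed
  have D: "AE \<omega> in M. (\<lambda>k. \<integral>\<^sup>+s. ennreal ((norm (step (n' k) (\<tau>' k) (d k) s \<omega> - V s \<omega>))\<^sup>2) \<partial>lborel) \<longlonglongrightarrow> 0"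
    using r(2) AE_space
  proof eventually_elim
    case (elim \<omega>)
    let ?D = "\<lambda>k. \<integral>\<^sup>+s. ennreal ((norm (step (n' k) (\<tau>' k) (d k) s \<omega> - V s \<omega>))\<^sup>2) \<partial>lborel"
    have [measurable]: "(\<lambda>s. V s \<omega>) \<in> borel_measurable lborel"
      "(\<lambda>s. step (n' k) (\<tau>' k) (d k) s \<omega>) \<in> borel_measurable lborel" for k
      using pair_section_measurable[OF V elim(2)] pair_section_measurable[OF step_measurable[OF adm] elim(2)] by auto
    have "(\<lambda>k. ennreal (inverse C) * ?D k) \<longlonglongrightarrow> 0"
    proof (rule tendsto_sandwich[OF _ _ tendsto_const])
      show "(\<lambda>k. \<integral>\<^sup>+s\<in>{0..t}. hs_norm_sq ((elementary_process (n' k) (\<tau>' k) (c' k) s \<omega> - \<Phi> s \<omega>) o\<^sub>L R) \<partial>lborel) \<longlonglongrightarrow> 0"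
        unfolding n'_def \<tau>'_def c'_def
        using LIMSEQ_subseq_LIMSEQ[OF elim(1) r'(1)] by (simp add: o_def)
      show "eventually (\<lambda>k. ennreal (inverse C) * ?D k \<le> (\<integral>\<^sup>+s\<in>{0..t}.
          hs_norm_sq ((elementary_process (n' k) (\<tau>' k) (c' k) s \<omega> - \<Phi> s \<omega>) o\<^sub>L R) \<partial>lborel)) sequentially"
        by (intro always_eventually allI)
          (subst nn_integral_cmult[symmetric], measurable, intro nn_integral_mono pointwise)
    qed simp
    then have "(\<lambda>k. ennreal C * (ennreal (inverse C) * ?D k)) \<longlonglongrightarrow> ennreal C * 0"
      by (intro ennreal_tendsto_cmult) auto
    moreover have "ennreal C * (ennreal (inverse C) * x) = x" for x
      using C by (simp add: mult.assoc[symmetric] ennreal_mult'[symmetric])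
    ultimately show ?case by simp
  qed
  have J: "AE \<omega> in M. (\<lambda>k. step_integral (n' k) (\<tau>' k) (d k) \<omega>) \<longlonglongrightarrow> a \<bullet> I \<omega>"
    using r'(2)
  proof eventually_elim
    case (elim \<omega>)
    then have "(\<lambda>k. norm (elementary_integral W (n' k) (\<tau>' k) (c' k) \<omega> - I \<omega>)) \<longlonglongrightarrow> 0"
      unfolding n'_def \<tau>'_def c'_def using tendsto_enn2real[of _ 0] by fastforce
    then have "(\<lambda>k. elementary_integral W (n' k) (\<tau>' k) (c' k) \<omega>) \<longlonglongrightarrow> I \<omega>"
      by (simp add: tendsto_norm_zero_iff LIM_zero_iff)
    then show ?case unfolding integral_eq by (intro tendsto_intros)
  qed
  have fin': "(\<integral>\<^sup>+\<omega>. \<integral>\<^sup>+s. ennreal ((norm (V s \<omega>))\<^sup>2) \<partial>lborel \<partial>M) < \<infinity>" using fin by (simp add: V_def)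
  obtain m \<sigma> b where "\<And>k::nat. admissible (m k) (\<sigma> k) (b k)"
    "(\<lambda>k. \<integral>\<^sup>+\<omega>. \<integral>\<^sup>+s. ennreal ((norm (step (m k) (\<sigma> k) (b k) s \<omega> - V s \<omega>))\<^sup>2) \<partial>lborel \<partial>M) \<longlonglongrightarrow> 0"
    "AE \<omega> in M. (\<lambda>k. step_integral (m k) (\<sigma> k) (b k) \<omega>) \<longlonglongrightarrow> a \<bullet> I \<omega>"
    using ex_mean_square_approximation[OF adm V fin' D J] by blast
  note lim = step_integral_limit[OF this(1) V fin' this(2) _ this(3)]
  show "integrable M (\<lambda>\<omega>. a \<bullet> I \<omega>)" "expectation (\<lambda>\<omega>. a \<bullet> I \<omega>) = 0"
    by (rule lim, measurable)+
  show "(\<integral>\<^sup>+\<omega>. ennreal ((a \<bullet> I \<omega>)\<^sup>2) \<partial>M)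
      = (\<integral>\<^sup>+\<omega>. \<integral>\<^sup>+s. ennreal ((norm (indicat_real {0..t} s *\<^sub>R R (adj (\<Phi> s \<omega>) a)))\<^sup>2) \<partial>lborel \<partial>M)"
    using lim(3) by (simp add: V_def)
qed

end

subsection \<open>Evaluation functionals and second moments\<close>

text \<open>The increment of the function from 0 to \<open>x\<close> is at most the integral of
  \<open>|g|\<close> over the half-line, and \<open>|g| \<le> 1 / w + w g^2\<close> makes that bound
  independent of \<open>x\<close>. On the unit ball this additive estimate suffices; homogeneity
  does the rest.\<close>

lemma filipovic_evaluation_bounded:
  assumes w: "filipovic_weight w" and sp: "filipovic_space w \<delta>"
  shows "\<exists>C. \<forall>x\<ge>0. \<forall>h. \<bar>\<delta> x h\<bar> \<le> C * norm h"
proof -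
  have w1: "1 \<le> w x" if "0 \<le> x" for x
    using w that mono_onD[of "{0..}" w 0 x] by (simp add: filipovic_weight_def)
  have iw: "set_integrable lborel {0..} (\<lambda>x. inverse (w x))" using w by (simp add: filipovic_weight_def)
  have lin: "linear (\<delta> x)" if "0 \<le> x" for x using sp that by (simp add: filipovic_space_def)
  \<comment> \<open>One unit for the value at 0 and one for the weighted integral of
    \<open>g^2\<close>, both at most 1 on the unit ball.\<close>
  define C where "C = 2 + (LBINT x:{0..}. inverse (w x))"
  have unit: "\<bar>\<delta> x h\<bar> \<le> C" if x: "0 \<le> x" and h: "norm h \<le> 1" for x h
  proof -
    have "(\<lambda>x. \<delta> x h) \<in> filipovic_functions w"
      using sp by (auto simp: filipovic_space_def bij_betw_def)
    then obtain g where g: "has_weak_derivative (\<lambda>x. \<delta> x h) g"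
      and ig: "set_integrable lborel {0..} (\<lambda>x. w x * (g x)\<^sup>2)"
      by (auto simp: filipovic_functions_def)
    define L where "L = (LBINT x:{0..}. w x * (g x)\<^sup>2)"
    have L: "0 \<le> L"
      unfolding L_def set_lebesgue_integral_def
    proof (rule Bochner_Integration.integral_nonneg)
      show "0 \<le> indicat_real {0..} x *\<^sub>R (w x * (g x)\<^sup>2)" for x
        using w1[of x] by (cases "0 \<le> x") simp_all
    qed
    have norm_eq: "(norm h)\<^sup>2 = (\<delta> 0 h)\<^sup>2 + L"
      using sp g by (auto simp: filipovic_space_def L_def)
    have "(norm h)\<^sup>2 \<le> 1" using h by (simp add: power_le_one)
    then have d0: "(\<delta> 0 h)\<^sup>2 \<le> 1" and L1: "L \<le> 1" using norm_eq L zero_le_power2[of "\<delta> 0 h"] by linarith+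
    have d0': "\<bar>\<delta> 0 h\<bar> \<le> 1" using d0 by (simp add: abs_square_le_1)
    have sum: "set_integrable lborel {0..} (\<lambda>u. inverse (w u) + w u * (g u)\<^sup>2)"
      using iw ig by (rule set_integral_add)
    have gx: "set_integrable lborel {0..x} g" and eq: "\<delta> x h = \<delta> 0 h + (LBINT u:{0..x}. g u)"
      using g x unfolding has_weak_derivative_def by blast+
    have "\<bar>LBINT u:{0..x}. g u\<bar> \<le> (\<integral>u. \<bar>indicat_real {0..x} u *\<^sub>R g u\<bar> \<partial>lborel)"
      unfolding set_lebesgue_integral_def by (rule integral_abs_bound)
    also have "\<dots> \<le> (\<integral>u. indicat_real {0..} u *\<^sub>R (inverse (w u) + w u * (g u)\<^sup>2) \<partial>lborel)"
    proof (rule integral_mono)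
      show "integrable lborel (\<lambda>u. \<bar>indicat_real {0..x} u *\<^sub>R g u\<bar>)"
        using gx unfolding set_integrable_def by (rule integrable_abs)
      show "integrable lborel (\<lambda>u. indicat_real {0..} u *\<^sub>R (inverse (w u) + w u * (g u)\<^sup>2))"
        using sum unfolding set_integrable_def .
      fix u :: real
      have "\<bar>g u\<bar> \<le> inverse (w u) + w u * (g u)\<^sup>2" if "0 \<le> u"
      proof -
        have p: "0 < w u" using w1[OF that] by linarith
        have "0 \<le> (1 - w u * \<bar>g u\<bar>)\<^sup>2 / w u" using p by simp
        also have "\<dots> = inverse (w u) + w u * (g u)\<^sup>2 - 2 * \<bar>g u\<bar>"
          using p by (simp add: power2_diff field_simps power2_eq_square)
        finally show ?thesis by linarith
      qed
      moreover have "0 \<le> inverse (w u) + w u * (g u)\<^sup>2" if "0 \<le> u" using w1[OF that] by simp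
      ultimately show "\<bar>indicat_real {0..x} u *\<^sub>R g u\<bar>
          \<le> indicat_real {0..} u *\<^sub>R (inverse (w u) + w u * (g u)\<^sup>2)"
        by (auto simp: indicator_def)
    qed
    also have "\<dots> = (LBINT u:{0..}. inverse (w u)) + L"
      unfolding L_def using set_integral_add(2)[OF iw ig] by (simp add: set_lebesgue_integral_def)
    finally have "\<bar>LBINT u:{0..x}. g u\<bar> \<le> (LBINT u:{0..}. inverse (w u)) + 1" using L1 by linarith
    then show ?thesis unfolding C_def eq using d0' by linarith
  qed
  have "\<bar>\<delta> x h\<bar> \<le> C * norm h" if x: "0 \<le> x" for x h
  proof (cases "h = 0")
    case True
    then show ?thesis using linear_0[OF lin[OF x]] by simp
  next
    case False
    have "h = norm h *\<^sub>R (inverse (norm h) *\<^sub>R h)" using False by simp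
    then have "\<delta> x h = norm h * \<delta> x (inverse (norm h) *\<^sub>R h)"
      using linear_scale[OF lin[OF x], of "norm h" "inverse (norm h) *\<^sub>R h"] by simp
    moreover have "\<bar>\<delta> x (inverse (norm h) *\<^sub>R h)\<bar> \<le> C" using False by (intro unit x) simp
    ultimately show ?thesis
      using mult_left_mono[of "\<bar>\<delta> x (inverse (norm h) *\<^sub>R h)\<bar>" C "norm h"]
      by (simp add: abs_mult mult.commute)
  qed
  then show ?thesis by blast
qed

lemma filipovic_evaluation_representer:
  fixes \<delta> :: "real \<Rightarrow> 'h::{real_inner, banach} \<Rightarrow> real"
  assumes w: "filipovic_weight w" and sp: "filipovic_space w \<delta>"
  obtains a C where "\<And>x h. 0 \<le> x \<Longrightarrow> \<delta> x h = a x \<bullet> h" "\<And>x. 0 \<le> x \<Longrightarrow> norm (a x) \<le> C" "0 \<le> C"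
proof -
  obtain C where C: "\<And>x h. 0 \<le> x \<Longrightarrow> \<bar>\<delta> x h\<bar> \<le> C * norm h"
    using filipovic_evaluation_bounded[OF assms] by blast
  have "\<exists>v. \<forall>h. \<delta> x h = v \<bullet> h" if "0 \<le> x" for x
  proof (rule riesz_representation)
    have "linear (\<delta> x)" using sp that by (simp add: filipovic_space_def)
    then show "bounded_linear (\<delta> x)"
      using C[OF that] by (intro bounded_linear_intro[of _ C]) (auto simp: linear_add linear_scale mult.commute)
  qed
  then obtain a where a: "\<And>x h. 0 \<le> x \<Longrightarrow> \<delta> x h = a x \<bullet> h" by metis
  have "norm (a x) \<le> max C 0" if "0 \<le> x" for x
  proof -
    have "norm (a x) * norm (a x) = \<delta> x (a x)" by (simp add: a[OF that] norm_eq_sqrt_inner)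
    also have "\<dots> \<le> C * norm (a x)" using C[OF that, of "a x"] by simp
    finally have "norm (a x) * norm (a x) \<le> C * norm (a x)" .
    then show ?thesis by (cases "a x = 0") (auto simp: mult_le_cancel_right)
  qed
  with a that[of a "max C 0"] show thesis by simp
qed

context wiener
begin

text \<open>The integrand is deterministic, and semigroup bounds on \<open>{0..t}\<close> make its
  energy finite. Uniformity over the functionals \<open>b\<close> is required because the functional
  applied to \<open>Y s\<close> will change with \<open>s\<close>.\<close>

lemma mild_solution_second_moment:
  assumes U: "c0_semigroup U" and sol: "mild_solution M F Q W U x\<^sub>0 (\<lambda>s \<omega>. \<eta>) X"
  shows "\<exists>c. \<forall>s\<in>{0..t}. \<forall>b. norm b \<le> C \<longrightarrow> (\<integral>\<^sup>+\<omega>. ennreal ((b \<bullet> X s \<omega>)\<^sup>2) \<partial>M) \<le> ennreal c"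
proof -
  obtain K where K: "0 \<le> K" "\<And>u. 0 \<le> u \<Longrightarrow> u \<le> t \<Longrightarrow> norm (U u) \<le> K"
    using c0_semigroup_locally_bounded[OF U] by blast
  \<comment> \<open>Bounds the transformed integrand pointwise; in \<open>c\<close> below, the noise
    and the initial value enter with the factor 2 from
    \<open>(u + v)^2 \<le> 2 u^2 + 2 v^2\<close>.\<close>
  define k where "k = norm R * (K * norm \<eta> * C)"
  define c where "c = 2 * (k\<^sup>2 * t) + 2 * (C * (K * norm x\<^sub>0))\<^sup>2"
  have "(\<integral>\<^sup>+\<omega>. ennreal ((b \<bullet> X s \<omega>)\<^sup>2) \<partial>M) \<le> ennreal c" if s: "s \<in> {0..t}" and b: "norm b \<le> C" for s b
  proof -
    have C: "0 \<le> C" using b norm_ge_zero[of b] by linarith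
    let ?I = "\<lambda>\<omega>. X s \<omega> - U s x\<^sub>0"
    have si: "has_stoch_integral M F Q W s (\<lambda>r \<omega>. U (s - r) o\<^sub>L \<eta>) ?I"
      using sol s by (simp add: mild_solution_def)
    have [measurable]: "?I \<in> borel_measurable M" using si by (simp add: has_stoch_integral_def)
    have "norm (R (adj (U (s - r) o\<^sub>L \<eta>) b)) \<le> k" if "r \<in> {0..s}" for r
    proof -
      have "norm (R (adj (U (s - r) o\<^sub>L \<eta>) b)) \<le> norm R * norm (adj (U (s - r) o\<^sub>L \<eta>) b)"
        by (rule norm_blinfun)
      also have "\<dots> \<le> norm R * (norm (U (s - r) o\<^sub>L \<eta>) * norm b)"
        by (intro mult_left_mono norm_adj_le) simp
      also have "\<dots> \<le> norm R * ((norm (U (s - r)) * norm \<eta>) * norm b)"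
        by (intro mult_left_mono mult_right_mono norm_blinfun_compose) simp_all
      also have "\<dots> \<le> k"
        unfolding k_def using that s b K C by (intro mult_mono K(2)) auto
      finally show ?thesis .
    qed
    then have "ennreal ((norm (indicat_real {0..s} r *\<^sub>R R (adj (U (s - r) o\<^sub>L \<eta>) b)))\<^sup>2)
        \<le> ennreal (k\<^sup>2) * indicator {0..s} r" for r
      by (auto simp: indicator_def intro!: ennreal_leI power_mono)
    then have "(\<integral>\<^sup>+r. ennreal ((norm (indicat_real {0..s} r *\<^sub>R R (adj (U (s - r) o\<^sub>L \<eta>) b)))\<^sup>2) \<partial>lborel)
        \<le> (\<integral>\<^sup>+r. ennreal (k\<^sup>2) * indicator {0..s} r \<partial>lborel)" by (rule nn_integral_mono)
    also have "\<dots> = ennreal (k\<^sup>2 * s)"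
      using s by (simp add: nn_integral_cmult_indicator ennreal_mult')
    also have "\<dots> \<le> ennreal (k\<^sup>2 * t)" using s by (intro ennreal_leI mult_left_mono) auto
    finally have "(\<integral>\<^sup>+\<omega>. \<integral>\<^sup>+r. ennreal ((norm (indicat_real {0..s} r *\<^sub>R R (adj (U (s - r) o\<^sub>L \<eta>) b)))\<^sup>2) \<partial>lborel \<partial>M)
        \<le> (\<integral>\<^sup>+\<omega>. ennreal (k\<^sup>2 * t) \<partial>M)" by (intro nn_integral_mono)
    then have le: "(\<integral>\<^sup>+\<omega>. \<integral>\<^sup>+r. ennreal ((norm (indicat_real {0..s} r *\<^sub>R R (adj (U (s - r) o\<^sub>L \<eta>) b)))\<^sup>2) \<partial>lborel \<partial>M)
        \<le> ennreal (k\<^sup>2 * t)" by (simp add: emeasure_space_1)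
    then have le2: "(\<integral>\<^sup>+\<omega>. ennreal ((b \<bullet> ?I \<omega>)\<^sup>2) \<partial>M) \<le> ennreal (k\<^sup>2 * t)"
      using ito_isometry(3)[OF si] by (simp add: le_less_trans)
    have "\<bar>b \<bullet> U s x\<^sub>0\<bar> \<le> norm b * norm (U s x\<^sub>0)" by (rule Cauchy_Schwarz_ineq2)
    also have "\<dots> \<le> C * (K * norm x\<^sub>0)"
      using s b C K by (intro mult_mono order.trans[OF norm_blinfun]) auto
    finally have "(b \<bullet> U s x\<^sub>0)\<^sup>2 \<le> (C * (K * norm x\<^sub>0))\<^sup>2" by (rule power2_le_iff_abs_le[THEN iffD2, rotated]) (use C K in auto)
    then have "2 * (\<integral>\<^sup>+\<omega>. ennreal ((b \<bullet> U s x\<^sub>0)\<^sup>2) \<partial>M) \<le> 2 * ennreal ((C * (K * norm x\<^sub>0))\<^sup>2)"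
      by (intro mult_left_mono) (simp_all add: emeasure_space_1)
    moreover have "(\<integral>\<^sup>+\<omega>. ennreal ((norm (b \<bullet> ?I \<omega> + b \<bullet> U s x\<^sub>0))\<^sup>2) \<partial>M)
        \<le> 2 * (\<integral>\<^sup>+\<omega>. ennreal ((norm (b \<bullet> ?I \<omega>))\<^sup>2) \<partial>M) + 2 * (\<integral>\<^sup>+\<omega>. ennreal ((norm (b \<bullet> U s x\<^sub>0))\<^sup>2) \<partial>M)"
      by (rule nn_integral_norm_sq_add_le) measurable
    ultimately have "(\<integral>\<^sup>+\<omega>. ennreal ((b \<bullet> X s \<omega>)\<^sup>2) \<partial>M)
        \<le> 2 * ennreal (k\<^sup>2 * t) + 2 * ennreal ((C * (K * norm x\<^sub>0))\<^sup>2)"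
      using le2 by (simp add: inner_diff_right) (meson add_mono mult_left_mono order.trans zero_le)
    also have "\<dots> = ennreal c" unfolding c_def using s by (simp add: ennreal_mult')
    finally show ?thesis .
  qed
  then show ?thesis by blast
qed

end

section \<open>The covariance of two forward prices\<close>

theorem corollary10:
  fixes M :: "'o measure" and F :: "real \<Rightarrow> 'o measure"
    and w :: "real \<Rightarrow> real"
    and \<delta> :: "real \<Rightarrow> 'h::{real_inner, banach, second_countable_topology} \<Rightarrow> real"
    and W B :: "real \<Rightarrow> 'o \<Rightarrow> 'h" and Q\<^sub>W Q\<^sub>B :: "'h \<Rightarrow>\<^sub>L 'h"
    and D\<^sub>A D\<^sub>C :: "'h set" and A C :: "'h \<Rightarrow> 'h" and U S :: "real \<Rightarrow> 'h \<Rightarrow>\<^sub>L 'h"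
    and \<eta> :: "'h \<Rightarrow>\<^sub>L 'h" and Y\<^sub>0 X\<^sub>0 :: 'h
    and Y Z X :: "real \<Rightarrow> 'o \<Rightarrow> 'h"
    and x y t :: real
  assumes "prob_space M" and "is_filtration M F"
    and "filipovic_weight w" and "filipovic_space w \<delta>"
    and "covariance_operator Q\<^sub>W" and "wiener_process M F Q\<^sub>W W"
    and "covariance_operator Q\<^sub>B" and "wiener_process M F Q\<^sub>B B"
    and "independent_processes M W B"
    and "closure D\<^sub>A = UNIV" and "generates D\<^sub>A A U"
    and "predictable M F Y"
    and "mild_solution M F Q\<^sub>W W U Y\<^sub>0 (\<lambda>s \<omega>. \<eta>) Y"
    and "adapted F Z" and "predictable M F Z"
    and "\<And>s. s \<ge> 0 \<Longrightarrow> AE \<omega> in M. norm (Z s \<omega>) = 1"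
    and "derivative_operator \<delta> D\<^sub>C C" and "left_shift \<delta> S" and "generates D\<^sub>C C S"
    and "mild_solution M F Q\<^sub>B B S X\<^sub>0 (\<lambda>s \<omega>. tensor (Z s \<omega>) (Y s \<omega>)) X"
    and "x \<ge> 0" and "y \<ge> 0" and "t \<ge> 0"
  shows "covariance M (\<lambda>\<omega>. \<delta> x (X t \<omega>)) (\<lambda>\<omega>. \<delta> y (X t \<omega>)) =
    (\<integral>\<omega>. (LBINT s:{0..t}. (norm (op_sqrt Q\<^sub>B (Z s \<omega>)))\<^sup>2 *
        \<delta> (x + t - s) (Y s \<omega>) * \<delta> (y + t - s) (Y s \<omega>)) \<partial>M)"
proof -
  interpret WW: wiener M F W Q\<^sub>W by (intro wiener.intro wiener_axioms.intro assms)
  interpret BB: wiener M F B Q\<^sub>B by (intro wiener.intro wiener_axioms.intro assms)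
  interpret P: pair_sigma_finite M "lborel :: real measure" ..
  let ?N = "M \<Otimes>\<^sub>M (lborel :: real measure)"
  let ?R = "op_sqrt Q\<^sub>B"
  \<comment> \<open>From here on \<open>C\<close> is the uniform bound on the representing vectors
    and hides the derivative operator of the same name.\<close>
  obtain a C where a: "\<And>z h. 0 \<le> z \<Longrightarrow> \<delta> z h = a z \<bullet> h" and aC: "\<And>z. 0 \<le> z \<Longrightarrow> norm (a z) \<le> C" and C: "0 \<le> C"
    using filipovic_evaluation_representer[OF assms(3,4)] by blast
  have U: "c0_semigroup U" using assms(11) by (simp add: generates_def)
  obtain c where c: "\<And>s b. s \<in> {0..t} \<Longrightarrow> norm b \<le> C \<Longrightarrow> (\<integral>\<^sup>+\<omega>. ennreal ((b \<bullet> Y s \<omega>)\<^sup>2) \<partial>M) \<le> ennreal c"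
    using WW.mild_solution_second_moment[OF U assms(13), of t C] by blast
  have Y_meas: "Y s \<in> borel_measurable M" if "0 \<le> s" for s
  proof -
    have "has_stoch_integral M F Q\<^sub>W W s (\<lambda>r \<omega>. U (s - r) o\<^sub>L \<eta>) (\<lambda>\<omega>. Y s \<omega> - U s Y\<^sub>0)"
      using assms(13) that by (simp add: mild_solution_def)
    then have "(\<lambda>\<omega>. Y s \<omega> - U s Y\<^sub>0) \<in> borel_measurable M" by (simp add: has_stoch_integral_def)
    then have "(\<lambda>\<omega>. (Y s \<omega> - U s Y\<^sub>0) + U s Y\<^sub>0) \<in> borel_measurable M" by measurable
    then show ?thesis by simp
  qed
  define I where "I \<omega> = X t \<omega> - S t X\<^sub>0" for \<omega>
  define \<Phi> where "\<Phi> s \<omega> = S (t - s) o\<^sub>L tensor (Z s \<omega>) (Y s \<omega>)" for s \<omega>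
  have si: "has_stoch_integral M F Q\<^sub>B B t \<Phi> I"
    using assms(20,23) by (simp add: mild_solution_def \<Phi>_def[abs_def] I_def[abs_def])
  define p where "p s \<omega> = \<delta> (x + t - s) (Y s \<omega>)" for s \<omega>
  define q where "q s \<omega> = \<delta> (y + t - s) (Y s \<omega>)" for s \<omega>
  \<comment> \<open>One family serves all purposes: \<open>b 0\<close> and \<open>b 1 - b 0\<close>
    represent evaluation at \<open>x\<close> and \<open>y\<close>, and \<open>b 1\<close>,
    \<open>b (- 1)\<close> polarize the product.\<close>
  define b where "b \<sigma> = a x + \<sigma> *\<^sub>R a y" for \<sigma>
  define f where "f \<sigma> s \<omega> = indicat_real {0..t} s * ((norm (?R (Z s \<omega>)))\<^sup>2 * (p s \<omega> + \<sigma> * q s \<omega>)\<^sup>2)" for \<sigma> s \<omega>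
  have f_eq: "(norm (indicat_real {0..t} s *\<^sub>R ?R (adj (\<Phi> s \<omega>) (b \<sigma>))))\<^sup>2 = f \<sigma> s \<omega>" for \<sigma> s \<omega>
  proof (cases "s \<in> {0..t}")
    case True
    have S: "a z \<bullet> S (t - s) h = \<delta> (z + t - s) h" if "0 \<le> z" for z h
      using True assms(18) that by (simp add: left_shift_def a[symmetric] add_diff_eq)
    \<comment> \<open>\<open>\<Phi> s \<omega>\<close> has rank at most one: it sends
      \<open>h\<close> to \<open>Z s \<omega> \<bullet> h\<close> times the shifted
      \<open>Y s \<omega>\<close>. Its adjoint is a multiple of \<open>Z s \<omega>\<close>, with
      factor the pairing of \<open>b \<sigma>\<close> and the shifted vector.\<close>
    have "adj (\<Phi> s \<omega>) (b \<sigma>) = (p s \<omega> + \<sigma> * q s \<omega>) *\<^sub>R Z s \<omega>"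
      by (rule adj_eqI) (simp add: \<Phi>_def b_def tensor_apply blinfun.scaleR_right inner_add_left
          S assms(21,22) p_def q_def algebra_simps)
    then show ?thesis using True
      by (simp add: f_def blinfun.scaleR_right power_mult_distrib mult.commute)
  qed (simp add: f_def)
  have f_meas [measurable]: "(\<lambda>(\<omega>, s). f \<sigma> s \<omega>) \<in> borel_measurable ?N" for \<sigma>
  proof -
    have "(\<lambda>z. (norm ((\<lambda>(\<omega>, s). indicat_real {0..t} s *\<^sub>R ?R (adj (\<Phi> s \<omega>) (b \<sigma>))) z))\<^sup>2) \<in> borel_measurable ?N"
      using BB.integrand_measurable[OF si, of "b \<sigma>"] by measurable
    then show ?thesis unfolding f_eq[symmetric] by (simp add: case_prod_beta)
  qed
  have f_nonneg: "0 \<le> f \<sigma> s \<omega>" for \<sigma> s \<omega> by (simp add: f_def)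
  have fin: "(\<integral>\<^sup>+\<omega>. \<integral>\<^sup>+s. ennreal (f \<sigma> s \<omega>) \<partial>lborel \<partial>M) < \<infinity>" for \<sigma>
  proof -
    define L where "L = ennreal ((norm ?R)\<^sup>2) * (2 * ennreal c + 2 * (ennreal (\<sigma>\<^sup>2) * ennreal c))"
    \<comment> \<open>For a fixed time \<open>Z s\<close> has norm 1 almost surely, so
      \<open>norm ?R\<close> bounds the first factor. The rest of \<open>L\<close> comes from
      \<open>(p + \<sigma> q)^2 \<le> 2 p^2 + 2 \<sigma>^2 q^2\<close> and the moment bound
      \<open>c\<close>.\<close>
    have slice: "(\<integral>\<^sup>+\<omega>. ennreal (f \<sigma> s \<omega>) \<partial>M) \<le> L * indicator {0..t} s" for s
    proof (cases "s \<in> {0..t}")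
      case True
      then have s: "0 \<le> s" "0 \<le> x + t - s" "0 \<le> y + t - s" using assms(21,22) by auto
      note [measurable] = Y_meas[OF s(1)]
      have pq: "p s \<omega> = a (x + t - s) \<bullet> Y s \<omega>" "q s \<omega> = a (y + t - s) \<bullet> Y s \<omega>" for \<omega>
        using a s by (simp_all add: p_def q_def)
      have [measurable]: "p s \<in> borel_measurable M" "q s \<in> borel_measurable M"
        unfolding pq[abs_def] by measurable
      have "AE \<omega> in M. ennreal (f \<sigma> s \<omega>)
          \<le> ennreal ((norm ?R)\<^sup>2) * ennreal ((norm (p s \<omega> + \<sigma> * q s \<omega>))\<^sup>2)"
        using assms(16)[OF s(1)]
      proof eventually_elim
        case (elim \<omega>)
        have "norm (?R (Z s \<omega>)) \<le> norm ?R" using norm_blinfun[of ?R "Z s \<omega>"] elim by simp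
        then have "(norm (?R (Z s \<omega>)))\<^sup>2 \<le> (norm ?R)\<^sup>2" by (intro power_mono) auto
        then have "f \<sigma> s \<omega> \<le> (norm ?R)\<^sup>2 * (norm (p s \<omega> + \<sigma> * q s \<omega>))\<^sup>2"
          using True by (simp add: f_def mult_right_mono)
        then show ?case by (simp add: ennreal_mult'[symmetric] ennreal_leI)
      qed
      then have "(\<integral>\<^sup>+\<omega>. ennreal (f \<sigma> s \<omega>) \<partial>M)
          \<le> (\<integral>\<^sup>+\<omega>. ennreal ((norm ?R)\<^sup>2) * ennreal ((norm (p s \<omega> + \<sigma> * q s \<omega>))\<^sup>2) \<partial>M)"
        by (rule nn_integral_mono_AE)
      also have "\<dots> = ennreal ((norm ?R)\<^sup>2) * (\<integral>\<^sup>+\<omega>. ennreal ((norm (p s \<omega> + \<sigma> * q s \<omega>))\<^sup>2) \<partial>M)"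
        by (rule nn_integral_cmult) measurable
      also have "\<dots> \<le> ennreal ((norm ?R)\<^sup>2) * (2 * (\<integral>\<^sup>+\<omega>. ennreal ((norm (p s \<omega>))\<^sup>2) \<partial>M)
          + 2 * (\<integral>\<^sup>+\<omega>. ennreal ((norm (\<sigma> * q s \<omega>))\<^sup>2) \<partial>M))"
        by (intro mult_left_mono nn_integral_norm_sq_add_le) simp_all
      also have "(\<integral>\<^sup>+\<omega>. ennreal ((norm (\<sigma> * q s \<omega>))\<^sup>2) \<partial>M)
          = ennreal (\<sigma>\<^sup>2) * (\<integral>\<^sup>+\<omega>. ennreal ((norm (q s \<omega>))\<^sup>2) \<partial>M)"
        by (subst nn_integral_cmult[symmetric]) (simp_all add: power_mult_distrib ennreal_mult')
      also have "ennreal ((norm ?R)\<^sup>2) * (2 * (\<integral>\<^sup>+\<omega>. ennreal ((norm (p s \<omega>))\<^sup>2) \<partial>M)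
          + 2 * (ennreal (\<sigma>\<^sup>2) * (\<integral>\<^sup>+\<omega>. ennreal ((norm (q s \<omega>))\<^sup>2) \<partial>M))) \<le> L"
        unfolding L_def pq real_norm_def power2_abs
        by (intro mult_left_mono add_mono c True aC s) simp_all
      finally show ?thesis using True by simp
    qed (simp add: f_def)
    have "(\<integral>\<^sup>+\<omega>. \<integral>\<^sup>+s. ennreal (f \<sigma> s \<omega>) \<partial>lborel \<partial>M) = (\<integral>\<^sup>+s. \<integral>\<^sup>+\<omega>. ennreal (f \<sigma> s \<omega>) \<partial>M \<partial>lborel)"
      by (rule P.Fubini'[symmetric]) measurable
    also have "\<dots> \<le> (\<integral>\<^sup>+s. L * indicator {0..t} s \<partial>lborel)"
      by (intro nn_integral_mono slice)
    also have "\<dots> = L * ennreal t" using assms(23) by (simp add: nn_integral_cmult_indicator)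
    also have "\<dots> < \<infinity>" by (simp add: L_def ennreal_mult_less_top ennreal_add_less_top)
    finally show ?thesis .
  qed
  note iso = BB.ito_isometry[OF si, where a="b _", unfolded f_eq, OF fin]
  have f_int: "integrable ?N (\<lambda>(\<omega>, s). f \<sigma> s \<omega>)" for \<sigma>
  proof (rule integrableI_nonneg)
    have "(\<integral>\<^sup>+z. ennreal (case z of (\<omega>, s) \<Rightarrow> f \<sigma> s \<omega>) \<partial>?N) = (\<integral>\<^sup>+\<omega>. \<integral>\<^sup>+s. ennreal (f \<sigma> s \<omega>) \<partial>lborel \<partial>M)"
      by (subst lborel.nn_integral_fst[symmetric]) simp_all
    then show "(\<integral>\<^sup>+z. ennreal (case z of (\<omega>, s) \<Rightarrow> f \<sigma> s \<omega>) \<partial>?N) < \<infinity>" using fin by simp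
  qed (auto simp: f_nonneg)
  have sq: "integrable M (\<lambda>\<omega>. (b \<sigma> \<bullet> I \<omega>)\<^sup>2)"
    "(\<integral>\<omega>. (b \<sigma> \<bullet> I \<omega>)\<^sup>2 \<partial>M) = (\<integral>z. (case z of (\<omega>, s) \<Rightarrow> f \<sigma> s \<omega>) \<partial>?N)" for \<sigma>
  proof -
    have "(\<integral>\<^sup>+z. ennreal (case z of (\<omega>, s) \<Rightarrow> f \<sigma> s \<omega>) \<partial>?N) = (\<integral>\<^sup>+\<omega>. ennreal ((b \<sigma> \<bullet> I \<omega>)\<^sup>2) \<partial>M)"
      unfolding iso(3) by (subst lborel.nn_integral_fst[symmetric]) simp_all
    moreover have "(\<lambda>\<omega>. (b \<sigma> \<bullet> I \<omega>)\<^sup>2) \<in> borel_measurable M" using iso(1)[of \<sigma>] by measurable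
    ultimately show "integrable M (\<lambda>\<omega>. (b \<sigma> \<bullet> I \<omega>)\<^sup>2)"
      "(\<integral>\<omega>. (b \<sigma> \<bullet> I \<omega>)\<^sup>2 \<partial>M) = (\<integral>z. (case z of (\<omega>, s) \<Rightarrow> f \<sigma> s \<omega>) \<partial>?N)"
      using iso(3)[of \<sigma>] fin[of \<sigma>]
      by (auto intro!: integrableI_nonneg simp: integral_eq_nn_integral f_nonneg split_beta)
  qed
  have ax: "a x \<bullet> I \<omega> = b 0 \<bullet> I \<omega>" and ay: "a y \<bullet> I \<omega> = b 1 \<bullet> I \<omega> - b 0 \<bullet> I \<omega>" for \<omega>
    by (simp_all add: b_def inner_add_left)
  have X_eq: "\<delta> z (X t \<omega>) = a z \<bullet> S t X\<^sub>0 + a z \<bullet> I \<omega>" if "0 \<le> z" for z \<omega>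
    using a[OF that] by (simp add: I_def inner_diff_right)
  have mean: "(\<integral>\<omega>. \<delta> x (X t \<omega>) \<partial>M) = a x \<bullet> S t X\<^sub>0" "(\<integral>\<omega>. \<delta> y (X t \<omega>) \<partial>M) = a y \<bullet> S t X\<^sub>0"
    using iso(1,2) by (simp_all add: X_eq assms(21,22) ax ay WW.prob_space)
  \<comment> \<open>The deterministic part is the mean, so centring leaves the stochastic integral
    alone.\<close>
  have "covariance M (\<lambda>\<omega>. \<delta> x (X t \<omega>)) (\<lambda>\<omega>. \<delta> y (X t \<omega>)) = (\<integral>\<omega>. (a x \<bullet> I \<omega>) * (a y \<bullet> I \<omega>) \<partial>M)"
    unfolding covariance_def mean by (simp add: X_eq assms(21,22))
  also have "\<dots> = (\<integral>\<omega>. ((b 1 \<bullet> I \<omega>)\<^sup>2 - (b (- 1) \<bullet> I \<omega>)\<^sup>2) / 4 \<partial>M)"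
    by (intro Bochner_Integration.integral_cong refl)
      (simp add: b_def inner_add_left inner_diff_left power2_eq_square algebra_simps)
  also have "\<dots> = ((\<integral>z. (case z of (\<omega>, s) \<Rightarrow> f 1 s \<omega>) \<partial>?N) - (\<integral>z. (case z of (\<omega>, s) \<Rightarrow> f (- 1) s \<omega>) \<partial>?N)) / 4"
    using sq by simp
  also have "\<dots> = (\<integral>z. ((case z of (\<omega>, s) \<Rightarrow> f 1 s \<omega>) - (case z of (\<omega>, s) \<Rightarrow> f (- 1) s \<omega>)) / 4 \<partial>?N)"
    by (simp only: integral_divide_zero Bochner_Integration.integral_diff[OF f_int f_int])
  also have "\<dots> = (\<integral>z. (case z of (\<omega>, s) \<Rightarrow> (f 1 s \<omega> - f (- 1) s \<omega>) / 4) \<partial>?N)"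
    by (simp add: case_prod_beta)
  \<comment> \<open>The polarized integrand may change sign; Fubini applies because it is a
    difference of two integrable functions.\<close>
  also have "\<dots> = (\<integral>\<omega>. \<integral>s. (f 1 s \<omega> - f (- 1) s \<omega>) / 4 \<partial>lborel \<partial>M)"
    using integrable_divide_zero[OF Bochner_Integration.integrable_diff[OF f_int[of 1] f_int[of "- 1"]], of 4]
    by (intro P.integral_fst[symmetric]) (simp add: case_prod_beta')
  also have "\<dots> = (\<integral>\<omega>. (LBINT s:{0..t}. (norm (?R (Z s \<omega>)))\<^sup>2 * p s \<omega> * q s \<omega>) \<partial>M)"
    unfolding set_lebesgue_integral_def
    by (intro Bochner_Integration.integral_cong refl)
      (simp add: f_def power2_eq_square algebra_simps)
  finally show ?thesis by (simp add: p_def q_def)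
qed

end
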